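(* Let $q$ be a prime power, let $n$ be an even positive integer and let $\alpha=0.08$. Let $Z_t$ and $Y_t=Y_t^{(n)}$ be the processes defined in the context, and assume that $Y^{(n)}_0=Z_0=a$, where $a\in\mathbb{Z}$ is a deterministic constant satisfying $|a|\le 2\alpha n$. Then there is a coupling of the processes $(Z_t)$ and $(Y_t)$ such that with probability at least $1-O(q^{-2\alpha n})$ all of the following hold: (a) for all integers $0\le i\le q^{2\alpha n}$, we have $\widehat{Y}_i=\widehat{Z}_i$; (b) for all integers $0\le i\le q^{2\alpha n}$, we have $|R_i-T_i|\le q^{-\alpha n}$; (c) $T_{\lfloor q^{2\alpha n}\rfloor}\ge q^{\alpha n}$. Here the constant implied by $O(\cdot)$ depends only on $q$.
   Context: $(a;q)_r=\prod_{i=0}^{r-1}(1-aq^i)$. $(X_i)_{i\ge0}=(X_i^{(n)})_{i\ge 0}$ is a discrete time Markov chain on $\{0,1,\dots,n\}$ with transition matrix $$P_n(d,r)=\mathbf{1}(d+r\le n)\,q^{-(n-d-r)(n-r)}\frac{(q^{-(n-d)};q)_r(q^{-n};q)_r}{(q^{-r};q)_r}.$$ For real $t\ge 0$, $Y_t=Y^{(n)}_t=X_{2\lfloor q^{n/2}(q-1)t\rfloor}-n/2$. Its jump times are $R_0=0$ and $R_i=\inf\{t>R_{i-1}: Y_t\ne Y_{R_{i-1}}\}$, and $\widehat{Y}_i=Y_{R_i}$. $(Z_t)_{t\ge 0}$ is the continuous time Markov chain on $\mathbb{Z}$ with transition rates $Q_Z(a,a+1)=q^{-a}$, $Q_Z(a,a-1)=q^{a}$,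 $Q_Z(a,a)=-q^a-q^{-a}$, and $Q_Z(a,b)=0$ otherwise (it has no explosions). Its jump times are $T_0=0$ and $T_i=\inf\{t>T_{i-1}: Z_t\ne Z_{T_{i-1}}\}$, and $\widehat{Z}_i=Z_{T_i}$. *)

theory Defs
  imports "HOL-Probability.Probability" "HOL-Number_Theory.Prime_Powers"
begin

section \<open>Markov chains in discrete and continuous time\<close>

definition discrete_markov_chain ::
    "'w measure \<Rightarrow> 's set \<Rightarrow> ('s \<Rightarrow> 's \<Rightarrow> real) \<Rightarrow> (nat \<Rightarrow> 'w \<Rightarrow> 's) \<Rightarrow> bool" where
  "discrete_markov_chain M S P X \<longleftrightarrow>
     prob_space M \<and>
     (\<forall>i. X i \<in> measurable M (count_space S)) \<and>
     (\<forall>k. \<forall>x :: nat \<Rightarrow> 's. (\<forall>i \<le> Suc k. x i \<in> S) \<longrightarrow>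
        \<P>(\<omega> in M. \<forall>i\<le>k. X i \<omega> = x i) > 0 \<longrightarrow>
        \<P>(\<omega> in M. X (Suc k) \<omega> = x (Suc k) \<bar> \<forall>i\<le>k. X i \<omega> = x i) = P (x k) (x (Suc k)))"

text \<open>
  Jump times and jump chain of a path indexed by the times \<open>t \<ge> 0\<close>. Jump times are extended
  reals: the infimum of the empty set is \<open>\<infinity>\<close>. The value of \<open>jump_chain f i\<close> is meaningful only
  if the \<open>i\<close>-th jump time is finite.
\<close>

fun jump_time :: "(real \<Rightarrow> 's) \<Rightarrow> nat \<Rightarrow> ereal" where
  "jump_time f 0 = 0"
| "jump_time f (Suc i) =
     Inf {ereal t | t. jump_time f i < ereal t \<and> f t \<noteq> f (real_of_ereal (jump_time f i))}"

definition jump_chain :: "(real \<Rightarrow> 's) \<Rightarrow> nat \<Rightarrow> 's" where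
  "jump_chain f i = f (real_of_ereal (jump_time f i))"

definition jump_matrix :: "('s \<Rightarrow> 's \<Rightarrow> real) \<Rightarrow> 's \<Rightarrow> 's \<Rightarrow> real" where
  "jump_matrix Q a b = (if a = b then 0 else Q a b / (- Q a a))"

text \<open>
  The jump chain/holding time definition of a (non-explosive) continuous time Markov chain with
  transition rates \<open>Q\<close>, for \<open>Q\<close> without absorbing states (\<open>Q a a < 0\<close> for all \<open>a\<close>) on a countable
  state space: the paths are right-continuous for the discrete topology on the state space, the
  jump chain is a Markov chain with transition matrix \<open>jump_matrix Q\<close>, and conditionally on
  the first \<open>k + 1\<close> states \<open>x 0, \<dots>, x k\<close> of the jump chain, the first \<open>k + 1\<close> holding times are
  independent and exponentially distributed with rates \<open>- Q (x i) (x i)\<close>; the last property is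
  expressed by the joint tail probabilities. Absence of explosion means that the jump times
  almost surely tend to infinity.
\<close>

definition continuous_markov_chain ::
    "'w measure \<Rightarrow> ('s \<Rightarrow> 's \<Rightarrow> real) \<Rightarrow> (real \<Rightarrow> 'w \<Rightarrow> 's) \<Rightarrow> bool" where
  "continuous_markov_chain M Q Z \<longleftrightarrow>
     prob_space M \<and>
     (\<forall>t\<ge>0. Z t \<in> measurable M (count_space UNIV)) \<and>
     (\<forall>\<omega>\<in>space M. \<forall>t\<ge>0. eventually (\<lambda>s. Z s \<omega> = Z t \<omega>) (at_right t)) \<and>
     discrete_markov_chain M UNIV (jump_matrix Q) (\<lambda>i \<omega>. jump_chain (\<lambda>t. Z t \<omega>) i) \<and>
     (\<forall>k. \<forall>x :: nat \<Rightarrow> 's. \<forall>s :: nat \<Rightarrow> real. (\<forall>i\<le>k. s i \<ge> 0) \<longrightarrow>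
        \<P>(\<omega> in M. \<forall>i\<le>k. jump_chain (\<lambda>t. Z t \<omega>) i = x i) > 0 \<longrightarrow>
        \<P>(\<omega> in M. (\<forall>i\<le>k. jump_time (\<lambda>t. Z t \<omega>) (Suc i) - jump_time (\<lambda>t. Z t \<omega>) i > ereal (s i))
            \<bar> \<forall>i\<le>k. jump_chain (\<lambda>t. Z t \<omega>) i = x i)
          = (\<Prod>i\<le>k. exp (Q (x i) (x i) * s i))) \<and>
     (AE \<omega> in M. (\<lambda>i. jump_time (\<lambda>t. Z t \<omega>) i) \<longlonglongrightarrow> \<infinity>)"


section \<open>The two processes\<close>

definition qpoch :: "real \<Rightarrow> real \<Rightarrow> nat \<Rightarrow> real" where
  "qpoch a q r = (\<Prod>i<r. 1 - a * q ^ i)"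

definition P_mat :: "nat \<Rightarrow> nat \<Rightarrow> nat \<Rightarrow> nat \<Rightarrow> real" where
  "P_mat q n d r =
     (if d + r \<le> n
      then real q powi (- ((int n - int d - int r) * (int n - int r)))
           * (qpoch (real q powi (- (int n - int d))) (real q) r * qpoch (real q powi (- int n)) (real q) r)
           / qpoch (real q powi (- int r)) (real q) r
      else 0)"

definition Q_Z :: "nat \<Rightarrow> int \<Rightarrow> int \<Rightarrow> real" where
  "Q_Z q a b =
     (if b = a + 1 then real q powi (- a)
      else if b = a - 1 then real q powi a
      else if b = a then - (real q powi a) - real q powi (- a)
      else 0)"

text \<open>To be used for even \<open>n\<close> and \<open>t \<ge> 0\<close> only, so that the division and \<open>nat\<close> are exact.\<close>

definition Y_proc :: "nat \<Rightarrow> nat \<Rightarrow> (nat \<Rightarrow> 'w \<Rightarrow> nat) \<Rightarrow> real \<Rightarrow> 'w \<Rightarrow> int" where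
  "Y_proc q n X t \<omega> =
     int (X (2 * nat \<lfloor>real q powr (real n / 2) * (real q - 1) * t\<rfloor>) \<omega>) - int (n div 2)"

definition \<alpha> :: real where
  "\<alpha> = 0.08"

end

theory Submission
  imports Defs "HOL-Real_Asymp.Real_Asymp"
begin

text \<open>Write \<open>n = 2h\<close> and measure corank relative to \<open>h\<close>, so that \<open>d = h + x\<close> with \<open>x\<close> the value of \<open>Y\<close>. The number
\<open>P_mat q n d r\<close> is the probability that a uniformly random \<open>(n - d) \<times> n\<close> matrix over the field with
\<open>q\<close> elements has rank \<open>r\<close>. Such a matrix has full rank with probability \<open>1 - O(q^-d)\<close> and corank
one with probability close to \<open>q^-d / (q - 1)\<close>. One step of the chain therefore almost always
reflects \<open>d\<close> to \<open>n - d\<close>, and two steps almost always return to \<open>d\<close>. A deficient step leads from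
\<open>d\<close> to \<open>n - d - 1\<close>, so the two-step chain moves up from \<open>x\<close> with probability about
\<open>q^-x / (q^h (q - 1))\<close> (first step deficient) and down with probability about
\<open>q^x / (q^h (q - 1))\<close> (second step deficient), both up to a relative error \<open>O(q^(\<bar>x\<bar> - h))\<close>. In the
time unit \<open>q^h (q - 1)\<close> these are the rates of \<open>Z\<close>.

Both processes are determined by a jump chain and by holding times, which are exponential for \<open>Z\<close>
and geometric for \<open>Y\<close>. The coupling is made jump by jump, from independent drivers: the \<open>i\<close>-th
driver consists of a standard exponential variable \<open>E\<close> and of a pair of next states for each pair of
current states, drawn from a coupling of the two jump kernels. The holding time of \<open>Z\<close> is \<open>E\<close> divided
by the rate, and that of the two-step chain is \<open>\<lceil>E / c\<rceil>\<close> with \<open>exp (- c)\<close> the probability of staying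
put, which is geometric. The states at odd times are then inserted independently,
conditionally on their two neighbours. The laws of both processes follow by conditioning on
the first driver (\<open>cont_path_joint_law\<close>, \<open>disc_path_law\<close>, \<open>refine_law\<close>).

Write \<open>z = q^(\<alpha> n)\<close> and consider the first \<open>z^2\<close> jumps. Three errors enter (\<open>close_prob\<close>).
\<^item> From \<open>\<bar>x\<bar> = l\<close> the jump chain of \<open>Z\<close> moves outwards with probability at most \<open>q^(-2l)\<close>. For \<open>l\<close> just
  above \<open>2 \<alpha> n\<close> this is \<open>z^-4\<close>, so \<open>\<bar>x\<bar> \<le> l\<close> persists except with probability \<open>z^-2\<close>. On this range
  the jump kernels of the two chains differ by \<open>O(q^(l - h))\<close>, which is at most a multiple of
  \<open>z^-4\<close> because \<open>h \<ge> 6 \<alpha> n\<close>. This yields (a).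
\<^item> While the two chains agree, corresponding holding times differ by \<open>O(1 + E) / (q^h (q - 1))\<close>.
  Bounding every \<open>E\<close> by a multiple of \<open>z^3\<close>, which fails with negligible probability, keeps the
  sum of these errors below \<open>z^2 * z^3 / z^6 = 1 / z\<close>. This yields (b).
\<^item> The function \<open>(5/4)^\<bar>x\<bar>\<close> is contracted by \<open>9/10\<close> under one discounted jump of \<open>Z\<close>. So the
  expectation of \<open>exp (- T_k)\<close> decays exponentially in \<open>k\<close>. This yields (c) by Markov's inequality,
  and it also rules out explosion.\<close>

section \<open>Step functions and their jump times\<close>

definition step_path :: "(nat \<Rightarrow> 't::linorder) \<Rightarrow> (nat \<Rightarrow> 's) \<Rightarrow> 't \<Rightarrow> 's" where
  "step_path \<tau> v t = v (LEAST i. t < \<tau> (Suc i))"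

lemma step_path_eq:
  fixes \<tau> :: "nat \<Rightarrow> 't::linorder"
  assumes mono: "\<And>i. \<tau> i \<le> \<tau> (Suc i)" and "\<tau> i \<le> t" "t < \<tau> (Suc i)"
  shows "step_path \<tau> v t = v i"
proof -
  have le: "i \<le> j" if "t < \<tau> (Suc j)" for j
  proof (rule ccontr)
    assume "\<not> i \<le> j"
    then have "\<tau> (Suc j) \<le> \<tau> i"
      by (intro lift_Suc_mono_le[of \<tau>, OF mono]) simp
    with that assms(2) show False by (meson leD order.strict_trans2)
  qed
  have "(LEAST i. t < \<tau> (Suc i)) = i"
    using assms(3) le by (rule Least_equality)
  then show ?thesis by (simp add: step_path_def)
qed

lemma ex_step_interval:
  fixes \<tau> :: "nat \<Rightarrow> 't::linorder"
  assumes "\<tau> 0 \<le> t" and "t < \<tau> j"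
  shows "\<exists>i. \<tau> i \<le> t \<and> t < \<tau> (Suc i)"
  using assms(2)
proof (induction j)
  case 0
  with assms(1) show ?case by auto
next
  case (Suc j)
  then show ?case by (cases "t < \<tau> j") (auto simp: not_less)
qed

text \<open>Both \<open>Y\<close> and \<open>Z\<close> are constructed as step functions with explicit breakpoints, so this is the only
place where the infimum in \<open>jump_time\<close> has to be computed. It is attained, since the value at a
breakpoint is already the new one.\<close>

lemma jump_times_of_step_function:
  fixes f :: "real \<Rightarrow> 's" and \<tau> :: "nat \<Rightarrow> real"
  assumes \<tau>0: "\<tau> 0 = 0" and mono: "\<And>i. \<tau> i < \<tau> (Suc i)"
    and f: "\<And>i t. \<tau> i \<le> t \<Longrightarrow> t < \<tau> (Suc i) \<Longrightarrow> f t = v i"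
    and v: "\<And>i. v (Suc i) \<noteq> v i"
  shows "jump_time f i = ereal (\<tau> i)" and "jump_chain f i = v i"
proof -
  have f\<tau>: "f (\<tau> i) = v i" for i
    using f[of i "\<tau> i"] mono[of i] by auto
  show *: "jump_time f i = ereal (\<tau> i)" for i
  proof (induction i)
    case 0
    then show ?case by (simp add: \<tau>0 zero_ereal_def)
  next
    case (Suc i)
    have "Inf {ereal t | t. \<tau> i < t \<and> f t \<noteq> v i} = ereal (\<tau> (Suc i))"
    proof (rule Inf_eqI)
      fix x assume "x \<in> {ereal t | t. \<tau> i < t \<and> f t \<noteq> v i}"
      then obtain t where t: "x = ereal t" "\<tau> i < t" "f t \<noteq> v i" by auto
      then have "\<tau> (Suc i) \<le> t" using f[of i t] by (meson not_less less_imp_le)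
      then show "ereal (\<tau> (Suc i)) \<le> x" by (simp add: t)
    next
      fix y assume y: "\<And>x. x \<in> {ereal t | t. \<tau> i < t \<and> f t \<noteq> v i} \<Longrightarrow> y \<le> x"
      show "y \<le> ereal (\<tau> (Suc i))"
        using mono[of i] v[of i] f\<tau>[of "Suc i"] by (intro y) auto
    qed
    then show ?case by (simp add: Suc f\<tau>)
  qed
  show "jump_chain f i = v i"
    by (simp add: jump_chain_def * f\<tau>)
qed

lemma step_path_right_continuous:
  fixes \<tau> :: "nat \<Rightarrow> real"
  assumes mono: "\<And>i. \<tau> i \<le> \<tau> (Suc i)" and "\<tau> i \<le> t" "t < \<tau> (Suc i)"
  shows "eventually (\<lambda>s. step_path \<tau> v s = step_path \<tau> v t) (at_right t)"
proof -
  have "eventually (\<lambda>s. s \<in> {t<..<\<tau> (Suc i)}) (at_right t)"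
    using assms(3) by (rule eventually_at_right_real)
  moreover have "step_path \<tau> v s = step_path \<tau> v t" if "s \<in> {t<..<\<tau> (Suc i)}" for s
    using that assms(2,3) step_path_eq[of \<tau> i s v, OF mono] step_path_eq[of \<tau> i t v, OF mono]
    by auto
  ultimately show ?thesis
    by (rule eventually_mono)
qed

lemma measurable_step_path:
  fixes \<tau> :: "'a \<Rightarrow> nat \<Rightarrow> 't::linorder" and v :: "'a \<Rightarrow> nat \<Rightarrow> 'b"
  assumes [measurable]: "\<And>i. Measurable.pred M (\<lambda>\<omega>. t < \<tau> \<omega> i)"
    and v: "\<And>i. (\<lambda>\<omega>. v \<omega> i) \<in> measurable M (count_space UNIV)"
  shows "(\<lambda>\<omega>. step_path (\<tau> \<omega>) (v \<omega>) t) \<in> measurable M (count_space UNIV)"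
  unfolding step_path_def
  by (rule measurable_compose_countable[where f = "\<lambda>i \<omega>. v \<omega> i", OF v]) measurable

section \<open>Markov chains from path probabilities\<close>

lemma sets_path_event:
  fixes W :: "nat \<Rightarrow> 'a \<Rightarrow> 'b"
  assumes W: "\<And>k. W k \<in> measurable M (count_space UNIV)"
  shows "{\<omega> \<in> space M. \<forall>j\<le>m. W j \<omega> = w j} \<in> sets M"
proof -
  have "{\<omega> \<in> space M. \<forall>j\<le>m. W j \<omega> = w j} = (\<Inter>j\<in>{0..m}. W j -` {w j} \<inter> space M)" by auto
  also have "\<dots> \<in> sets M"
    by (intro sets.finite_INT measurable_sets[OF W]) auto
  finally show ?thesis .
qed

text \<open>The conditional probabilities in the definition are quotients of path probabilities, so it suffices
that these have product form.\<close>

lemma discrete_markov_chainI: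
  assumes "prob_space M" and "\<And>i. X i \<in> measurable M (count_space S)"
    and path: "\<And>k x. (\<And>i. i \<le> k \<Longrightarrow> x i \<in> S) \<Longrightarrow>
       \<P>(\<omega> in M. \<forall>i\<le>k. X i \<omega> = x i) = (if x 0 = init then \<Prod>i<k. P (x i) (x (Suc i)) else 0)"
  shows "discrete_markov_chain M S P X"
  unfolding discrete_markov_chain_def
proof (intro conjI allI impI assms(1,2))
  fix k x
  assume xS: "\<forall>i\<le>Suc k. x i \<in> S" and pos: "0 < \<P>(\<omega> in M. \<forall>i\<le>k. X i \<omega> = x i)"
  have 1: "\<P>(\<omega> in M. \<forall>i\<le>k. X i \<omega> = x i) = (if x 0 = init then \<Prod>i<k. P (x i) (x (Suc i)) else 0)"
    using xS by (intro path) auto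
  have 2: "\<P>(\<omega> in M. \<forall>i\<le>Suc k. X i \<omega> = x i) = (if x 0 = init then \<Prod>i<Suc k. P (x i) (x (Suc i)) else 0)"
    using xS by (intro path) auto
  have 3: "(X (Suc k) \<omega> = x (Suc k) \<and> (\<forall>i\<le>k. X i \<omega> = x i)) \<longleftrightarrow> (\<forall>i\<le>Suc k. X i \<omega> = x i)" for \<omega>
    by (auto simp: le_Suc_eq)
  show "\<P>(\<omega> in M. X (Suc k) \<omega> = x (Suc k) \<bar> \<forall>i\<le>k. X i \<omega> = x i) = P (x k) (x (Suc k))"
    using pos 1 2 by (simp add: cond_prob_def 3 del: prod_zero_iff split: if_splits)
qed

section \<open>The standard exponential distribution\<close>

abbreviation std_exp :: "real measure" where
  "std_exp \<equiv> density lborel (exponential_density 1)"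

lemma prob_space_std_exp: "prob_space std_exp"
  by (rule prob_space_exponential_density) simp

lemma emeasure_std_exp_gt:
  assumes "0 \<le> t" shows "emeasure std_exp {e. t < e} = ennreal (exp (- t))"
proof -
  interpret prob_space std_exp by (rule prob_space_std_exp)
  have "distributed std_exp lborel (\<lambda>x. x) (exponential_density 1)"
    by (auto simp: distributed_def cong: distr_cong intro!: distr_id2)
  from exponential_distributedD_gt[OF this assms] have "measure std_exp {e. t < e} = exp (- t)"
    by (simp add: space_density)
  then show ?thesis by (simp add: emeasure_eq_measure)
qed

text \<open>The integrand times the density is, up to the factor \<open>r / (r + 1)\<close>, the density of the exponential
distribution of rate \<open>1 + 1 / r\<close>.\<close>

lemma nn_integral_std_exp_discount:
  assumes "0 < r"
  shows "(\<integral>\<^sup>+e. ennreal (exp (- (e / r))) \<partial>std_exp) = ennreal (r / (r + 1))"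
proof -
  have r1: "0 < 1 + 1 / r" using assms by (simp add: add_pos_pos)
  interpret prob_space "density lborel (exponential_density (1 + 1 / r))"
    by (rule prob_space_exponential_density[OF r1])
  have one: "(\<integral>\<^sup>+e. ennreal (exponential_density (1 + 1 / r) e) \<partial>lborel) = 1"
    using emeasure_space_1 by (simp add: emeasure_density)
  have "(\<integral>\<^sup>+e. ennreal (exp (- (e / r))) \<partial>std_exp)
      = (\<integral>\<^sup>+e. ennreal (exponential_density 1 e) * ennreal (exp (- (e / r))) \<partial>lborel)"
    by (subst nn_integral_density) auto
  also have "\<dots> = (\<integral>\<^sup>+e. ennreal (r / (r + 1)) * ennreal (exponential_density (1 + 1 / r) e) \<partial>lborel)"
  proof (intro nn_integral_cong)
    fix e :: real
    have "r / (r + 1) * (1 + 1 / r) = 1"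
      using assms add_pos_pos[OF assms zero_less_one] by (simp add: divide_simps)
    then have "exponential_density 1 e * exp (- (e / r)) = r / (r + 1) * exponential_density (1 + 1 / r) e"
      by (simp add: exponential_density_def exp_add[symmetric] mult.assoc[symmetric] del: times_divide_eq_left)
        (simp add: algebra_simps)
    then show "ennreal (exponential_density 1 e) * ennreal (exp (- (e / r)))
        = ennreal (r / (r + 1)) * ennreal (exponential_density (1 + 1 / r) e)"
      using assms r1 by (simp add: ennreal_mult[symmetric] exponential_density_nonneg)
  qed
  also have "\<dots> = ennreal (r / (r + 1))"
    by (subst nn_integral_cmult) (auto simp: one)
  finally show ?thesis .
qed

section \<open>Two chains driven by common jumps\<close>

lemma pmf_nondegenerate:
  assumes "y \<in> set_pmf p" "set_pmf p \<noteq> {y}"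
  shows "0 < pmf p y" "pmf p y < 1"
proof -
  show "0 < pmf p y" using assms(1) by (simp add: pmf_positive)
  obtain y' where "y' \<in> set_pmf p" "y' \<noteq> y" using assms by blast
  then have "0 < pmf p y'" by (simp add: pmf_positive)
  moreover have "measure p {y, y'} \<le> 1" by simp
  moreover have "measure p {y, y'} = pmf p y + pmf p y'"
    using \<open>y' \<noteq> y\<close> by (subst measure_measure_pmf_finite) auto
  ultimately show "pmf p y < 1" by linarith
qed

text \<open>A driver consists of an exponential variable and a map that assigns to every state the state that
follows it. Drawing the next state for all states at once makes the drivers independent and
identically distributed, although the transition probabilities depend on the current state.\<close>

type_synonym 's drive = "nat \<Rightarrow> real \<times> ('s \<Rightarrow> 's)"

text \<open>The first component of a state is the jump chain, with kernel \<open>J\<close>, of a chain in continuous time; the second is the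
jump chain of a chain in discrete time with transition kernel \<open>R\<close>. The last two assumptions
say that the chain \<open>R\<close> has nondegenerate geometric holding times. They are made for every state, which spares
the state space of the second chain from being carried along as an invariant.\<close>

locale jump_coupling =
  fixes \<kappa> :: "('x::countable \<times> 'y::countable) \<Rightarrow> ('x \<times> 'y) pmf"
    and J :: "'x \<Rightarrow> 'x pmf" and rate :: "'x \<Rightarrow> real" and R :: "'y \<Rightarrow> 'y pmf"
  assumes fst_\<kappa>: "map_pmf fst (\<kappa> s) = J (fst s)"
    and snd_\<kappa>: "map_pmf snd (\<kappa> s) = cond_pmf (R (snd s)) (- {snd s})"
    and rate_pos: "0 < rate x"
    and R_stay: "y \<in> set_pmf (R y)" and R_move: "set_pmf (R y) \<noteq> {y}"
begin

definition driver :: "(real \<times> ('x \<times> 'y \<Rightarrow> 'x \<times> 'y)) measure" where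
  "driver = std_exp \<Otimes>\<^sub>M (\<Pi>\<^sub>M s\<in>UNIV. measure_pmf (\<kappa> s))"

definition drivers :: "('x \<times> 'y) drive measure" where
  "drivers = (\<Pi>\<^sub>M i\<in>UNIV. driver)"

primrec state :: "'x \<times> 'y \<Rightarrow> ('x \<times> 'y) drive \<Rightarrow> nat \<Rightarrow> 'x \<times> 'y" where
  "state s \<omega> 0 = s"
| "state s \<omega> (Suc i) = snd (\<omega> i) (state s \<omega> i)"

definition cont_hold :: "'x \<times> 'y \<Rightarrow> ('x \<times> 'y) drive \<Rightarrow> nat \<Rightarrow> real" where
  "cont_hold s \<omega> i = fst (\<omega> i) / rate (fst (state s \<omega> i))"

definition cont_time :: "'x \<times> 'y \<Rightarrow> ('x \<times> 'y) drive \<Rightarrow> nat \<Rightarrow> real" where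
  "cont_time s \<omega> k = (\<Sum>i<k. cont_hold s \<omega> i)"

text \<open>The rounding turns an exponential variable \<open>e\<close> into a geometric one: for \<open>m > 0\<close>, \<open>disc_hold y e > m\<close> means
\<open>e > c m\<close>, where \<open>exp (- c)\<close> is the probability of staying in \<open>y\<close>. The maximum with \<open>1\<close> matters only for
\<open>e \<le> 0\<close>, and makes holding times positive without exception.\<close>

definition disc_hold :: "'y \<Rightarrow> real \<Rightarrow> nat" where
  "disc_hold y e = max 1 (nat \<lceil>e / (- ln (pmf (R y) y))\<rceil>)"

definition disc_time :: "'x \<times> 'y \<Rightarrow> ('x \<times> 'y) drive \<Rightarrow> nat \<Rightarrow> nat" where
  "disc_time s \<omega> k = (\<Sum>i<k. disc_hold (snd (state s \<omega> i)) (fst (\<omega> i)))"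

definition disc_path :: "'x \<times> 'y \<Rightarrow> ('x \<times> 'y) drive \<Rightarrow> nat \<Rightarrow> 'y" where
  "disc_path s \<omega> = step_path (disc_time s \<omega>) (\<lambda>i. snd (state s \<omega> i))"

lemma sets_driver: "sets driver = sets (borel \<Otimes>\<^sub>M (\<Pi>\<^sub>M s\<in>UNIV. count_space UNIV))"
  unfolding driver_def by (intro sets_pair_measure_cong sets_PiM_cong) auto

lemma space_driver [simp]: "space driver = UNIV"
  by (simp add: driver_def space_pair_measure space_PiM)

lemma space_drivers [simp]: "space drivers = UNIV"
  by (simp add: drivers_def space_PiM)

lemma sets_driver_Collect: "Measurable.pred driver Q \<Longrightarrow> {\<xi>. Q \<xi>} \<in> sets driver"
  by (simp add: pred_def)

lemma sets_drivers_Collect: "Measurable.pred drivers Q \<Longrightarrow> {\<omega>. Q \<omega>} \<in> sets drivers"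
  by (simp add: pred_def)

lemma prob_space_driver: "prob_space driver"
proof -
  interpret A: prob_space std_exp by (rule prob_space_std_exp)
  interpret B: prob_space "\<Pi>\<^sub>M s\<in>UNIV. measure_pmf (\<kappa> s)"
    by (intro prob_space_PiM measure_pmf.prob_space_axioms)
  interpret pair_prob_space std_exp "\<Pi>\<^sub>M s\<in>UNIV. measure_pmf (\<kappa> s)" ..
  show ?thesis unfolding driver_def by unfold_locales
qed

lemma prob_space_drivers: "prob_space drivers"
  unfolding drivers_def by (intro prob_space_PiM prob_space_driver)

sublocale driver: prob_space driver by (rule prob_space_driver)
sublocale drivers: prob_space drivers by (rule prob_space_drivers)

lemma measurable_fst_driver [measurable]: "fst \<in> borel_measurable driver"
  unfolding measurable_cong_sets[OF sets_driver refl] by measurable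

lemma measurable_snd_driver [measurable]: "(\<lambda>\<xi>. snd \<xi> s) \<in> measurable driver (count_space UNIV)"
  unfolding measurable_cong_sets[OF sets_driver refl] by measurable

lemma measurable_driver [measurable]: "(\<lambda>\<omega>. \<omega> i) \<in> measurable drivers driver"
  unfolding drivers_def by measurable

lemma measurable_state [measurable]: "(\<lambda>\<omega>. state s \<omega> i) \<in> measurable drivers (count_space UNIV)"
proof (induction i)
  case (Suc i)
  have "(\<lambda>\<omega>. snd (\<omega> i) s') \<in> measurable drivers (count_space UNIV)" for s'
    by (rule measurable_compose[OF measurable_driver measurable_snd_driver])
  from measurable_compose_countable[OF this Suc] show ?case by simp
qed simp

lemma measurable_fst_drivers [measurable]: "(\<lambda>\<omega>. fst (\<omega> i)) \<in> borel_measurable drivers"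
  by (rule measurable_compose[OF measurable_driver measurable_fst_driver])

lemma measurable_cont_hold [measurable]: "(\<lambda>\<omega>. cont_hold s \<omega> i) \<in> borel_measurable drivers"
  unfolding cont_hold_def by measurable

lemma measurable_cont_time [measurable]: "(\<lambda>\<omega>. cont_time s \<omega> i) \<in> borel_measurable drivers"
  unfolding cont_time_def by measurable

lemma measurable_disc_time [measurable]: "(\<lambda>\<omega>. disc_time s \<omega> i) \<in> measurable drivers (count_space UNIV)"
proof -
  have "(\<lambda>\<omega>. disc_hold (snd (state s \<omega> j)) (fst (\<omega> j))) \<in> measurable drivers (count_space UNIV)" for j
    unfolding disc_hold_def by measurable
  then show ?thesis unfolding disc_time_def by measurable
qed

lemma measurable_disc_path [measurable]: "(\<lambda>\<omega>. disc_path s \<omega> k) \<in> measurable drivers (count_space UNIV)"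
  unfolding disc_path_def
  by (rule measurable_step_path) (auto intro: measurable_compose[OF measurable_state])

text \<open>First-step analysis: prepending an independent driver to a sequence of drivers reproduces its law.
Everything about the two chains is derived from this by induction, with the initial state
generalised.\<close>

lemma drivers_nn_integral_first_step:
  assumes [measurable]: "f \<in> borel_measurable drivers"
  shows "(\<integral>\<^sup>+\<omega>. f \<omega> \<partial>drivers) = (\<integral>\<^sup>+\<xi>. (\<integral>\<^sup>+\<omega>. f (case_nat \<xi> \<omega>) \<partial>drivers) \<partial>driver)"
proof -
  interpret sequence_space driver ..
  have dr: "drivers = (\<Pi>\<^sub>M i\<in>UNIV. driver)" by (simp add: drivers_def)
  have [measurable]: "(\<lambda>(s, \<omega>). case_nat s \<omega>) \<in> measurable (driver \<Otimes>\<^sub>M drivers) drivers"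
    unfolding dr by measurable
  have "(\<integral>\<^sup>+\<omega>. f \<omega> \<partial>drivers) = (\<integral>\<^sup>+\<omega>. f \<omega> \<partial>distr (driver \<Otimes>\<^sub>M drivers) drivers (\<lambda>(s, \<omega>). case_nat s \<omega>))"
    using PiM_iter by (simp add: dr)
  also have "\<dots> = (\<integral>\<^sup>+x. f (case x of (s, \<omega>) \<Rightarrow> case_nat s \<omega>) \<partial>(driver \<Otimes>\<^sub>M drivers))"
    by (rule nn_integral_distr) measurable
  also have "\<dots> = (\<integral>\<^sup>+\<xi>. (\<integral>\<^sup>+\<omega>. f (case_nat \<xi> \<omega>) \<partial>drivers) \<partial>driver)"
    by (subst drivers.nn_integral_fst[symmetric]) auto
  finally show ?thesis .
qed

lemma emeasure_drivers_first_step: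
  assumes Q: "Measurable.pred drivers Q"
  shows "emeasure drivers {\<omega>. Q \<omega>} = (\<integral>\<^sup>+\<xi>. emeasure drivers {\<omega>. Q (case_nat \<xi> \<omega>)} \<partial>driver)"
proof -
  interpret sequence_space driver ..
  have dr: "drivers = (\<Pi>\<^sub>M i\<in>UNIV. driver)" by (simp add: drivers_def)
  have case_nat: "(\<lambda>\<omega>. case_nat \<xi> \<omega>) \<in> measurable drivers drivers" for \<xi>
    unfolding dr by (intro measurable_PiM_single') (auto split: nat.split simp: space_PiM)
  have m: "{\<omega>. Q (case_nat \<xi> \<omega>)} \<in> sets drivers" for \<xi>
    using measurable_sets[OF measurable_compose[OF case_nat Q], of "{True}"] by (simp add: vimage_def)
  have "emeasure drivers {\<omega>. Q \<omega>} = (\<integral>\<^sup>+\<omega>. indicator {\<omega>. Q \<omega>} \<omega> \<partial>drivers)"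
    using Q by (simp add: pred_def)
  also have "\<dots> = (\<integral>\<^sup>+\<xi>. (\<integral>\<^sup>+\<omega>. indicator {\<omega>. Q \<omega>} (case_nat \<xi> \<omega>) \<partial>drivers) \<partial>driver)"
    using Q by (intro drivers_nn_integral_first_step) (simp add: pred_def)
  also have "\<dots> = (\<integral>\<^sup>+\<xi>. emeasure drivers {\<omega>. Q (case_nat \<xi> \<omega>)} \<partial>driver)"
  proof (intro nn_integral_cong)
    fix \<xi>
    show "(\<integral>\<^sup>+\<omega>. indicator {\<omega>. Q \<omega>} (case_nat \<xi> \<omega>) \<partial>drivers) = emeasure drivers {\<omega>. Q (case_nat \<xi> \<omega>)}"
      unfolding nn_integral_indicator[OF m, symmetric]
      by (intro nn_integral_cong) (simp split: split_indicator)
  qed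
  finally show ?thesis .
qed

lemma state_case_nat [simp]: "state s (case_nat \<xi> \<omega>) (Suc i) = state (snd \<xi> s) \<omega> i"
  by (induction i) auto

lemma cont_hold_case_nat:
  "cont_hold s (case_nat \<xi> \<omega>) 0 = fst \<xi> / rate (fst s)"
  "cont_hold s (case_nat \<xi> \<omega>) (Suc i) = cont_hold (snd \<xi> s) \<omega> i"
  by (simp_all add: cont_hold_def del: state.simps(2))

lemma cont_time_case_nat: "cont_time s (case_nat \<xi> \<omega>) (Suc k) = fst \<xi> / rate (fst s) + cont_time (snd \<xi> s) \<omega> k"
  unfolding cont_time_def by (subst sum.lessThan_Suc_shift) (simp add: cont_hold_case_nat)

lemma disc_time_case_nat:
  "disc_time s (case_nat \<xi> \<omega>) (Suc k) = disc_hold (snd s) (fst \<xi>) + disc_time (snd \<xi> s) \<omega> k"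
  unfolding disc_time_def by (subst sum.lessThan_Suc_shift) (simp del: state.simps(2))

text \<open>The two components of a driver are independent, and only the value of the second one at the current
state matters.\<close>

lemma emeasure_driver_rectangle:
  assumes "B \<in> sets borel"
  shows "emeasure driver {\<xi>. fst \<xi> \<in> B \<and> snd \<xi> s \<in> D} = emeasure std_exp B * emeasure (measure_pmf (\<kappa> s)) D"
proof -
  interpret B: prob_space "\<Pi>\<^sub>M s\<in>UNIV. measure_pmf (\<kappa> s)"
    by (intro prob_space_PiM measure_pmf.prob_space_axioms)
  let ?F = "{F \<in> space (\<Pi>\<^sub>M s\<in>UNIV. measure_pmf (\<kappa> s)). F s \<in> D}"
  have F: "?F \<in> sets (\<Pi>\<^sub>M s\<in>UNIV. measure_pmf (\<kappa> s))" by measurable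
  have "{\<xi>. fst \<xi> \<in> B \<and> snd \<xi> s \<in> D} = B \<times> ?F" by (auto simp: space_PiM)
  moreover have "emeasure (\<Pi>\<^sub>M s\<in>UNIV. measure_pmf (\<kappa> s)) ?F = emeasure (measure_pmf (\<kappa> s)) D"
  proof -
    have "emeasure (measure_pmf (\<kappa> s)) D
       = emeasure (distr (\<Pi>\<^sub>M s\<in>UNIV. measure_pmf (\<kappa> s)) (measure_pmf (\<kappa> s)) (\<lambda>F. F s)) D"
      by (subst distr_PiM_component) (auto simp: measure_pmf.prob_space_axioms)
    also have "\<dots> = emeasure (\<Pi>\<^sub>M s\<in>UNIV. measure_pmf (\<kappa> s)) ?F"
      by (subst emeasure_distr) (auto intro!: arg_cong2[where f=emeasure])
    finally show ?thesis ..
  qed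
  ultimately show ?thesis
    using assms F by (simp add: driver_def B.emeasure_pair_measure_Times)
qed

lemma AE_driver_pos: "AE \<xi> in driver. 0 < fst \<xi>"
proof -
  have "emeasure driver {\<xi>. fst \<xi> \<in> {e. 0 < e} \<and> snd \<xi> undefined \<in> UNIV} = 1"
    using emeasure_std_exp_gt[of 0] by (subst emeasure_driver_rectangle) auto
  then have "AE \<xi> in driver. \<xi> \<in> {\<xi>. 0 < fst \<xi>}" 
    by (subst driver.prob_eq_1[symmetric]) (auto simp: driver.emeasure_eq_measure intro!: sets_driver_Collect)
  then show ?thesis by simp
qed

lemma AE_driver_support: "AE \<xi> in driver. snd \<xi> s \<in> set_pmf (\<kappa> s)"
proof -
  have "emeasure driver {\<xi>. fst \<xi> \<in> UNIV \<and> snd \<xi> s \<in> set_pmf (\<kappa> s)} = 1"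
  proof -
    interpret prob_space std_exp by (rule prob_space_std_exp)
    show ?thesis using emeasure_space_1
      by (subst emeasure_driver_rectangle) (auto simp: measure_pmf.emeasure_eq_measure measure_pmf.prob_eq_1 AE_measure_pmf_iff)
  qed
  then have "AE \<xi> in driver. \<xi> \<in> {\<xi>. snd \<xi> s \<in> set_pmf (\<kappa> s)}" 
    by (subst driver.prob_eq_1[symmetric]) (auto simp: driver.emeasure_eq_measure intro!: sets_driver_Collect)
  then show ?thesis by simp
qed

lemma AE_drivers: "AE \<omega> in drivers. \<forall>i. 0 < fst (\<omega> i) \<and> (\<forall>s. snd (\<omega> i) s \<in> set_pmf (\<kappa> s))"
  unfolding AE_all_countable
proof
  fix i
  have "AE \<xi> in driver. 0 < fst \<xi> \<and> (\<forall>s. snd \<xi> s \<in> set_pmf (\<kappa> s))"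
    using AE_driver_pos AE_driver_support by (simp add: AE_all_countable)
  then show "AE \<omega> in drivers. 0 < fst (\<omega> i) \<and> (\<forall>s. snd (\<omega> i) s \<in> set_pmf (\<kappa> s))"
    unfolding drivers_def by (intro AE_PiM_component) (auto simp: prob_space_driver)
qed

section \<open>The laws of the two chains\<close>

lemma pmf_J: "pmf (J x) x' = measure (\<kappa> (x, y)) {s. fst s = x'}"
proof -
  have "pmf (map_pmf fst (\<kappa> (x, y))) x' = measure (\<kappa> (x, y)) {s. fst s = x'}"
    by (simp add: pmf_map vimage_def)
  then show ?thesis by (simp add: fst_\<kappa>)
qed

lemma sets_driver_rectangle:
  assumes "B \<in> sets borel" shows "{\<xi>. fst \<xi> \<in> B \<and> snd \<xi> s \<in> D} \<in> sets driver"
proof -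
  have "{\<xi>. fst \<xi> \<in> B \<and> snd \<xi> s \<in> D}
      = (fst -` B \<inter> space driver) \<inter> ((\<lambda>\<xi>. snd \<xi> s) -` D \<inter> space driver)" by auto
  also have "\<dots> \<in> sets driver"
    using assms by (intro sets.Int measurable_sets[OF measurable_fst_driver] measurable_sets[OF measurable_snd_driver]) auto
  finally show ?thesis .
qed

lemma measurable_cont_path_event:
  "Measurable.pred drivers (\<lambda>\<omega>. \<forall>i\<le>k. fst (state s \<omega> i) = x i \<and> t i < fst (\<omega> i))"
proof -
  have "Measurable.pred drivers (\<lambda>\<omega>. fst (state s \<omega> i) = x i)" for i
    by (rule measurable_compose[OF measurable_state]) simp
  then show ?thesis
    by (intro pred_intros_countable pred_intros_imp' pred_intros_logic) auto
qed

text \<open>Whatever the current second component, the first component jumps according to \<open>J\<close>. Hence the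
conditional probability after the first step depends on the new state only through its
first component, and the second one drops out.\<close>

lemma cont_path_joint_law:
  assumes "\<And>i. 0 \<le> t i"
  shows "emeasure drivers {\<omega>. \<forall>i\<le>k. fst (state s \<omega> i) = x i \<and> t i < fst (\<omega> i)}
     = (if fst s = x 0 then ennreal ((\<Prod>i<k. pmf (J (x i)) (x (Suc i))) * (\<Prod>i\<le>k. exp (- t i))) else 0)"
  using assms
proof (induction k arbitrary: s x t)
  case 0
  have "emeasure drivers {\<omega>. fst s = x 0 \<and> t 0 < fst (\<omega> 0)}
     = (\<integral>\<^sup>+\<xi>. emeasure drivers {\<omega>. fst s = x 0 \<and> t 0 < fst (case_nat \<xi> \<omega> 0)} \<partial>driver)"
    by (rule emeasure_drivers_first_step) measurable
  also have "\<dots> = (\<integral>\<^sup>+\<xi>. (if fst s = x 0 then 1 else 0) * indicator {\<xi>. fst \<xi> \<in> {e. t 0 < e} \<and> snd \<xi> s \<in> UNIV} \<xi> \<partial>driver)"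
    using drivers.emeasure_space_1 by (intro nn_integral_cong) (auto split: split_indicator)
  also have "\<dots> = (if fst s = x 0 then 1 else 0) * emeasure driver {\<xi>. fst \<xi> \<in> {e. t 0 < e} \<and> snd \<xi> s \<in> UNIV}"
    by (intro nn_integral_cmult_indicator sets_driver_rectangle) auto
  also have "\<dots> = (if fst s = x 0 then ennreal (exp (- t 0)) else 0)"
    using 0 by (subst emeasure_driver_rectangle) (auto simp: emeasure_std_exp_gt measure_pmf.emeasure_eq_measure)
  finally show ?case by simp
next
  case (Suc k)
  define c where "c = (\<Prod>i<k. pmf (J (x (Suc i))) (x (Suc (Suc i)))) * (\<Prod>i\<le>k. exp (- t (Suc i)))"
  have c0: "0 \<le> c" unfolding c_def by (intro mult_nonneg_nonneg prod_nonneg) auto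
  let ?D = "{s'. fst s' = x 1}"
  have "emeasure drivers {\<omega>. \<forall>i\<le>Suc k. fst (state s \<omega> i) = x i \<and> t i < fst (\<omega> i)}
     = (\<integral>\<^sup>+\<xi>. emeasure drivers {\<omega>. \<forall>i\<le>Suc k. fst (state s (case_nat \<xi> \<omega>) i) = x i \<and> t i < fst (case_nat \<xi> \<omega> i)} \<partial>driver)"
    by (rule emeasure_drivers_first_step[OF measurable_cont_path_event])
  also have "\<dots> = (\<integral>\<^sup>+\<xi>. (if fst s = x 0 then ennreal c else 0) * indicator {\<xi>. fst \<xi> \<in> {e. t 0 < e} \<and> snd \<xi> s \<in> ?D} \<xi> \<partial>driver)"
  proof (intro nn_integral_cong)
    fix \<xi>
    have "{\<omega>. \<forall>i\<le>Suc k. fst (state s (case_nat \<xi> \<omega>) i) = x i \<and> t i < fst (case_nat \<xi> \<omega> i)}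
      = {\<omega>. fst s = x 0 \<and> t 0 < fst \<xi> \<and> (\<forall>i\<le>k. fst (state (snd \<xi> s) \<omega> i) = x (Suc i) \<and> t (Suc i) < fst (\<omega> i))}"
      by (simp only: All_less_Suc2 less_Suc_eq_le[symmetric]) (auto simp del: state.simps(2))
    then show "emeasure drivers {\<omega>. \<forall>i\<le>Suc k. fst (state s (case_nat \<xi> \<omega>) i) = x i \<and> t i < fst (case_nat \<xi> \<omega> i)}
      = (if fst s = x 0 then ennreal c else 0) * indicator {\<xi>. fst \<xi> \<in> {e. t 0 < e} \<and> snd \<xi> s \<in> ?D} \<xi>"
      using Suc.IH[of "\<lambda>i. t (Suc i)" "snd \<xi> s" "\<lambda>i. x (Suc i)"] Suc.prems 
      by (cases "fst s = x 0 \<and> t 0 < fst \<xi>") (auto simp: c_def split: split_indicator)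
  qed
  also have "\<dots> = (if fst s = x 0 then ennreal c else 0) * emeasure driver {\<xi>. fst \<xi> \<in> {e. t 0 < e} \<and> snd \<xi> s \<in> ?D}"
    by (intro nn_integral_cmult_indicator sets_driver_rectangle) auto
  also have "emeasure driver {\<xi>. fst \<xi> \<in> {e. t 0 < e} \<and> snd \<xi> s \<in> ?D} = ennreal (exp (- t 0) * pmf (J (fst s)) (x 1))"
    using Suc.prems pmf_J[of "fst s" "x 1" "snd s"]
    by (subst emeasure_driver_rectangle) (auto simp: emeasure_std_exp_gt measure_pmf.emeasure_eq_measure ennreal_mult)
  finally show ?case
    using c0 by (auto simp: c_def prod.lessThan_Suc_shift prod.atMost_Suc_shift ennreal_mult[symmetric] mult_ac simp del: prod.lessThan_Suc prod.atMost_Suc)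
qed

lemma stay_prob: "0 < pmf (R y) y" "pmf (R y) y < 1"
  using pmf_nondegenerate[OF R_stay R_move] by auto

lemma less_disc_hold_iff:
  "m < disc_hold y e \<longleftrightarrow> m = 0 \<or> - ln (pmf (R y) y) * real m < e"
proof -
  have c: "0 < - ln (pmf (R y) y)" using stay_prob by simp
  have "m < nat \<lceil>e / (- ln (pmf (R y) y))\<rceil> \<longleftrightarrow> int m < \<lceil>e / (- ln (pmf (R y) y))\<rceil>"
    by (simp add: zless_nat_eq_int_zless)
  also have "\<dots> \<longleftrightarrow> real m < e / (- ln (pmf (R y) y))" by (simp add: less_ceiling_iff)
  also have "\<dots> \<longleftrightarrow> - ln (pmf (R y) y) * real m < e" by (subst pos_less_divide_eq[OF c]) (simp add: mult.commute)
  finally show ?thesis by (cases "m = 0") (auto simp: disc_hold_def)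
qed

lemma disc_hold_pos: "0 < disc_hold y e"
  by (simp add: less_disc_hold_iff)

lemma exp_ln_stay: "exp (- (- ln (pmf (R y) y) * real m)) = pmf (R y) y ^ m"
  using stay_prob[of y] exp_of_nat_mult[of m "ln (pmf (R y) y)"] by (simp add: mult.commute)

lemma emeasure_disc_hold_gt: "emeasure std_exp {e. m < disc_hold y e} = ennreal (pmf (R y) y ^ m)"
proof (cases "m = 0")
  case True
  interpret prob_space std_exp by (rule prob_space_std_exp)
  show ?thesis using emeasure_space_1 True by (simp add: less_disc_hold_iff)
next
  case False
  have "emeasure std_exp {e. - ln (pmf (R y) y) * real m < e} = ennreal (pmf (R y) y ^ m)"
    unfolding exp_ln_stay[symmetric] using stay_prob[of y] by (intro emeasure_std_exp_gt) (simp add: mult_nonpos_nonneg)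
  then show ?thesis using False by (simp add: less_disc_hold_iff)
qed

lemma measurable_disc_hold [measurable]: "disc_hold y \<in> measurable borel (count_space UNIV)"
  unfolding disc_hold_def by measurable

lemma emeasure_disc_hold_eq:
  assumes "0 < g"
  shows "emeasure std_exp {e. disc_hold y e = g} = ennreal (pmf (R y) y ^ (g - 1) * (1 - pmf (R y) y))"
proof -
  interpret prob_space std_exp by (rule prob_space_std_exp)
  have "{e. disc_hold y e = g} = {e. g - 1 < disc_hold y e} - {e. g < disc_hold y e}"
    using assms by auto
  moreover have "emeasure std_exp ({e. g - 1 < disc_hold y e} - {e. g < disc_hold y e})
     = emeasure std_exp {e. g - 1 < disc_hold y e} - emeasure std_exp {e. g < disc_hold y e}"
    by (intro emeasure_Diff) (auto simp: emeasure_eq_measure)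
  moreover have "pmf (R y) y ^ g = pmf (R y) y ^ (g - 1) * pmf (R y) y"
    using assms by (cases g) auto
  ultimately show ?thesis
    using stay_prob[of y] by (simp add: emeasure_disc_hold_gt ennreal_minus algebra_simps)
qed

lemma disc_time_strict: "disc_time s \<omega> i < disc_time s \<omega> (Suc i)"
  by (simp add: disc_time_def disc_hold_pos)

lemma disc_time_ge: "i \<le> disc_time s \<omega> i"
  by (induction i) (auto intro: Suc_leI le_less_trans disc_time_strict)

lemma disc_path_eq: "disc_time s \<omega> i \<le> k \<Longrightarrow> k < disc_time s \<omega> (Suc i) \<Longrightarrow> disc_path s \<omega> k = snd (state s \<omega> i)"
  unfolding disc_path_def by (rule step_path_eq) (auto intro: less_imp_le disc_time_strict)

lemma ex_disc_time_interval: "\<exists>i. disc_time s \<omega> i \<le> k \<and> k < disc_time s \<omega> (Suc i)"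
  by (rule ex_step_interval[of _ _ "Suc k"]) (auto simp: disc_time_def[of _ _ 0] intro: less_le_trans[OF _ disc_time_ge])

lemma disc_path_case_nat:
  "disc_path s (case_nat \<xi> \<omega>) k =
    (if k < disc_hold (snd s) (fst \<xi>) then snd s else disc_path (snd \<xi> s) \<omega> (k - disc_hold (snd s) (fst \<xi>)))"
proof (cases "k < disc_hold (snd s) (fst \<xi>)")
  case True
  then show ?thesis by (subst disc_path_eq[of _ _ 0]) (auto simp: disc_time_case_nat disc_time_def[of _ _ 0])
next
  case False
  obtain i where "disc_time (snd \<xi> s) \<omega> i \<le> k - disc_hold (snd s) (fst \<xi>)"
      "k - disc_hold (snd s) (fst \<xi>) < disc_time (snd \<xi> s) \<omega> (Suc i)"
    using ex_disc_time_interval by blast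
  then show ?thesis
    using False disc_path_eq[of s "case_nat \<xi> \<omega>" "Suc i" k] disc_path_eq[of "snd \<xi> s" \<omega> i]
    by (simp add: disc_time_case_nat del: state.simps(2))
qed

lemma disc_path_0: "disc_path s \<omega> 0 = snd s"
  by (subst disc_path_eq[of _ _ 0]) (auto simp: disc_time_def disc_hold_pos)

lemma measure_\<kappa>_snd:
  assumes "y' \<noteq> y"
  shows "measure (\<kappa> (x, y)) {s. snd s = y'} = pmf (R y) y' / (1 - pmf (R y) y)"
proof -
  have "set_pmf (R y) \<inter> - {y} \<noteq> {}" using R_stay R_move by blast
  moreover have "measure (R y) (- {y}) = 1 - pmf (R y) y"
    using measure_pmf.prob_compl[of "{y}" "R y"] by (simp add: measure_pmf_single Compl_eq_Diff_UNIV)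
  moreover have "pmf (map_pmf snd (\<kappa> (x, y))) y' = measure (\<kappa> (x, y)) {s. snd s = y'}"
    by (simp add: pmf_map vimage_def)
  ultimately show ?thesis using assms by (simp add: snd_\<kappa> pmf_cond)
qed

lemma AE_driver_moves: "AE \<xi> in driver. snd (snd \<xi> s) \<noteq> snd s"
  using AE_driver_support[of s]
proof eventually_elim
  case (elim \<xi>)
  have "set_pmf (R (snd s)) \<inter> - {snd s} \<noteq> {}" using R_stay R_move by blast
  moreover have "snd (snd \<xi> s) \<in> set_pmf (map_pmf snd (\<kappa> s))" using elim by simp
  ultimately show ?case by (simp add: snd_\<kappa>)
qed

lemma measurable_disc_path_event: "Measurable.pred drivers (\<lambda>\<omega>. \<forall>j\<le>m. disc_path s \<omega> j = w j)"
proof -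
  have "Measurable.pred drivers (\<lambda>\<omega>. disc_path s \<omega> j = w j)" for j
    by (rule measurable_compose[OF measurable_disc_path]) simp
  then show ?thesis
    by (intro pred_intros_countable pred_intros_imp') auto
qed

text \<open>A prescribed path of length \<open>m\<close> either is constant, and then the first holding time must exceed \<open>m\<close>,
or leaves its initial state at a time \<open>g \<le> m\<close>. In the latter case the first holding time must
be \<open>g\<close> and the first jump must lead to \<open>w g\<close>; the rest is a path of length \<open>m - g\<close>. The normalising factor
\<open>1 - p\<close> in the law of the jump chain cancels against the one in the geometric distribution.\<close>

lemma disc_path_law:
  "emeasure drivers {\<omega>. \<forall>j\<le>m. disc_path s \<omega> j = w j}
     = (if snd s = w 0 then ennreal (\<Prod>j<m. pmf (R (w j)) (w (Suc j))) else 0)"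
proof (induction m arbitrary: s w rule: less_induct)
  case (less m)
  define y where "y = snd s"
  define p where "p = pmf (R y) y"
  note p = stay_prob[of y, folded p_def]
  show ?case
  proof (cases "w 0 = y")
    case False
    then have "\<not> (\<forall>j\<le>m. disc_path s \<omega> j = w j)" for \<omega>
      using disc_path_0[of s] by (auto simp: y_def intro!: exI[of _ 0])
    then have "{\<omega>. \<forall>j\<le>m. disc_path s \<omega> j = w j} = {}" by simp
    then show ?thesis using False by (simp only: y_def) simp
  next
    case w0: True
    have step: "emeasure drivers {\<omega>. \<forall>j\<le>m. disc_path s \<omega> j = w j}
       = (\<integral>\<^sup>+\<xi>. emeasure drivers {\<omega>. \<forall>j\<le>m. disc_path s (case_nat \<xi> \<omega>) j = w j} \<partial>driver)"
      by (rule emeasure_drivers_first_step[OF measurable_disc_path_event])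
    show ?thesis
    proof (cases "\<forall>j\<le>m. w j = y")
      case True
      have "emeasure drivers {\<omega>. \<forall>j\<le>m. disc_path s \<omega> j = w j}
         = (\<integral>\<^sup>+\<xi>. indicator {\<xi>. fst \<xi> \<in> {e. m < disc_hold y e} \<and> snd \<xi> s \<in> UNIV} \<xi> \<partial>driver)"
        unfolding step
      \<comment> \<open>Jumps to the same state have probability zero, so the end of the holding time is visible in the path.\<close>
      proof (intro nn_integral_cong_AE, use AE_driver_moves[of s] in eventually_elim)
        fix \<xi> :: "real \<times> ('x \<times> 'y \<Rightarrow> 'x \<times> 'y)" assume mv: "snd (snd \<xi> s) \<noteq> snd s"
        show "emeasure drivers {\<omega>. \<forall>j\<le>m. disc_path s (case_nat \<xi> \<omega>) j = w j}
           = indicator {\<xi>. fst \<xi> \<in> {e. m < disc_hold y e} \<and> snd \<xi> s \<in> UNIV} \<xi>"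
        proof (cases "m < disc_hold y (fst \<xi>)")
          case mlt: True
          then have "{\<omega>. \<forall>j\<le>m. disc_path s (case_nat \<xi> \<omega>) j = w j} = UNIV"
            using True by (auto simp: disc_path_case_nat y_def)
          then show ?thesis using mlt drivers.emeasure_space_1 by simp
        next
          case mge: False
          have "disc_path s (case_nat \<xi> \<omega>) (disc_hold y (fst \<xi>)) \<noteq> w (disc_hold y (fst \<xi>))" for \<omega>
            using mge mv True by (simp add: disc_path_case_nat y_def disc_path_0)
          then have "\<not> (\<forall>j\<le>m. disc_path s (case_nat \<xi> \<omega>) j = w j)" for \<omega>
            using mge by (auto simp: not_less)
          then have empty: "{\<omega>. \<forall>j\<le>m. disc_path s (case_nat \<xi> \<omega>) j = w j} = {}" by simp
          show ?thesis unfolding empty using mge by simp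
        qed
      qed
      also have "\<dots> = emeasure driver {\<xi>. fst \<xi> \<in> {e. m < disc_hold y e} \<and> snd \<xi> s \<in> UNIV}"
        by (intro nn_integral_indicator sets_driver_rectangle) measurable
      also have "\<dots> = ennreal (p ^ m)"
        by (subst emeasure_driver_rectangle) (auto simp: emeasure_disc_hold_gt p_def measure_pmf.emeasure_eq_measure)
      also have "p ^ m = (\<Prod>j<m. pmf (R (w j)) (w (Suc j)))"
        using True by (simp add: p_def)
      finally show ?thesis using w0 by (simp add: y_def)
    next
      case False
      define g where "g = (LEAST j. w j \<noteq> y)"
      have ex: "\<exists>j. w j \<noteq> y" using False by blast
      have g: "w g \<noteq> y" unfolding g_def using ex by (rule LeastI_ex)
      have before: "w j = y" if "j < g" for j using not_less_Least[of j "\<lambda>j. w j \<noteq> y"] that by (auto simp: g_def)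
      have gm: "g \<le> m" using False unfolding g_def by (meson Least_le order_trans)
      have g0: "0 < g" using g w0 by (cases g) auto
      define c where "c = (\<Prod>j<m - g. pmf (R (w (g + j))) (w (Suc (g + j))))"
      have c0: "0 \<le> c" unfolding c_def by (intro prod_nonneg) auto
      let ?A = "{\<xi>. fst \<xi> \<in> {e. disc_hold y e = g} \<and> snd \<xi> s \<in> {s'. snd s' = w g}}"
      have "emeasure drivers {\<omega>. \<forall>j\<le>m. disc_path s \<omega> j = w j} = (\<integral>\<^sup>+\<xi>. ennreal c * indicator ?A \<xi> \<partial>driver)"
        unfolding step
      proof (intro nn_integral_cong_AE, use AE_driver_moves[of s] in eventually_elim)
        fix \<xi> :: "real \<times> ('x \<times> 'y \<Rightarrow> 'x \<times> 'y)" assume mv: "snd (snd \<xi> s) \<noteq> snd s"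
        define G where "G = disc_hold y (fst \<xi>)"
        show "emeasure drivers {\<omega>. \<forall>j\<le>m. disc_path s (case_nat \<xi> \<omega>) j = w j} = ennreal c * indicator ?A \<xi>"
        proof (cases "G = g")
          case True
          have "(\<forall>j\<le>m. disc_path s (case_nat \<xi> \<omega>) j = w j) \<longleftrightarrow> (\<forall>j\<le>m - g. disc_path (snd \<xi> s) \<omega> j = w (g + j))" (is "?L \<longleftrightarrow> ?R") for \<omega>
          proof
            assume L: ?L
            show ?R
            proof (intro allI impI)
              fix j assume "j \<le> m - g"
              then have "disc_path s (case_nat \<xi> \<omega>) (g + j) = w (g + j)" using L gm by auto
              then show "disc_path (snd \<xi> s) \<omega> j = w (g + j)" using True by (simp add: disc_path_case_nat y_def[symmetric] G_def)
            qed
          next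
            assume R: ?R
            show ?L
            proof (intro allI impI)
              fix j assume j: "j \<le> m"
              show "disc_path s (case_nat \<xi> \<omega>) j = w j"
              proof (cases "j < g")
                case True then show ?thesis using \<open>G = g\<close> before by (simp add: disc_path_case_nat y_def[symmetric] G_def)
              next
                case False
                then have "disc_path (snd \<xi> s) \<omega> (j - g) = w (g + (j - g))" using R j by auto
                then show ?thesis using False \<open>G = g\<close> by (simp add: disc_path_case_nat y_def[symmetric] G_def)
              qed
            qed
          qed
          then show ?thesis
            using less[of "m - g" "snd \<xi> s" "\<lambda>j. w (g + j)"] g0 gm True
            by (auto simp: c_def G_def split: split_indicator)
        next
          case ne: False
          have "\<not> (\<forall>j\<le>m. disc_path s (case_nat \<xi> \<omega>) j = w j)" for \<omega>
          proof (cases "G < g")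
            case True
            then have "disc_path s (case_nat \<xi> \<omega>) G \<noteq> w G"
              using mv before[of G] by (simp add: disc_path_case_nat y_def[symmetric] G_def disc_path_0)
            then show ?thesis using True gm by (auto intro!: exI[of _ G])
          next
            case False
            then have "disc_path s (case_nat \<xi> \<omega>) g \<noteq> w g"
              using ne g by (simp add: disc_path_case_nat y_def[symmetric] G_def)
            then show ?thesis using gm by auto
          qed
          then have empty: "{\<omega>. \<forall>j\<le>m. disc_path s (case_nat \<xi> \<omega>) j = w j} = {}" by simp
          show ?thesis unfolding empty using ne by (simp add: G_def)
        qed
      qed
      also have "\<dots> = ennreal c * emeasure driver ?A"
        by (intro nn_integral_cmult_indicator sets_driver_rectangle) measurable
      also have "emeasure driver ?A = ennreal (p ^ (g - 1) * (1 - p)) * ennreal (pmf (R y) (w g) / (1 - p))"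
        using measure_\<kappa>_snd[OF g, of "fst s"] g0
        by (subst emeasure_driver_rectangle) (auto simp: emeasure_disc_hold_eq p_def measure_pmf.emeasure_eq_measure y_def)
      also have "ennreal c * \<dots> = ennreal (c * (p ^ (g - 1) * pmf (R y) (w g)))"
        using p c0 by (simp add: ennreal_mult[symmetric])
      also have "c * (p ^ (g - 1) * pmf (R y) (w g)) = (\<Prod>j<m. pmf (R (w j)) (w (Suc j)))"
      proof -
        have "(\<Prod>j<m. pmf (R (w j)) (w (Suc j)))
            = (\<Prod>j<g. pmf (R (w j)) (w (Suc j))) * (\<Prod>j\<in>{g..<m}. pmf (R (w j)) (w (Suc j)))"
          using gm by (subst prod.union_disjoint[symmetric]) (auto intro!: prod.cong)
        also have "(\<Prod>j\<in>{g..<m}. pmf (R (w j)) (w (Suc j))) = c"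
          unfolding c_def using gm
          by (intro prod.reindex_bij_witness[of _ "\<lambda>j. g + j" "\<lambda>j. j - g"]) auto
        also have "(\<Prod>j<g. pmf (R (w j)) (w (Suc j))) = p ^ (g - 1) * pmf (R y) (w g)"
        proof -
          obtain g' where g': "g = Suc g'" using g0 by (cases g) auto
          have "(\<Prod>j<g'. pmf (R (w j)) (w (Suc j))) = (\<Prod>j<g'. p)"
            using before g' by (intro prod.cong) (auto simp: p_def)
          then show ?thesis using before[of g'] g' by simp
        qed
        finally show ?thesis by simp
      qed
      finally show ?thesis using w0 by (simp add: y_def)
    qed
  qed
qed

section \<open>Non-explosion and exit probabilities\<close>

lemma driver_nn_integral_product:
  assumes [measurable]: "f \<in> borel_measurable borel"
  shows "(\<integral>\<^sup>+\<xi>. f (fst \<xi>) * g (snd \<xi> s) \<partial>driver) = (\<integral>\<^sup>+e. f e \<partial>std_exp) * (\<integral>\<^sup>+s'. g s' \<partial>measure_pmf (\<kappa> s))"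
proof -
  let ?P = "\<Pi>\<^sub>M s\<in>UNIV. measure_pmf (\<kappa> s)"
  interpret B: prob_space ?P
    by (intro prob_space_PiM measure_pmf.prob_space_axioms)
  have [measurable]: "(\<lambda>F. g (F s)) \<in> borel_measurable ?P"
    by (rule measurable_compose[OF measurable_component_singleton[of s]]) auto
  have g: "(\<integral>\<^sup>+F. g (F s) \<partial>?P) = (\<integral>\<^sup>+s'. g s' \<partial>measure_pmf (\<kappa> s))"
  proof -
    have "(\<integral>\<^sup>+s'. g s' \<partial>measure_pmf (\<kappa> s)) = (\<integral>\<^sup>+s'. g s' \<partial>distr ?P (measure_pmf (\<kappa> s)) (\<lambda>F. F s))"
      by (subst distr_PiM_component) (auto simp: measure_pmf.prob_space_axioms)
    also have "\<dots> = (\<integral>\<^sup>+F. g (F s) \<partial>?P)" by (intro nn_integral_distr) auto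
    finally show ?thesis ..
  qed
  have "(\<integral>\<^sup>+\<xi>. f (fst \<xi>) * g (snd \<xi> s) \<partial>driver) = (\<integral>\<^sup>+e. \<integral>\<^sup>+F. f e * g (F s) \<partial>?P \<partial>std_exp)"
    unfolding driver_def by (subst B.nn_integral_fst[symmetric]) auto
  also have "\<dots> = (\<integral>\<^sup>+e. f e * (\<integral>\<^sup>+s'. g s' \<partial>measure_pmf (\<kappa> s)) \<partial>std_exp)"
    by (intro nn_integral_cong) (simp add: nn_integral_cmult g)
  also have "\<dots> = (\<integral>\<^sup>+e. f e \<partial>std_exp) * (\<integral>\<^sup>+s'. g s' \<partial>measure_pmf (\<kappa> s))"
    by (intro nn_integral_multc) auto
  finally show ?thesis .
qed

text \<open>One step of the jump chain, discounted by the expectation \<open>r / (r + 1)\<close> of \<open>exp (- E / r)\<close>, contracts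
the Lyapunov function \<open>V\<close>.\<close>

lemma discounted_time_bound:
  assumes V: "\<And>x. 1 \<le> V x" and \<rho>: "0 \<le> \<rho>"
    and drift: "\<And>x. ennreal (rate x / (rate x + 1)) * (\<integral>\<^sup>+x'. ennreal (V x') \<partial>measure_pmf (J x)) \<le> ennreal (\<rho> * V x)"
  shows "(\<integral>\<^sup>+\<omega>. ennreal (exp (- cont_time s \<omega> k)) \<partial>drivers) \<le> ennreal (\<rho> ^ k * V (fst s))"
proof (induction k arbitrary: s)
  case 0
  then show ?case using V[of "fst s"] drivers.emeasure_space_1 by (simp add: cont_time_def)
next
  case (Suc k)
  define r where "r = rate (fst s)"
  have r: "0 < r" by (simp add: r_def rate_pos)
  have V0: "0 \<le> V x" for x using V[of x] by simp
  have "(\<integral>\<^sup>+\<omega>. ennreal (exp (- cont_time s \<omega> (Suc k))) \<partial>drivers)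
     = (\<integral>\<^sup>+\<xi>. (\<integral>\<^sup>+\<omega>. ennreal (exp (- cont_time s (case_nat \<xi> \<omega>) (Suc k))) \<partial>drivers) \<partial>driver)"
    by (rule drivers_nn_integral_first_step) measurable
  also have "\<dots> \<le> (\<integral>\<^sup>+\<xi>. ennreal (exp (- (fst \<xi> / r))) * ennreal (\<rho> ^ k * V (fst (snd \<xi> s))) \<partial>driver)"
  proof (intro nn_integral_mono)
    fix \<xi>
    have "(\<integral>\<^sup>+\<omega>. ennreal (exp (- cont_time s (case_nat \<xi> \<omega>) (Suc k))) \<partial>drivers)
       = (\<integral>\<^sup>+\<omega>. ennreal (exp (- (fst \<xi> / r))) * ennreal (exp (- cont_time (snd \<xi> s) \<omega> k)) \<partial>drivers)"
      by (intro nn_integral_cong) (simp add: cont_time_case_nat r_def ennreal_mult[symmetric] exp_add[symmetric])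
    also have "\<dots> = ennreal (exp (- (fst \<xi> / r))) * (\<integral>\<^sup>+\<omega>. ennreal (exp (- cont_time (snd \<xi> s) \<omega> k)) \<partial>drivers)"
      by (rule nn_integral_cmult) measurable
    also have "\<dots> \<le> ennreal (exp (- (fst \<xi> / r))) * ennreal (\<rho> ^ k * V (fst (snd \<xi> s)))"
      using Suc by (intro mult_left_mono) auto
    finally show "(\<integral>\<^sup>+\<omega>. ennreal (exp (- cont_time s (case_nat \<xi> \<omega>) (Suc k))) \<partial>drivers) \<le> \<dots>" .
  qed
  also have "\<dots> = ennreal (r / (r + 1)) * (\<integral>\<^sup>+s'. ennreal (\<rho> ^ k * V (fst s')) \<partial>measure_pmf (\<kappa> s))"
    unfolding driver_nn_integral_product[of "\<lambda>e. ennreal (exp (- (e / r)))" "\<lambda>s'. ennreal (\<rho> ^ k * V (fst s'))", simplified]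
    using r by (subst nn_integral_std_exp_discount) auto
  also have "(\<integral>\<^sup>+s'. ennreal (\<rho> ^ k * V (fst s')) \<partial>measure_pmf (\<kappa> s)) = ennreal (\<rho> ^ k) * (\<integral>\<^sup>+x'. ennreal (V x') \<partial>measure_pmf (J (fst s)))"
    unfolding fst_\<kappa>[symmetric] using \<rho> V0 by (simp add: ennreal_mult nn_integral_cmult nn_integral_map_pmf)
  also have "ennreal (r / (r + 1)) * \<dots> \<le> ennreal (\<rho> ^ k) * ennreal (\<rho> * V (fst s))"
    unfolding r_def using mult_left_mono[OF drift[of "fst s"], of "ennreal (\<rho> ^ k)"] by (simp add: mult_ac)
  also have "\<dots> = ennreal (\<rho> ^ Suc k * V (fst s))"
    using \<rho> V0 by (simp add: ennreal_mult[symmetric] mult_ac)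
  finally show ?case .
qed

text \<open>The expected sum of \<open>exp (- T_k)\<close> over all \<open>k\<close> is bounded by a geometric series. Almost surely this sum
is finite, so its terms tend to zero.\<close>

lemma no_explosion:
  assumes V: "\<And>x. 1 \<le> V x" and \<rho>: "0 \<le> \<rho>" "\<rho> < 1"
    and drift: "\<And>x. ennreal (rate x / (rate x + 1)) * (\<integral>\<^sup>+x'. ennreal (V x') \<partial>measure_pmf (J x)) \<le> ennreal (\<rho> * V x)"
  shows "AE \<omega> in drivers. filterlim (cont_time s \<omega>) at_top sequentially"
proof -
  have V0: "0 \<le> V x" for x using V[of x] by simp
  have "(\<integral>\<^sup>+\<omega>. (\<Sum>k. ennreal (exp (- cont_time s \<omega> k))) \<partial>drivers) = (\<Sum>k. \<integral>\<^sup>+\<omega>. ennreal (exp (- cont_time s \<omega> k)) \<partial>drivers)"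
    by (rule nn_integral_suminf) measurable
  also have "\<dots> \<le> (\<Sum>k. ennreal (\<rho> ^ k * V (fst s)))"
    by (intro suminf_le discounted_time_bound V \<rho> drift) auto
  also have "\<dots> < \<top>"
    using \<rho> V0 by (subst suminf_ennreal2) (auto intro!: summable_mult2 summable_geometric)
  finally have "(\<integral>\<^sup>+\<omega>. (\<Sum>k. ennreal (exp (- cont_time s \<omega> k))) \<partial>drivers) \<noteq> \<top>" by simp
  then have "AE \<omega> in drivers. (\<Sum>k. ennreal (exp (- cont_time s \<omega> k))) \<noteq> \<top>"
    by (intro nn_integral_PInf_AE[unfolded infinity_ennreal_def]) auto
  then show ?thesis
  proof eventually_elim
    case (elim \<omega>)
    then have "summable (\<lambda>k. exp (- cont_time s \<omega> k))"
      by (intro summable_suminf_not_top) auto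
    then have "(\<lambda>k. exp (- cont_time s \<omega> k)) \<longlonglongrightarrow> 0" by (rule summable_LIMSEQ_zero)
    then have "filterlim (\<lambda>k. ln (exp (- cont_time s \<omega> k))) at_bot sequentially"
      by (intro filterlim_compose[OF ln_at_0]) (auto simp: filterlim_at eventually_sequentially)
    then show ?case by (simp add: filterlim_uminus_at_bot)
  qed
qed

lemma measurable_exit_event:
  "Measurable.pred drivers (\<lambda>\<omega>. \<exists>i<k. state s \<omega> (Suc i) \<notin> G \<or> thr < fst (\<omega> i))"
proof -
  have "Measurable.pred drivers (\<lambda>\<omega>. state s \<omega> (Suc i) \<notin> G)" for i
    by (rule measurable_compose[OF measurable_state]) simp
  then show ?thesis
    by (intro pred_intros_countable pred_intros_conj1' pred_intros_logic) auto
qed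

text \<open>A union bound over the jumps. It is proved by first-step analysis because the probability of leaving \<open>G\<close> is
small only as long as the current state is in \<open>G\<close>.\<close>

lemma exit_bound:
  assumes \<epsilon>: "\<And>s. s \<in> G \<Longrightarrow> emeasure (measure_pmf (\<kappa> s)) (- G) \<le> ennreal \<epsilon>" and "0 \<le> \<epsilon>" "0 \<le> thr" and "s \<in> G"
  shows "emeasure drivers {\<omega>. \<exists>i<k. state s \<omega> (Suc i) \<notin> G \<or> thr < fst (\<omega> i)} \<le> ennreal (real k * (\<epsilon> + exp (- thr)))"
  using \<open>s \<in> G\<close>
proof (induction k arbitrary: s)
  case 0
  then show ?case by simp
next
  case (Suc k)
  let ?E = "\<lambda>k s \<omega>. \<exists>i<k. state s \<omega> (Suc i) \<notin> G \<or> thr < fst (\<omega> i)"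
  let ?A = "{\<xi>. fst \<xi> \<in> UNIV \<and> snd \<xi> s \<in> - G}" and ?B = "{\<xi>. fst \<xi> \<in> {e. thr < e} \<and> snd \<xi> s \<in> UNIV}"
  let ?c = "ennreal (real k * (\<epsilon> + exp (- thr)))"
  have AB: "?A \<in> sets driver" "?B \<in> sets driver" by (intro sets_driver_rectangle; simp)+
  have "emeasure drivers {\<omega>. ?E (Suc k) s \<omega>} = (\<integral>\<^sup>+\<xi>. emeasure drivers {\<omega>. ?E (Suc k) s (case_nat \<xi> \<omega>)} \<partial>driver)"
    by (rule emeasure_drivers_first_step[OF measurable_exit_event])
  also have "\<dots> \<le> (\<integral>\<^sup>+\<xi>. indicator ?A \<xi> + indicator ?B \<xi> + ?c \<partial>driver)"
  proof (intro nn_integral_mono)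
    fix \<xi> :: "real \<times> ('x \<times> 'y \<Rightarrow> 'x \<times> 'y)"
    show "emeasure drivers {\<omega>. ?E (Suc k) s (case_nat \<xi> \<omega>)} \<le> indicator ?A \<xi> + indicator ?B \<xi> + ?c"
    proof (cases "\<xi> \<in> ?A \<union> ?B")
      case True
      have "emeasure drivers {\<omega>. ?E (Suc k) s (case_nat \<xi> \<omega>)} \<le> 1" by (rule drivers.emeasure_le_1)
      also have "1 \<le> indicator ?A \<xi> + (indicator ?B \<xi> :: ennreal)" using True by (auto split: split_indicator)
      finally show ?thesis by (rule order_trans) simp
    next
      case False
      then have "snd \<xi> s \<in> G" and le: "\<not> thr < fst \<xi>" by auto
      have "?E (Suc k) s (case_nat \<xi> \<omega>) \<longleftrightarrow> ?E k (snd \<xi> s) \<omega>" for \<omega>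
        unfolding Ex_less_Suc2 using \<open>snd \<xi> s \<in> G\<close> le by (simp only: state_case_nat) simp
      then have "emeasure drivers {\<omega>. ?E (Suc k) s (case_nat \<xi> \<omega>)} \<le> ?c"
        using Suc.IH[OF \<open>snd \<xi> s \<in> G\<close>] by simp
      then show ?thesis by (rule order_trans) simp
    qed
  qed
  also have "\<dots> = emeasure driver ?A + emeasure driver ?B + ?c"
    using AB driver.emeasure_space_1 by (simp add: nn_integral_add)
  also have "emeasure driver ?A \<le> ennreal \<epsilon>"
  proof -
    interpret prob_space std_exp by (rule prob_space_std_exp)
    show ?thesis using emeasure_space_1 \<epsilon>[OF Suc.prems] by (subst emeasure_driver_rectangle) auto
  qed
  also have "emeasure driver ?B = ennreal (exp (- thr))"
    using \<open>0 \<le> thr\<close> by (subst emeasure_driver_rectangle) (auto simp: emeasure_std_exp_gt measure_pmf.emeasure_eq_measure)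
  also have "ennreal \<epsilon> + ennreal (exp (- thr)) + ?c = ennreal (real (Suc k) * (\<epsilon> + exp (- thr)))"
    using \<open>0 \<le> \<epsilon>\<close> by (simp add: ennreal_plus[symmetric] algebra_simps del: ennreal_plus)
  finally show ?case by (simp add: add_right_mono)
qed

end

section \<open>Inserting the odd times\<close>

text \<open>The law of the middle state of two steps of \<open>K\<close> from \<open>w\<close> to \<open>w'\<close>. The default value for
an impossible pair \<open>(w, w')\<close> is \<open>w\<close>, so that the bridge does not leave a set that is closed under \<open>K\<close>.\<close>

definition bridge :: "('y \<Rightarrow> 'y pmf) \<Rightarrow> 'y \<Rightarrow> 'y \<Rightarrow> 'y pmf" where
  "bridge K w w' =
    (if w' \<in> set_pmf (bind_pmf (K w) K)
     then embed_pmf (\<lambda>z. pmf (K w) z * pmf (K z) w' / pmf (bind_pmf (K w) K) w')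
     else return_pmf w)"

lemma pmf_two_steps_bridge:
  "pmf (bind_pmf (K w) K) w' * pmf (bridge K w w') z = pmf (K w) z * pmf (K z) w'"
proof (cases "w' \<in> set_pmf (bind_pmf (K w) K)")
  case True
  define p where "p = pmf (bind_pmf (K w) K) w'"
  have p: "0 < p" using True by (simp only: p_def pmf_positive)
  have "ennreal p = (\<integral>\<^sup>+z. ennreal (pmf (K w) z * pmf (K z) w') \<partial>count_space UNIV)"
    unfolding p_def ennreal_pmf_bind nn_integral_measure_pmf by (simp add: ennreal_mult)
  then have "(\<integral>\<^sup>+z. ennreal (pmf (K w) z * pmf (K z) w' / p) \<partial>count_space UNIV) = ennreal p / ennreal p"
    using p by (simp add: divide_ennreal[symmetric] nn_integral_divide)
  also have "\<dots> = 1" using p by (simp add: divide_ennreal)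
  finally have "pmf (bridge K w w') z = pmf (K w) z * pmf (K z) w' / p"
    using True p by (simp add: bridge_def p_def[symmetric] pmf_embed_pmf)
  then show ?thesis using p by (simp add: p_def[symmetric])
next
  case False
  then have "pmf (bind_pmf (K w) K) w' = 0" by (metis set_pmf_iff)
  moreover have "z \<notin> set_pmf (K w) \<or> w' \<notin> set_pmf (K z)" using False by auto
  ultimately show ?thesis by (auto simp: set_pmf_iff)
qed

lemma set_pmf_bridge: "set_pmf (bridge K w w') \<subseteq> insert w (set_pmf (K w))"
proof (cases "w' \<in> set_pmf (bind_pmf (K w) K)")
  case True
  then have p: "pmf (bind_pmf (K w) K) w' \<noteq> 0" by (metis set_pmf_iff)
  then have "z \<in> set_pmf (K w)" if "z \<in> set_pmf (bridge K w w')" for z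
    using that pmf_two_steps_bridge[of K w w' z] by (auto simp: set_pmf_iff)
  then show ?thesis by auto
qed (auto simp: bridge_def)

text \<open>One bridge for every time and every pair of end points; \<open>refine\<close> uses the ones that
belong to the end points visited by the path.\<close>

definition bridges :: "('y \<Rightarrow> 'y pmf) \<Rightarrow> (nat \<times> 'y \<times> 'y \<Rightarrow> 'y) measure" where
  "bridges K = (\<Pi>\<^sub>M i\<in>UNIV. measure_pmf (case i of (k, w, w') \<Rightarrow> bridge K w w'))"

definition refine :: "(nat \<Rightarrow> 'y) \<Rightarrow> (nat \<times> 'y \<times> 'y \<Rightarrow> 'y) \<Rightarrow> nat \<Rightarrow> 'y" where
  "refine w v m = (if even m then w (m div 2) else v (m div 2, w (m div 2), w (Suc (m div 2))))"

lemma space_bridges [simp]: "space (bridges K) = UNIV"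
  by (simp add: bridges_def space_PiM)

lemma prob_space_bridges: "prob_space (bridges K)"
  unfolding bridges_def by (intro prob_space_PiM measure_pmf.prob_space_axioms)

lemma measurable_bridges: "(\<lambda>v. v i) \<in> measurable (bridges K) (count_space UNIV)"
proof -
  have "(\<lambda>v. v i) \<in> measurable (bridges K) (measure_pmf (case i of (k, w, w') \<Rightarrow> bridge K w w'))"
    unfolding bridges_def by measurable
  then show ?thesis by simp
qed

lemma AE_bridges: "AE v in bridges K. \<forall>k w w' :: 'y::countable. v (k, w, w') \<in> set_pmf (bridge K w w')"
proof -
  have "AE v in bridges K. v i \<in> set_pmf (case i of (k, w, w') \<Rightarrow> bridge K w w')" for i
    unfolding bridges_def
    by (rule AE_PiM_component) (auto simp: measure_pmf.prob_space_axioms AE_measure_pmf)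
  from this[of "(_, _, _)"] show ?thesis by (simp add: AE_all_countable)
qed

lemma bridges_law:
  "emeasure (bridges K) {v. \<forall>j<k. v (j, x (2*j), x (2*j+2)) = x (2*j+1)}
    = ennreal (\<Prod>j<k. pmf (bridge K (x (2*j)) (x (2*j+2))) (x (2*j+1)))"
proof -
  interpret product_prob_space "\<lambda>i. measure_pmf (case i of (k, w, w') \<Rightarrow> bridge K w w')" UNIV
    by unfold_locales
  let ?f = "\<lambda>j. (j, x (2*j), x (2*j+2))"
  have "emeasure (bridges K) {v \<in> space (bridges K). \<forall>i\<in>?f ` {..<k}. v i \<in> {x (2 * fst i + 1)}}
     = (\<Prod>i\<in>?f ` {..<k}. emeasure (measure_pmf (case i of (k, w, w') \<Rightarrow> bridge K w w')) {x (2 * fst i + 1)})"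
    unfolding bridges_def by (rule emeasure_PiM_Collect) auto
  also have "\<dots> = (\<Prod>j<k. ennreal (pmf (bridge K (x (2*j)) (x (2*j+2))) (x (2*j+1))))"
    by (subst prod.reindex) (auto simp: inj_on_def emeasure_pmf_single)
  also have "\<dots> = ennreal (\<Prod>j<k. pmf (bridge K (x (2*j)) (x (2*j+2))) (x (2*j+1)))"
    by (rule prod_ennreal) simp
  also have "{v \<in> space (bridges K). \<forall>i\<in>?f ` {..<k}. v i \<in> {x (2 * fst i + 1)}}
      = {v. \<forall>j<k. v (j, x (2*j), x (2*j+2)) = x (2*j+1)}" by auto
  finally show ?thesis .
qed

lemma measurable_refine:
  fixes W :: "nat \<Rightarrow> 'w \<Rightarrow> 'y::countable"
  assumes W: "\<And>k. W k \<in> measurable M (count_space UNIV)"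
  shows "(\<lambda>z. refine (\<lambda>k. W k (fst z)) (snd z) m) \<in> measurable (M \<Otimes>\<^sub>M bridges K) (count_space UNIV)"
proof -
  have W': "(\<lambda>z. W k (fst z)) \<in> measurable (M \<Otimes>\<^sub>M bridges K) (count_space UNIV)" for k
    by (rule measurable_compose[OF measurable_fst W])
  have v: "(\<lambda>z. snd z (k, w, w')) \<in> measurable (M \<Otimes>\<^sub>M bridges K) (count_space UNIV)" for k w w'
    by (rule measurable_compose[OF measurable_snd measurable_bridges])
  have "(\<lambda>z. snd z (k, W i (fst z), W j (fst z))) \<in> measurable (M \<Otimes>\<^sub>M bridges K) (count_space UNIV)" for k i j
    by (rule measurable_compose_countable[where g = "\<lambda>z. W i (fst z)", OF measurable_compose_countable[where g = "\<lambda>z. W j (fst z)", OF v W'] W'])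
  then show ?thesis using W' by (cases "even m") (simp_all add: refine_def)
qed

lemma prod_lessThan_double:
  fixes f :: "nat \<Rightarrow> 'a::comm_monoid_mult"
  shows "(\<Prod>i<2 * k. f i) = (\<Prod>j<k. f (2*j) * f (2*j+1))"
  by (induction k) (auto simp: mult.assoc)

text \<open>At an even final time the path event is a product event, and each factor \<open>K^2(w, w') bridge(z)\<close> equals
\<open>K(w, z) K(z, w')\<close>. At an odd final time the next state also enters the construction, and one sums over it.\<close>

lemma refine_law:
  fixes W :: "nat \<Rightarrow> 'w \<Rightarrow> 'y::countable"
  assumes M: "prob_space M" and W: "\<And>k. W k \<in> measurable M (count_space UNIV)"
    and law: "\<And>m w. emeasure M {\<omega> \<in> space M. \<forall>j\<le>m. W j \<omega> = w j}
      = (if y0 = w 0 then ennreal (\<Prod>j<m. pmf (bind_pmf (K (w j)) K) (w (Suc j))) else 0)"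
  shows "emeasure (M \<Otimes>\<^sub>M bridges K) {z \<in> space (M \<Otimes>\<^sub>M bridges K). \<forall>i\<le>m. refine (\<lambda>k. W k (fst z)) (snd z) i = x i}
      = (if y0 = x 0 then ennreal (\<Prod>i<m. pmf (K (x i)) (x (Suc i))) else 0)"
proof -
  interpret M: prob_space M by fact
  interpret B: prob_space "bridges K" by (rule prob_space_bridges)
  let ?P = "M \<Otimes>\<^sub>M bridges K"
  have sp: "space ?P = space M \<times> UNIV" by (simp add: space_pair_measure)
  have even: "emeasure ?P {z \<in> space ?P. \<forall>i\<le>2*k. refine (\<lambda>k. W k (fst z)) (snd z) i = x i}
      = (if y0 = x 0 then ennreal (\<Prod>i<2*k. pmf (K (x i)) (x (Suc i))) else 0)" for k x
  proof -
    let ?A = "{\<omega> \<in> space M. \<forall>j\<le>k. W j \<omega> = x (2*j)}" and ?B = "{v. \<forall>j<k. v (j, x (2*j), x (2*j+2)) = x (2*j+1)}"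
    have "(\<forall>i\<le>2*k. refine w v i = x i) \<longleftrightarrow> (\<forall>j\<le>k. w j = x (2*j)) \<and> (\<forall>j<k. v (j, x (2*j), x (2*j+2)) = x (2*j+1))" (is "?L \<longleftrightarrow> ?R") for w v
    proof
      assume L: ?L
      have w: "w j = x (2*j)" if "j \<le> k" for j using L[rule_format, of "2*j"] that by (simp add: refine_def)
      moreover have "v (j, x (2*j), x (2*j+2)) = x (2*j+1)" if "j < k" for j
        using L[rule_format, of "2*j+1"] that w[of j] w[of "Suc j"] by (simp add: refine_def)
      ultimately show ?R by blast
    next
      assume R: ?R
      show ?L
      proof (intro allI impI)
        fix i assume "i \<le> 2 * k"
        show "refine w v i = x i"
        proof (cases "even i")
          case True
          then obtain j where "i = 2 * j" by blast
          then show ?thesis using R \<open>i \<le> 2 * k\<close> by (simp add: refine_def)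
        next
          case False
          then obtain j where i: "i = 2 * j + 1" by (rule oddE)
          then have "j < k" using \<open>i \<le> 2 * k\<close> by simp
          then have "w j = x (2*j)" "w (Suc j) = x (2*j+2)" "v (j, x (2*j), x (2*j+2)) = x (2*j+1)"
            using R[THEN conjunct1, rule_format, of j] R[THEN conjunct1, rule_format, of "Suc j"] R[THEN conjunct2, rule_format, of j] by auto
          then show ?thesis using i by (simp add: refine_def)
        qed
      qed
    qed
    then have AB: "{z \<in> space ?P. \<forall>i\<le>2*k. refine (\<lambda>k. W k (fst z)) (snd z) i = x i} = ?A \<times> ?B"
      by (auto simp: sp)
    have A: "?A \<in> sets M" by (rule sets_path_event[OF W])
    have B: "?B \<in> sets (bridges K)"
      using sets_path_event[of "\<lambda>j v. v (j, x (2*j), x (2*j+2))" "bridges K" "k - 1" "\<lambda>j. x (2*j+1)", OF measurable_bridges]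
      sets.top[of "bridges K"]
      by (cases k) (simp_all add: less_Suc_eq_le)
    have "emeasure ?P {z \<in> space ?P. \<forall>i\<le>2*k. refine (\<lambda>k. W k (fst z)) (snd z) i = x i}
       = emeasure M ?A * emeasure (bridges K) ?B"
      unfolding AB by (rule B.emeasure_pair_measure_Times[OF A B])
    also have "\<dots> = (if y0 = x 0 then ennreal ((\<Prod>j<k. pmf (bind_pmf (K (x (2*j))) K) (x (2 * Suc j))) *
        (\<Prod>j<k. pmf (bridge K (x (2*j)) (x (2*j+2))) (x (2*j+1)))) else 0)"
      using law[of k "\<lambda>j. x (2*j)"] unfolding bridges_law by (simp add: ennreal_mult prod_nonneg)
    also have "(\<Prod>j<k. pmf (bind_pmf (K (x (2*j))) K) (x (2 * Suc j))) *
        (\<Prod>j<k. pmf (bridge K (x (2*j)) (x (2*j+2))) (x (2*j+1))) = (\<Prod>i<2*k. pmf (K (x i)) (x (Suc i)))"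
      unfolding prod_lessThan_double prod.distrib[symmetric]
      by (intro prod.cong refl) (simp add: pmf_two_steps_bridge)
    finally show ?thesis .
  qed
  show ?thesis
  proof (cases "even m")
    case True
    then show ?thesis using even by auto
  next
    case False
    then obtain k where m: "m = 2 * k + 1" by (rule oddE)
    let ?X = "\<lambda>z. refine (\<lambda>k. W k (fst z)) (snd z)"
    have meas: "{z \<in> space ?P. \<forall>i\<le>l. ?X z i = x i} \<in> sets ?P" for l x
      by (rule sets_path_event[where W = "\<lambda>i z. ?X z i", OF measurable_refine[OF W]])
    let ?x = "\<lambda>y. x(Suc m := y)"
    have ext: "(\<forall>i\<le>m. h i = x i) \<longleftrightarrow> (\<exists>y. \<forall>i\<le>Suc m. h i = ?x y i)" for h
    proof
      assume "\<forall>i\<le>m. h i = x i"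
      then have "\<forall>i\<le>Suc m. h i = ?x (h (Suc m)) i" by (simp add: le_Suc_eq)
      then show "\<exists>y. \<forall>i\<le>Suc m. h i = ?x y i" by blast
    next
      assume "\<exists>y. \<forall>i\<le>Suc m. h i = ?x y i"
      then obtain y where y: "\<forall>i\<le>Suc m. h i = ?x y i" by blast
      show "\<forall>i\<le>m. h i = x i"
      proof (intro allI impI)
        fix i assume "i \<le> m"
        then show "h i = x i" using y[rule_format, of i] by simp
      qed
    qed
    have UN: "{z \<in> space ?P. \<forall>i\<le>m. ?X z i = x i} = (\<Union>y. {z \<in> space ?P. \<forall>i\<le>Suc m. ?X z i = ?x y i})"
      unfolding ext by blast
    have disj: "disjoint_family (\<lambda>y. {z \<in> space ?P. \<forall>i\<le>Suc m. ?X z i = ?x y i})"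
      unfolding disjoint_family_on_def by (force dest: spec[of _ "Suc m"])
    have "emeasure ?P {z \<in> space ?P. \<forall>i\<le>m. ?X z i = x i}
       = (\<integral>\<^sup>+y. emeasure ?P {z \<in> space ?P. \<forall>i\<le>Suc m. ?X z i = ?x y i} \<partial>count_space UNIV)"
      unfolding UN by (rule emeasure_UN_countable[OF meas _ disj]) simp
    also have "\<dots> = (\<integral>\<^sup>+y. (if y0 = x 0 then ennreal (\<Prod>i<m. pmf (K (x i)) (x (Suc i))) else 0) * ennreal (pmf (K (x m)) y) \<partial>count_space UNIV)"
    proof (intro nn_integral_cong)
      fix y
      have "(\<Prod>i<m. pmf (K (?x y i)) (?x y (Suc i))) = (\<Prod>i<m. pmf (K (x i)) (x (Suc i)))"
        by (intro prod.cong) auto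
      then have "(\<Prod>i<Suc m. pmf (K (?x y i)) (?x y (Suc i))) = (\<Prod>i<m. pmf (K (x i)) (x (Suc i))) * pmf (K (x m)) y"
        by simp
      moreover have "Suc m = 2 * Suc k" by (simp add: m)
      ultimately show "emeasure ?P {z \<in> space ?P. \<forall>i\<le>Suc m. ?X z i = ?x y i}
        = (if y0 = x 0 then ennreal (\<Prod>i<m. pmf (K (x i)) (x (Suc i))) else 0) * ennreal (pmf (K (x m)) y)"
        using even[of "Suc k" "?x y"] by (simp add: ennreal_mult prod_nonneg del: prod.lessThan_Suc)
    qed
    also have "\<dots> = (if y0 = x 0 then ennreal (\<Prod>i<m. pmf (K (x i)) (x (Suc i))) else 0)"
      by (subst nn_integral_cmult) (auto simp: nn_integral_pmf)
    finally show ?thesis .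
  qed
qed

section \<open>Ranks of random matrices over a finite field\<close>

text \<open>The probability that a random \<open>m \<times> n\<close> matrix over a field with \<open>q\<close> elements has rank \<open>r\<close>, as a
function of a real number \<open>q\<close>.\<close>

definition rank_prob :: "real \<Rightarrow> nat \<Rightarrow> nat \<Rightarrow> nat \<Rightarrow> real" where
  "rank_prob q n m r = q powi (- ((int m - int r) * (int n - int r))) *
     (qpoch (q powi (- int m)) q r * qpoch (q powi (- int n)) q r) / qpoch (q powi (- int r)) q r"

lemma P_mat_eq_rank_prob:
  "d \<le> n \<Longrightarrow> r \<le> n - d \<Longrightarrow> P_mat q n d r = rank_prob q n (n - d) r"
  by (simp add: P_mat_def rank_prob_def of_nat_diff)

lemma qpoch_Suc: "qpoch a q (Suc r) = qpoch a q r * (1 - a * q ^ r)"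
  by (simp add: qpoch_def mult.commute)

lemma qpoch_Suc_shift: "qpoch a q (Suc r) = (1 - a) * qpoch (a * q) q r"
  unfolding qpoch_def by (subst prod.lessThan_Suc_shift) (simp add: mult.assoc)

lemma qpoch_neg_Suc_shift:
  "q \<noteq> 0 \<Longrightarrow> qpoch (q powi (- int (Suc m))) q (Suc r)
     = (1 - q powi (- int (Suc m))) * qpoch (q powi (- int m)) q r"
  using power_int_add_1[of q "- int (Suc m)"] by (simp add: qpoch_Suc_shift)

lemma qpoch_neg_Suc:
  "q \<noteq> 0 \<Longrightarrow> qpoch (q powi (- int m)) q (Suc r)
     = qpoch (q powi (- int m)) q r * (1 - q powi (int r - int m))"
  by (simp add: qpoch_Suc power_int_diff power_int_minus field_simps)

lemma qpoch_neg_pos: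
  assumes "1 < q" "r \<le> m" shows "0 < qpoch (q powi (- int m)) q r"
  unfolding qpoch_def
proof (intro prod_pos ballI)
  fix i assume "i \<in> {..<r}"
  then have "q ^ i < q ^ m" using assms by (intro power_strict_increasing) auto
  then show "0 < 1 - q powi (- int m) * q ^ i"
    using assms by (simp add: power_int_minus field_simps)
qed

lemma qpoch_neg_eq_0:
  assumes "1 < q" "m < r" shows "qpoch (q powi (- int m)) q r = 0"
  unfolding qpoch_def using assms by (auto simp: power_int_minus intro!: bexI[of _ m])

text \<open>Adding a row to an \<open>m \<times> n\<close> matrix of rank \<open>r\<close> keeps the rank with probability \<open>q^(r - n)\<close> and raises it by one
otherwise. This recurrence for the ranks gives total mass one without the \<open>q\<close>-Chu--Vandermonde identity.\<close>

lemma rank_prob_Suc: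
  assumes q: "1 < q"
  shows "rank_prob q n (Suc m) (Suc s) =
    rank_prob q n m (Suc s) * q powi (- (int n - int (Suc s))) +
    rank_prob q n m s * (1 - q powi (- (int n - int s)))"
proof -
  have q0: "q \<noteq> 0" using q by auto
  define A B D where "A = qpoch (q powi (- int m)) q s" and "B = qpoch (q powi (- int n)) q s"
    and "D = qpoch (q powi (- int s)) q s"
  define x y z where "x = q powi (int s - int m)" and "y = q powi (int s - int n)"
    and "z = q powi (- int (Suc s))"
  define E where "E = q powi (- ((int m - int s) * (int n - int s - 1)))"
  have D: "D \<noteq> 0" using qpoch_neg_pos[OF q, of s s] by (simp add: D_def)
  have z: "1 - z \<noteq> 0"
    using one_less_power[OF q, of "Suc s"] by (simp add: z_def power_int_minus del: of_nat_Suc power_Suc)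
  have e1: "rank_prob q n (Suc m) (Suc s) = E * ((1 - x * z) * A * (B * (1 - y))) / ((1 - z) * D)"
    using q0 unfolding rank_prob_def qpoch_neg_Suc_shift[OF q0, of m] qpoch_neg_Suc_shift[OF q0, of s]
      qpoch_neg_Suc[OF q0, of n]
    by (simp add: A_def B_def D_def E_def x_def y_def z_def power_int_add[symmetric] algebra_simps)
  have E1: "q powi (- ((int m - int (Suc s)) * (int n - int (Suc s)))) * q powi (- (int n - int (Suc s))) = E"
    using q0 by (simp add: E_def power_int_add[symmetric] algebra_simps)
  have E2: "q powi (- ((int m - int s) * (int n - int s))) = E * x"
    using q0 by (simp add: E_def x_def power_int_add[symmetric] algebra_simps)
  have "rank_prob q n m (Suc s) * q powi (- (int n - int (Suc s)))
     = (q powi (- ((int m - int (Suc s)) * (int n - int (Suc s)))) * q powi (- (int n - int (Suc s)))) *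
       ((A * (1 - x)) * (B * (1 - y))) / ((1 - z) * D)"
    unfolding rank_prob_def qpoch_neg_Suc[OF q0, of m] qpoch_neg_Suc_shift[OF q0, of s]
      qpoch_neg_Suc[OF q0, of n] A_def B_def D_def x_def y_def z_def
    by (simp add: mult_ac)
  then have e2: "rank_prob q n m (Suc s) * q powi (- (int n - int (Suc s)))
     = E * ((A * (1 - x)) * (B * (1 - y))) / ((1 - z) * D)"
    by (simp only: E1)
  have e3: "rank_prob q n m s * (1 - q powi (- (int n - int s))) = E * x * (A * B) / D * (1 - y)"
    unfolding rank_prob_def E2 by (simp add: A_def B_def D_def y_def)
  show ?thesis
    unfolding e1 e2 e3 using D z by (simp add: field_simps)
qed

lemma rank_prob_0:
  "q \<noteq> 0 \<Longrightarrow> rank_prob q n (Suc m) 0 = rank_prob q n m 0 * q powi (- int n)"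
  by (simp add: rank_prob_def qpoch_def power_int_add[symmetric] algebra_simps)

lemma sum_rank_prob: "1 < q \<Longrightarrow> (\<Sum>r\<le>m. rank_prob q n m r) = 1"
proof (induction m)
  case 0
  then show ?case by (simp add: rank_prob_def qpoch_def)
next
  case (Suc m)
  have z: "rank_prob q n m (Suc m) = 0"
    using qpoch_neg_eq_0[OF \<open>1 < q\<close>, of m "Suc m"] by (simp add: rank_prob_def)
  let ?c = "\<lambda>r. q powi (- (int n - int r))"
  have "(\<Sum>r\<le>Suc m. rank_prob q n (Suc m) r)
     = rank_prob q n m 0 * ?c 0 + (\<Sum>s\<le>m. rank_prob q n m (Suc s) * ?c (Suc s)) + (\<Sum>s\<le>m. rank_prob q n m s * (1 - ?c s))"
    using Suc.prems by (subst sum.atMost_Suc_shift) (simp add: rank_prob_0 rank_prob_Suc sum.distrib)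
  also have "rank_prob q n m 0 * ?c 0 + (\<Sum>s\<le>m. rank_prob q n m (Suc s) * ?c (Suc s)) = (\<Sum>r\<le>Suc m. rank_prob q n m r * ?c r)"
    by (subst sum.atMost_Suc_shift) simp
  also have "\<dots> = (\<Sum>r\<le>m. rank_prob q n m r * ?c r)" by (simp add: z)
  finally show ?case
    using Suc by (simp add: sum.distrib[symmetric] algebra_simps)
qed

lemma rank_prob_pos: "1 < q \<Longrightarrow> r \<le> m \<Longrightarrow> m \<le> n \<Longrightarrow> 0 < rank_prob q n m r"
  unfolding rank_prob_def by (intro divide_pos_pos mult_pos_pos qpoch_neg_pos zero_less_power_int) auto

lemma qpoch_neg_le_1:
  assumes q: "1 < q" and r: "r \<le> n"
  shows "qpoch (q powi (- int n)) q r \<le> 1"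
  unfolding qpoch_def
proof (intro prod_le_1 conjI)
  fix i assume "i \<in> {..<r}"
  then have "q ^ i < q ^ n" using r q by (intro power_strict_increasing) auto
  then show "0 \<le> 1 - q powi (- int n) * q ^ i" using q by (simp add: power_int_minus field_simps)
  show "1 - q powi (- int n) * q ^ i \<le> 1" using q by simp
qed

text \<open>By induction, with \<open>w = q powi (r - n)\<close>: the new factor costs at most \<open>w\<close>, and \<open>w / (q - 1) + w = q w / (q - 1)\<close>.\<close>

lemma qpoch_neg_lower:
  assumes q: "1 < q" and r: "r \<le> n"
  shows "1 - q powi (int r - int n) / (q - 1) \<le> qpoch (q powi (- int n)) q r"
  using r
proof (induction r)
  case 0
  then show ?case using q by (simp add: qpoch_def)
next
  case (Suc r)
  define w where "w = q powi (int r - int n)"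
  have w0: "0 < w" using q by (simp add: w_def)
  define A where "A = qpoch (q powi (- int n)) q r"
  have A0: "0 < A" using qpoch_neg_pos[OF q, of r n] Suc.prems by (simp add: A_def)
  have A1: "A \<le> 1"
    unfolding A_def using q Suc.prems by (intro qpoch_neg_le_1) auto
  have IH: "1 - w / (q - 1) \<le> A" using Suc by (simp add: w_def A_def)
  have "q powi (int (Suc r) - int n) = q * w"
    using q by (simp add: w_def power_int_add[symmetric] flip: power_int_add_1') (simp add: algebra_simps)
  moreover have "q * w / (q - 1) = w / (q - 1) + w" using q by (simp add: field_simps)
  moreover have "A * w \<le> w" using A1 w0 by (simp add: mult_left_le_one_le A0 less_imp_le)
  ultimately show ?case
    using q IH by (simp add: qpoch_neg_Suc w_def[symmetric] A_def[symmetric] algebra_simps)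
qed

lemma rank_prob_full: "1 < q \<Longrightarrow> rank_prob q n m m = qpoch (q powi (- int n)) q m"
  using qpoch_neg_pos[of q m m] by (simp add: rank_prob_def)

text \<open>The quotient of the two products that are special to corank one telescopes to a single factor.\<close>

lemma rank_prob_corank_1:
  assumes q: "1 < q" and m: "m < n"
  shows "rank_prob q n (Suc m) m
    = q powi (int (Suc m) - int n) / (q - 1) * (1 - q powi (- int (Suc m))) * qpoch (q powi (- int n)) q m"
proof -
  have q0: "q \<noteq> 0" using q by auto
  have D: "qpoch (q powi (- int m)) q m \<noteq> 0" using qpoch_neg_pos[OF q, of m m] by simp
  have "qpoch (q powi (- int (Suc m))) q m * (1 - q powi (-1))
      = (1 - q powi (- int (Suc m))) * qpoch (q powi (- int m)) q m"
    using qpoch_neg_Suc_shift[OF q0, of m m] qpoch_neg_Suc[OF q0, of "Suc m" m] by simp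
  then have "qpoch (q powi (- int (Suc m))) q m / qpoch (q powi (- int m)) q m
      = (1 - q powi (- int (Suc m))) * q / (q - 1)"
    using D q by (simp add: power_int_minus field_simps)
  moreover have "rank_prob q n (Suc m) m = q powi (int m - int n) *
      (qpoch (q powi (- int (Suc m))) q m / qpoch (q powi (- int m)) q m) * qpoch (q powi (- int n)) q m"
    by (simp add: rank_prob_def)
  moreover have "q powi (int (Suc m) - int n) = q powi (int m - int n) * q"
    using power_int_add_1[of q "int m - int n"] q0 by (simp add: algebra_simps)
  ultimately show ?thesis by simp
qed

section \<open>The two-step kernel\<close>

text \<open>The value for \<open>d > n\<close> is arbitrary apart from two properties: the kernel can stay
in \<open>d\<close> and can leave it. With them the two-step chain satisfies the assumptions of \<open>jump_coupling\<close> at all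
natural numbers.\<close>

definition one_step :: "nat \<Rightarrow> nat \<Rightarrow> nat \<Rightarrow> nat pmf" where
  "one_step q n d = (if d \<le> n then embed_pmf (P_mat q n d) else pmf_of_set {0, d})"

definition two_steps :: "nat \<Rightarrow> nat \<Rightarrow> nat \<Rightarrow> nat pmf" where
  "two_steps q n d = bind_pmf (one_step q n d) (one_step q n)"

lemma P_mat_pos: "2 \<le> q \<Longrightarrow> d + r \<le> n \<Longrightarrow> 0 < P_mat q n d r"
  by (subst P_mat_eq_rank_prob) (auto intro!: rank_prob_pos)

lemma P_mat_eq_0: "\<not> d + r \<le> n \<Longrightarrow> P_mat q n d r = 0"
  by (simp add: P_mat_def)

lemma sum_P_mat:
  assumes "2 \<le> q" "d \<le> n" shows "(\<Sum>r\<le>n - d. P_mat q n d r) = 1"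
  using assms sum_rank_prob[of "real q" n "n - d"] by (simp add: P_mat_eq_rank_prob)

lemma pmf_one_step:
  assumes "2 \<le> q" "d \<le> n" shows "pmf (one_step q n d) r = P_mat q n d r"
proof -
  have nonneg: "0 \<le> P_mat q n d r" for r
    using P_mat_pos[OF assms(1), of d r n] P_mat_eq_0[of d r n q] by (cases "d + r \<le> n") auto
  have "(\<integral>\<^sup>+r. ennreal (P_mat q n d r) \<partial>count_space UNIV) = (\<Sum>r\<le>n - d. ennreal (P_mat q n d r))"
    using assms(2) by (intro nn_integral_count_space') (auto simp: P_mat_eq_0)
  also have "\<dots> = 1" using nonneg sum_P_mat[OF assms] by (simp add: sum_ennreal)
  finally show ?thesis
    using nonneg assms(2) by (simp add: one_step_def pmf_embed_pmf)
qed

lemma set_one_step: "2 \<le> q \<Longrightarrow> d \<le> n \<Longrightarrow> set_pmf (one_step q n d) = {..n - d}"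
proof (intro set_eqI)
  fix r assume "2 \<le> q" "d \<le> n"
  then show "r \<in> set_pmf (one_step q n d) \<longleftrightarrow> r \<in> {..n - d}"
    using P_mat_pos[of q d r n] P_mat_eq_0[of d r n q]
    by (cases "d + r \<le> n") (auto simp: set_pmf_iff pmf_one_step)
qed

lemma set_one_step_outside: "\<not> d \<le> n \<Longrightarrow> set_pmf (one_step q n d) = {0, d}"
  by (simp add: one_step_def)

text \<open>The one-step kernel can move from every state to \<open>0\<close>, and from \<open>0\<close> to all of \<open>{..n}\<close>.\<close>

lemma set_two_steps: "2 \<le> q \<Longrightarrow> {..n} \<union> {d} \<subseteq> set_pmf (two_steps q n d)"
  by (cases "d \<le> n")
     (auto simp: two_steps_def set_one_step set_one_step_outside intro!: bexI[of _ 0])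

lemma two_steps_le: "2 \<le> q \<Longrightarrow> d \<le> n \<Longrightarrow> d' \<in> set_pmf (two_steps q n d) \<Longrightarrow> d' \<le> n"
  by (auto simp: two_steps_def set_one_step)

lemma pmf_two_steps_ge: "pmf (one_step q n d) z * pmf (one_step q n z) d' \<le> pmf (two_steps q n d) d'"
  unfolding two_steps_def pmf_two_steps_bridge[symmetric]
  by (rule mult_left_le[OF pmf_le_1]) simp

lemma powi_div_le:
  fixes q :: real assumes "2 \<le> q" shows "q powi i / (q - 1) \<le> q powi i"
proof -
  have "q powi i * 1 \<le> q powi i * (q - 1)" using assms by (intro mult_left_mono) auto
  then show ?thesis using assms by (simp add: pos_divide_le_eq)
qed

lemma P_mat_full_ge:
  assumes "2 \<le> q" "d \<le> n"
  shows "1 - real q powi (- int d) / (real q - 1) \<le> P_mat q n d (n - d)"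
  using assms qpoch_neg_lower[of "real q" "n - d" n]
  by (simp add: P_mat_eq_rank_prob rank_prob_full of_nat_diff)

lemma P_mat_corank_1_ge:
  assumes q: "2 \<le> q" and d: "d < n"
  shows "real q powi (- int d) / (real q - 1) * ((1 - real q powi (- int (n - d))) * (1 - real q powi (- int d)))
    \<le> P_mat q n d (n - d - 1)"
proof -
  obtain m where m: "n - d = Suc m" using d by (cases "n - d") auto
  have "int (Suc m) - int n = - int d" "m < n" using m d by auto
  then have eq: "P_mat q n d (n - d - 1) = real q powi (- int d) / (real q - 1) *
      ((1 - real q powi (- int (Suc m))) * qpoch (real q powi (- int n)) (real q) m)"
    using q d m by (simp add: P_mat_eq_rank_prob rank_prob_corank_1)
  have "real q powi (int m - int n) / (real q - 1) \<le> real q powi (int m - int n)"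
    using q by (intro powi_div_le) simp
  also have "\<dots> \<le> real q powi (- int d)" using q m d by (intro power_int_increasing) auto
  finally have "1 - real q powi (- int d) \<le> qpoch (real q powi (- int n)) (real q) m"
    using qpoch_neg_lower[of "real q" m n] q \<open>m < n\<close> by simp
  moreover have "real q powi (- int (Suc m)) \<le> real q powi 0" using q by (intro power_int_increasing) auto
  ultimately show ?thesis
    unfolding eq unfolding m using q by (intro mult_left_mono) auto
qed

lemma mult_compl_ge:
  fixes a b :: real assumes "0 \<le> a" "0 \<le> b" shows "1 - a - b \<le> (1 - a) * (1 - b)"
  using mult_nonneg_nonneg[OF assms] by (simp add: algebra_simps)

text \<open>Two full-rank steps lead back to \<open>d\<close>.\<close>

lemma two_steps_stay:
  assumes q: "2 \<le> q" and d: "d \<le> n"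
  shows "1 - pmf (two_steps q n d) d \<le> (real q powi (- int d) + real q powi (- int (n - d))) / (real q - 1)"
proof -
  define u v where "u = real q powi (- int d) / (real q - 1)" and "v = real q powi (- int (n - d)) / (real q - 1)"
  have "0 \<le> u" using q by (simp add: u_def)
  have v: "0 \<le> v" "v \<le> 1"
    using q powi_div_le[of "real q" "- int (n - d)"] power_int_increasing[of "- int (n - d)" 0 "real q"]
    by (auto simp: v_def)
  have "1 - u - v \<le> (1 - u) * (1 - v)" using \<open>0 \<le> u\<close> v by (intro mult_compl_ge)
  also have "\<dots> \<le> P_mat q n d (n - d) * P_mat q n (n - d) d"
    using P_mat_full_ge[OF q d] P_mat_full_ge[OF q, of "n - d" n] d v P_mat_pos[OF q, of d "n - d" n]
    by (intro mult_mono) (auto simp: u_def v_def)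
  also have "\<dots> \<le> pmf (two_steps q n d) d"
    using pmf_two_steps_ge[of q n d "n - d" d] q d by (simp add: pmf_one_step)
  finally show ?thesis by (simp add: u_def v_def add_divide_distrib)
qed

text \<open>The path through \<open>n - d - 1\<close>: a corank-one step followed by a full-rank step. The constant \<open>q + 2\<close> collects
the relative losses \<open>\<delta> + \<delta>\<close> of the first step and \<open>q \<delta>\<close> of the second one.\<close>

lemma two_steps_up:
  assumes q: "2 \<le> q" and d: "d < n"
    and \<delta>: "real q powi (- int d) \<le> \<delta>" "real q powi (- int (n - d)) \<le> \<delta>"
  shows "real q powi (- int d) / (real q - 1) * (1 - (real q + 2) * \<delta>) \<le> pmf (two_steps q n d) (d + 1)"
proof (cases "(real q + 2) * \<delta> < 1")
  case False
  then have "real q powi (- int d) / (real q - 1) * (1 - (real q + 2) * \<delta>) \<le> 0"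
    using q by (intro mult_nonneg_nonpos) auto
  then show ?thesis by (rule order_trans) simp
next
  case True
  define u where "u = real q powi (- int d) / (real q - 1)"
  have u: "0 \<le> u" using q by (simp add: u_def)
  have \<delta>0: "0 \<le> \<delta>" using \<delta>(1) q by (meson order_trans zero_le_power_int of_nat_0_le_iff)
  have "0 \<le> real q * \<delta>" "real q * \<delta> + 2 * \<delta> < 1"
    using True \<delta>0 by (simp_all add: algebra_simps)
  then have q\<delta>: "real q * \<delta> \<le> 1" "\<delta> \<le> 1" using \<delta>0 by linarith+
  have "1 - (real q + 2) * \<delta> \<le> (1 - \<delta> - \<delta>) * (1 - real q * \<delta>)"
    using mult_compl_ge[of "2 * \<delta>" "real q * \<delta>"] \<delta>0 by (simp add: algebra_simps)
  also have "\<dots> \<le> ((1 - \<delta>) * (1 - \<delta>)) * (1 - real q * \<delta>)"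
    using q\<delta> \<delta>0 by (intro mult_right_mono mult_compl_ge) auto
  also have "\<dots> \<le> ((1 - real q powi (- int (n - d))) * (1 - real q powi (- int d))) * (1 - real q * \<delta>)"
    using \<delta> q\<delta> by (intro mult_right_mono mult_mono) auto
  finally have "u * (1 - (real q + 2) * \<delta>) \<le> (u * ((1 - real q powi (- int (n - d))) * (1 - real q powi (- int d)))) * (1 - real q * \<delta>)"
    unfolding mult.assoc using u by (rule mult_left_mono)
  also have "\<dots> \<le> P_mat q n d (n - d - 1) * P_mat q n (n - d - 1) (d + 1)"
  proof (intro mult_mono)
    show "u * ((1 - real q powi (- int (n - d))) * (1 - real q powi (- int d))) \<le> P_mat q n d (n - d - 1)"
      unfolding u_def using q d by (rule P_mat_corank_1_ge)
    have "real q powi (- int (n - d - 1)) / (real q - 1) \<le> real q powi (- int (n - d - 1))"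
      using q by (intro powi_div_le) simp
    also have "\<dots> = real q powi (- int (n - d)) * real q"
      using q d power_int_add_1[of "real q" "- int (n - d)"] by (simp add: of_nat_diff algebra_simps)
    also have "\<dots> \<le> real q * \<delta>" using \<delta>(2) q by (simp add: mult.commute mult_left_mono)
    finally show "1 - real q * \<delta> \<le> P_mat q n (n - d - 1) (d + 1)"
      using P_mat_full_ge[OF q, of "n - d - 1" n] d by (simp add: algebra_simps)
    show "0 \<le> P_mat q n d (n - d - 1)" using P_mat_pos[OF q, of d "n - d - 1" n] d by simp
    show "0 \<le> 1 - real q * \<delta>" using q\<delta> by simp
  qed
  also have "\<dots> \<le> pmf (two_steps q n d) (d + 1)"
    using pmf_two_steps_ge[of q n d "n - d - 1" "d + 1"] q d by (simp add: pmf_one_step)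
  finally show ?thesis by (simp add: u_def)
qed

text \<open>The path through \<open>n - d\<close>: a full-rank step followed by a corank-one step. The losses add up
to \<open>3 \<delta>\<close>, and the constant \<open>q + 2\<close> is the one of the upward move.\<close>

lemma two_steps_down:
  assumes q: "2 \<le> q" and d: "0 < d" "d \<le> n"
    and \<delta>: "real q powi (- int d) \<le> \<delta>" "real q powi (- int (n - d)) \<le> \<delta>"
  shows "real q powi (- int (n - d)) / (real q - 1) * (1 - (real q + 2) * \<delta>) \<le> pmf (two_steps q n d) (d - 1)"
proof (cases "(real q + 2) * \<delta> < 1")
  case False
  then have "real q powi (- int (n - d)) / (real q - 1) * (1 - (real q + 2) * \<delta>) \<le> 0"
    using q by (intro mult_nonneg_nonpos) auto
  then show ?thesis by (rule order_trans) simp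
next
  case True
  define v where "v = real q powi (- int (n - d)) / (real q - 1)"
  have v: "0 \<le> v" using q by (simp add: v_def)
  have \<delta>0: "0 \<le> \<delta>" using \<delta>(1) q by (meson order_trans zero_le_power_int of_nat_0_le_iff)
  have q\<delta>: "2 * \<delta> \<le> real q * \<delta>" using \<delta>0 q by (intro mult_right_mono) auto
  then have \<delta>1: "\<delta> \<le> 1" using True \<delta>0 by (simp add: algebra_simps)
  have "1 - (real q + 2) * \<delta> \<le> (1 - \<delta> - \<delta>) * (1 - \<delta>)"
  proof -
    have "\<delta> \<le> \<delta> * real q" "0 \<le> \<delta> * (\<delta> * 2)" using \<delta>0 q\<delta> by (simp_all add: mult.commute)
    then have "\<delta> \<le> \<delta> * real q + \<delta> * (\<delta> * 2)" by (intro add_increasing2)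
    then show ?thesis by (simp add: algebra_simps)
  qed
  also have "\<dots> \<le> ((1 - \<delta>) * (1 - \<delta>)) * (1 - \<delta>)"
    using \<delta>1 \<delta>0 by (intro mult_right_mono mult_compl_ge) auto
  also have "\<dots> \<le> ((1 - real q powi (- int d)) * (1 - real q powi (- int (n - d)))) * (1 - \<delta>)"
    using \<delta> \<delta>1 by (intro mult_right_mono mult_mono) auto
  finally have "v * (1 - (real q + 2) * \<delta>) \<le> (v * ((1 - real q powi (- int d)) * (1 - real q powi (- int (n - d))))) * (1 - \<delta>)"
    unfolding mult.assoc using v by (rule mult_left_mono)
  also have "\<dots> \<le> P_mat q n (n - d) (d - 1) * P_mat q n d (n - d)"
  proof (intro mult_mono)
    show "v * ((1 - real q powi (- int d)) * (1 - real q powi (- int (n - d)))) \<le> P_mat q n (n - d) (d - 1)"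
      using P_mat_corank_1_ge[OF q, of "n - d" n] d by (simp add: v_def)
    show "1 - \<delta> \<le> P_mat q n d (n - d)"
      using P_mat_full_ge[OF q d(2)] powi_div_le[of "real q" "- int d"] q \<delta>(1) by simp
    show "0 \<le> P_mat q n (n - d) (d - 1)" using P_mat_pos[OF q, of "n - d" "d - 1" n] d by simp
    show "0 \<le> 1 - \<delta>" using \<delta>1 by simp
  qed
  also have "\<dots> \<le> pmf (two_steps q n d) (d - 1)"
    using pmf_two_steps_ge[of q n d "n - d" "d - 1"] q d by (simp add: pmf_one_step mult.commute)
  finally show ?thesis by (simp add: v_def)
qed

text \<open>The number \<open>N\<close> stands for a geometric holding time obtained by rounding up \<open>e / c'\<close> with
\<open>c' = - ln (1 - p)\<close>, and \<open>e / s\<close> for the exponential one. They differ through the rounding, through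
\<open>p \<le> c' \<le> p / (1 - p)\<close>, and through \<open>p\<close> being \<open>s\<close> up to a relative error \<open>\<eta>\<close>. The last two sources give
multiples of \<open>e \<eta> / s\<close> and \<open>e p / s\<close>, where \<open>\<eta> / s\<close> and \<open>p / s\<close> are bounded. So the error is \<open>O(1 + e)\<close> however
large \<open>e / s\<close> is.\<close>

lemma geometric_holding_error:
  fixes e s p \<eta> c N :: real
  assumes e: "0 \<le> e" and p: "0 < p" "p < 1" and ps: "p \<le> s" and sp: "s * (1 - \<eta>) \<le> p"
    and \<eta>: "0 \<le> \<eta>" "\<eta> \<le> 1 / 2" "\<eta> \<le> c * s" and c: "1 / 2 \<le> c"
    and N: "e / (- ln (1 - p)) \<le> N" "N \<le> e / (- ln (1 - p)) + 1"
  shows "\<bar>N - e / s\<bar> \<le> 1 + 2 * c * e"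
proof -
  define l where "l = - ln (1 - p)"
  have s: "0 < s" using p ps by simp
  have l1: "p \<le> l" using ln_le_minus_one[of "1 - p"] p by (simp add: l_def)
  have l2: "l \<le> p / (1 - p)"
  proof -
    have "l = ln (1 / (1 - p))" using p by (simp add: l_def ln_div)
    also have "\<dots> \<le> 1 / (1 - p) - 1" using p by (intro ln_le_minus_one) simp
    also have "\<dots> = p / (1 - p)" using p by (simp add: field_simps)
    finally show ?thesis .
  qed
  have l0: "0 < l" using l1 p by simp
  have "e / l \<le> e / p" using e l1 p by (intro divide_left_mono) auto
  also have "\<dots> \<le> e / (s * (1 - \<eta>))" using e sp p s \<eta> by (intro divide_left_mono) auto
  also have "\<dots> = (e / s) * (1 / (1 - \<eta>))" by simp
  also have "\<dots> \<le> (e / s) * (1 + 2 * \<eta>)"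
  proof (intro mult_left_mono)
    have "1 \<le> (1 + 2 * \<eta>) * (1 - \<eta>)" using \<eta> mult_left_mono[OF \<eta>(2) \<eta>(1)] by (simp add: algebra_simps)
    then show "1 / (1 - \<eta>) \<le> 1 + 2 * \<eta>" using \<eta> by (simp add: divide_le_eq)
    show "0 \<le> e / s" using e s by simp
  qed
  also have "\<dots> = e / s + 2 * (e / s) * \<eta>" by (simp add: algebra_simps)
  also have "2 * (e / s) * \<eta> \<le> 2 * (e / s) * (c * s)" using \<eta> e s by (intro mult_left_mono) auto
  also have "2 * (e / s) * (c * s) = 2 * c * e" using s by simp
  finally have upper: "e / l \<le> e / s + 2 * c * e" by simp
  have "e / s - e \<le> e / s - e * (p / s)"
    using mult_left_mono[of "p / s" 1 e] ps s e by simp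
  also have "\<dots> = e * (1 - p) / s" using s by (simp add: field_simps)
  also have "\<dots> \<le> e * (1 - p) / p" using e p ps by (intro divide_left_mono) auto
  also have "\<dots> = e / (p / (1 - p))" using p by simp
  also have "\<dots> \<le> e / l" using e l2 l0 p by (intro divide_left_mono) auto
  finally have lower: "e / s - e \<le> e / l" .
  have "e \<le> 2 * c * e" using mult_right_mono[of 1 "2 * c" e] c e by simp
  then show ?thesis using upper lower N unfolding l_def[symmetric] by linarith
qed

section \<open>The jump chain of the limit process\<close>

definition rate_Z :: "nat \<Rightarrow> int \<Rightarrow> real" where
  "rate_Z q x = real q powi x + real q powi (- x)"

definition jump_Z :: "nat \<Rightarrow> int \<Rightarrow> int pmf" where
  "jump_Z q x = map_pmf (\<lambda>b. if b then x + 1 else x - 1) (bernoulli_pmf (real q powi (- x) / rate_Z q x))"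

lemma rate_Z_pos: "2 \<le> q \<Longrightarrow> 0 < rate_Z q x"
  by (simp add: rate_Z_def add_pos_pos)

lemma Q_Z_diag: "Q_Z q x x = - rate_Z q x"
  by (simp add: Q_Z_def rate_Z_def)

lemma up_prob_bounds:
  assumes "2 \<le> q" shows "0 \<le> real q powi (- x) / rate_Z q x" "real q powi (- x) / rate_Z q x \<le> 1"
  using rate_Z_pos[OF assms, of x] assms by (auto simp: divide_le_eq) (auto simp: rate_Z_def)

lemma pmf_jump_Z:
  assumes q: "2 \<le> q"
  shows "pmf (jump_Z q x) x' =
    (if x' = x + 1 then real q powi (- x) / rate_Z q x
     else if x' = x - 1 then real q powi x / rate_Z q x else 0)"
proof -
  have "(\<lambda>b. if b then x + 1 else x - 1) -` {x'} = (if x' = x + 1 then {True} else if x' = x - 1 then {False} else {})"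
    by (auto split: if_splits)
  moreover have "1 - real q powi (- x) / rate_Z q x = real q powi x / rate_Z q x"
    using rate_Z_pos[OF q, of x] by (simp add: field_simps) (simp add: rate_Z_def)
  ultimately show ?thesis
    using up_prob_bounds[OF q, of x] by (simp add: jump_Z_def pmf_map measure_pmf_single)
qed

lemma set_jump_Z: "set_pmf (jump_Z q x) \<subseteq> {x + 1, x - 1}"
  by (auto simp: jump_Z_def)

lemma jump_matrix_Q_Z: "2 \<le> q \<Longrightarrow> jump_matrix (Q_Z q) x x' = pmf (jump_Z q x) x'"
  by (auto simp: jump_matrix_def pmf_jump_Z Q_Z_diag) (auto simp: Q_Z_def)

lemma up_prob_le:
  assumes q: "2 \<le> q"
  shows "real q powi (- x) / rate_Z q x \<le> real q powi (- 2 * x)"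
proof -
  have "real q powi (- x) / rate_Z q x \<le> real q powi (- x) / real q powi x"
    using q by (intro divide_left_mono) (auto simp: rate_Z_def add_pos_pos)
  also have "\<dots> = real q powi (- 2 * x)" using q by (simp add: power_int_diff[symmetric])
  finally show ?thesis .
qed

text \<open>At distance at least one from the origin the jump chain moves outwards with probability at most \<open>1/5\<close>, so the
expectation of \<open>b^\<bar>x\<bar>\<close> shrinks at least by the factor \<open>b/5 + 4/(5b)\<close>. At the origin it grows by \<open>b\<close>,
which the discount \<open>2/3\<close> has to compensate. For \<open>b = 5/4\<close> both factors are below \<open>9/10\<close>.\<close>

definition lyapunov :: "int \<Rightarrow> real" where
  "lyapunov x = (5 / 4) ^ nat \<bar>x\<bar>"

lemma lyapunov_ge_1: "1 \<le> lyapunov x"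
  by (simp add: lyapunov_def)

lemma lyapunov_drift:
  assumes q: "2 \<le> q"
  shows "ennreal (rate_Z q x / (rate_Z q x + 1)) * (\<integral>\<^sup>+x'. ennreal (lyapunov x') \<partial>measure_pmf (jump_Z q x))
    \<le> ennreal (9 / 10 * lyapunov x)"
proof -
  define u where "u = real q powi (- x) / rate_Z q x"
  define r where "r = rate_Z q x / (rate_Z q x + 1)"
  have rp: "0 < rate_Z q x" using q by (rule rate_Z_pos)
  have u: "0 \<le> u" "u \<le> 1" using up_prob_bounds[OF q, of x] by (auto simp: u_def)
  have r: "0 \<le> r" "r \<le> 1" using rp by (auto simp: r_def)
  have L0: "0 \<le> lyapunov x" for x using lyapunov_ge_1[of x] by simp
  have *: "(\<integral>\<^sup>+x'. ennreal (lyapunov x') \<partial>measure_pmf (jump_Z q x)) = ennreal (u * lyapunov (x + 1) + (1 - u) * lyapunov (x - 1))"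
    unfolding jump_Z_def u_def[symmetric] using u L0
    by (simp add: nn_integral_map_pmf ennreal_mult[symmetric] ennreal_plus[symmetric] mult.commute del: ennreal_plus)
  have "r * (u * lyapunov (x + 1) + (1 - u) * lyapunov (x - 1)) \<le> 9 / 10 * lyapunov x"
  proof (cases "x = 0")
    case True
    have "u * (5 / 4) + (1 - u) * (5 / 4) = 5 / 4"
      by (rule trans[OF distrib_right[symmetric]]) simp
    then have eq: "u * lyapunov (x + 1) + (1 - u) * lyapunov (x - 1) = 5 / 4"
      using True by (simp add: lyapunov_def)
    show ?thesis unfolding eq using True by (simp add: r_def rate_Z_def lyapunov_def)
  next
    case False
    have away: "p * (5 / 4) + (1 - p) * (4 / 5) \<le> 9 / 10" if "p \<le> 1 / 5" for p :: real
      using that by (simp add: field_simps)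
    have "real q powi (- 2 * \<bar>x\<bar>) \<le> real q powi (- 2)" using q False by (intro power_int_increasing) auto
    also have "\<dots> = 1 / (real q)\<^sup>2" by (simp add: power_int_minus divide_inverse)
    also have "\<dots> \<le> 1 / 2 ^ 2" using q by (intro divide_left_mono power_mono) auto
    finally have q2: "real q powi (- 2 * \<bar>x\<bar>) \<le> 1 / 4" by simp
    have out: "real q powi (- \<bar>x\<bar>) / rate_Z q x \<le> 1 / 5"
    proof -
      have rate: "rate_Z q x = real q powi (- \<bar>x\<bar>) + real q powi \<bar>x\<bar>" by (simp add: rate_Z_def abs_if)
      have "real q powi (- 2 * \<bar>x\<bar>) * real q powi \<bar>x\<bar> = real q powi (- \<bar>x\<bar>)"
        using q by (simp add: power_int_add[symmetric])
      moreover have "real q powi (- 2 * \<bar>x\<bar>) * real q powi \<bar>x\<bar> \<le> 1 / 4 * real q powi \<bar>x\<bar>"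
        using q2 by (intro mult_right_mono) auto
      ultimately show ?thesis using rp unfolding rate by (simp add: divide_le_eq)
    qed
    have le: "u * lyapunov (x + 1) + (1 - u) * lyapunov (x - 1) \<le> 9 / 10 * lyapunov x"
    proof (cases "0 < x")
      case True
      then have "u \<le> 1 / 5" using out by (simp add: u_def)
      have "nat \<bar>x + 1\<bar> = Suc (nat \<bar>x\<bar>)" "nat \<bar>x\<bar> = Suc (nat \<bar>x - 1\<bar>)" using True by auto
      then have "lyapunov (x + 1) = 5 / 4 * lyapunov x" "lyapunov (x - 1) = 4 / 5 * lyapunov x"
        by (simp_all add: lyapunov_def)
      then have "u * lyapunov (x + 1) + (1 - u) * lyapunov (x - 1) = (u * (5 / 4) + (1 - u) * (4 / 5)) * lyapunov x"
        by (simp only: distrib_right mult.assoc)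
      then show ?thesis using mult_right_mono[OF away[OF \<open>u \<le> 1 / 5\<close>] L0[of x]] by simp
    next
      case neg: False
      have "1 - u = real q powi x / rate_Z q x"
        using rp by (simp add: u_def field_simps) (simp add: rate_Z_def)
      then have "1 - u \<le> 1 / 5" using out neg by simp
      have "nat \<bar>x - 1\<bar> = Suc (nat \<bar>x\<bar>)" "nat \<bar>x\<bar> = Suc (nat \<bar>x + 1\<bar>)" using False neg by auto
      then have "lyapunov (x - 1) = 5 / 4 * lyapunov x" "lyapunov (x + 1) = 4 / 5 * lyapunov x"
        by (simp_all add: lyapunov_def)
      then have "u * lyapunov (x + 1) + (1 - u) * lyapunov (x - 1) = (u * (4 / 5) + (1 - u) * (5 / 4)) * lyapunov x"
        by (simp only: distrib_right mult.assoc)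
      also have "u * (4 / 5) + (1 - u) * (5 / 4) = (1 - u) * (5 / 4) + (1 - (1 - u)) * (4 / 5)"
        by simp
      finally have "u * lyapunov (x + 1) + (1 - u) * lyapunov (x - 1) = ((1 - u) * (5 / 4) + (1 - (1 - u)) * (4 / 5)) * lyapunov x" .
      then show ?thesis using mult_right_mono[OF away[OF \<open>1 - u \<le> 1 / 5\<close>] L0[of x]] by simp
    qed
    have "r * (u * lyapunov (x + 1) + (1 - u) * lyapunov (x - 1)) \<le> 1 * (u * lyapunov (x + 1) + (1 - u) * lyapunov (x - 1))"
      using r u L0 by (intro mult_right_mono add_nonneg_nonneg mult_nonneg_nonneg) auto
    with le show ?thesis by simp
  qed
  then show ?thesis
    unfolding * r_def[symmetric] using r u L0
    by (subst ennreal_mult[symmetric]) (auto intro!: ennreal_leI add_nonneg_nonneg mult_nonneg_nonneg simp del: ennreal_plus)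
qed

section \<open>Coupling the jump kernels\<close>

definition time_scale :: "nat \<Rightarrow> nat \<Rightarrow> real" where
  "time_scale q h = real q ^ h * (real q - 1)"

lemma time_scale_pos: "2 \<le> q \<Longrightarrow> 0 < time_scale q h"
  by (simp add: time_scale_def)

lemma powi_centered:
  assumes "2 \<le> q" shows "real q powi (x - int h) / (real q - 1) = real q powi x / time_scale q h"
  using assms by (simp add: time_scale_def power_int_diff field_simps)

text \<open>This bound on the probability of leaving has no error term. The jump kernel is the
two-step kernel divided by it, so lower bounds for the moves of the two-step chain carry over to the
jump chain.\<close>

lemma two_steps_leave_le:
  assumes q: "2 \<le> q" and y: "int y = x + int h" "\<bar>x\<bar> \<le> int h"
  shows "1 - pmf (two_steps q (2 * h) y) y \<le> rate_Z q x / time_scale q h"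
proof -
  have eqs: "- int y = - x - int h" "- int (2 * h - y) = x - int h" and "y \<le> 2 * h" using y by auto
  from two_steps_stay[OF q this(3)] show ?thesis
    unfolding eqs add_divide_distrib powi_centered[OF q] by (simp add: rate_Z_def add_divide_distrib)
qed

lemma two_steps_neighbours:
  assumes q: "2 \<le> q" and y: "int y = x + int h" "\<bar>x\<bar> < int h" and l: "\<bar>x\<bar> \<le> l"
  shows "real q powi (- x) / time_scale q h * (1 - (real q + 2) * real q powi (l - int h)) \<le> pmf (two_steps q (2 * h) y) (y + 1)"
    and "real q powi x / time_scale q h * (1 - (real q + 2) * real q powi (l - int h)) \<le> pmf (two_steps q (2 * h) y) (y - 1)"
proof -
  have 1: "- int y = - x - int h" "- int (2 * h - y) = x - int h" "y < 2 * h" "0 < y" using y by auto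
  have 2: "real q powi (- int y) \<le> real q powi (l - int h)" "real q powi (- int (2 * h - y)) \<le> real q powi (l - int h)"
    using q l 1 by (auto intro!: power_int_increasing)
  show "real q powi (- x) / time_scale q h * (1 - (real q + 2) * real q powi (l - int h)) \<le> pmf (two_steps q (2 * h) y) (y + 1)"
    using two_steps_up[OF q 1(3) 2] unfolding 1(1) powi_centered[OF q] .
  show "real q powi x / time_scale q h * (1 - (real q + 2) * real q powi (l - int h)) \<le> pmf (two_steps q (2 * h) y) (y - 1)"
    using two_steps_down[OF q 1(4) less_imp_le[OF 1(3)] 2] unfolding 1(2) powi_centered[OF q] .
qed

lemma two_steps_leave_ge:
  assumes q: "2 \<le> q" and y: "int y = x + int h" "\<bar>x\<bar> < int h" and l: "\<bar>x\<bar> \<le> l"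
  shows "rate_Z q x / time_scale q h * (1 - (real q + 2) * real q powi (l - int h)) \<le> 1 - pmf (two_steps q (2 * h) y) y"
proof -
  let ?R = "two_steps q (2 * h) y"
  have "0 < y" using y by auto
  then have "measure ?R {y + 1, y - 1, y} = pmf ?R (y + 1) + pmf ?R (y - 1) + pmf ?R y"
    by (subst measure_measure_pmf_finite) auto
  moreover have "measure ?R {y + 1, y - 1, y} \<le> 1" by simp
  ultimately show ?thesis
    using two_steps_neighbours[OF assms] by (simp add: rate_Z_def add_divide_distrib distrib_right)
qed

lemma two_steps_support:
  assumes "2 \<le> q" "0 < h"
  shows "y \<in> set_pmf (two_steps q (2 * h) y)" "set_pmf (two_steps q (2 * h) y) \<noteq> {y}"
proof -
  have sub: "{..2 * h} \<union> {y} \<subseteq> set_pmf (two_steps q (2 * h) y)" by (rule set_two_steps) fact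
  then show "y \<in> set_pmf (two_steps q (2 * h) y)" by auto
  define y' :: nat where "y' = (if y = 0 then 1 else 0)"
  have "y' \<noteq> y" "y' \<in> set_pmf (two_steps q (2 * h) y)" using sub assms(2) by (auto simp: y'_def)
  then show "set_pmf (two_steps q (2 * h) y) \<noteq> {y}" by auto
qed

text \<open>Write \<open>p' = (1 - \<eta>) p + \<eta> r\<close>. With probability \<open>1 - \<eta>\<close> both coordinates are the same sample from \<open>p\<close>, otherwise they are
independent samples from \<open>p\<close> and \<open>r\<close>.\<close>

lemma mixture_coupling:
  fixes p p' :: "'a pmf"
  assumes "0 \<le> \<eta>" "\<eta> \<le> 1" and dom: "\<And>a. (1 - \<eta>) * pmf p a \<le> pmf p' a"
  shows "\<exists>c. map_pmf fst c = p \<and> map_pmf snd c = p' \<and> measure c {s. fst s \<noteq> snd s} \<le> \<eta>"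
\<comment> \<open>The remainder \<open>r\<close> is a quotient by \<open>\<eta>\<close>. For \<open>\<eta> = 0\<close> the two distributions coincide.\<close>
proof (cases "\<eta> = 0")
  case True
  then have le: "pmf p a \<le> pmf p' a" for a using dom[of a] by simp
  have "p = p'"
  proof (rule ccontr)
    assume "p \<noteq> p'"
    then obtain a where a: "pmf p a < pmf p' a"
      using le by (meson pmf_eqI antisym_conv1)
    have "measure p (UNIV - {a}) \<le> measure p' (UNIV - {a})"
    proof -
      have "emeasure p (UNIV - {a}) \<le> emeasure p' (UNIV - {a})"
        unfolding nn_integral_pmf[symmetric] by (intro nn_integral_mono) (simp add: le)
      then show ?thesis by (simp add: measure_pmf.emeasure_eq_measure)
    qed
    moreover have "measure p (UNIV - {a}) = 1 - pmf p a" "measure p' (UNIV - {a}) = 1 - pmf p' a"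
      using measure_pmf.prob_compl[of "{a}" p] measure_pmf.prob_compl[of "{a}" p'] by (simp_all add: measure_pmf_single)
    ultimately show False using a by simp
  qed
  then show ?thesis
    using \<open>0 \<le> \<eta>\<close> by (intro exI[of _ "map_pmf (\<lambda>a. (a, a)) p"]) (simp add: pmf.map_comp o_def pmf.map_ident)
next
  case False
  then have \<eta>: "0 < \<eta>" using assms by simp
  define r where "r a = (pmf p' a - (1 - \<eta>) * pmf p a) / \<eta>" for a
  have r0: "0 \<le> r a" for a using dom[of a] \<eta> by (simp add: r_def)
  have r1: "(\<integral>\<^sup>+a. ennreal (r a) \<partial>count_space UNIV) = 1"
  proof -
    have eq: "ennreal (pmf p' a) = ennreal (1 - \<eta>) * ennreal (pmf p a) + ennreal \<eta> * ennreal (r a)" for a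
      using assms r0[of a] \<eta>
      by (simp add: ennreal_mult[symmetric] ennreal_plus[symmetric] del: ennreal_plus) (simp add: r_def)
    have "1 = (\<integral>\<^sup>+a. ennreal (pmf p' a) \<partial>count_space UNIV)"
      by (simp add: nn_integral_pmf)
    also have "\<dots> = ennreal (1 - \<eta>) + ennreal \<eta> * (\<integral>\<^sup>+a. ennreal (r a) \<partial>count_space UNIV)"
      unfolding eq by (simp add: nn_integral_add nn_integral_cmult nn_integral_pmf)
    finally have eq1: "ennreal (1 - \<eta>) + ennreal \<eta> * (\<integral>\<^sup>+a. ennreal (r a) \<partial>count_space UNIV) = 1" by simp
    have "(\<integral>\<^sup>+a. ennreal (r a) \<partial>count_space UNIV) \<noteq> \<top>"
      using eq1 \<eta> by (auto simp: ennreal_mult_top)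
    then obtain I where I: "(\<integral>\<^sup>+a. ennreal (r a) \<partial>count_space UNIV) = ennreal I" "0 \<le> I"
      by (metis ennreal_cases)
    have "ennreal (1 - \<eta> + \<eta> * I) = ennreal 1"
      using eq1 I \<eta> assms by (simp add: ennreal_mult)
    then have "1 - \<eta> + \<eta> * I = 1" using I \<eta> assms
      by (subst (asm) ennreal_inj) auto
    then have "I = 1" using \<eta> by simp
    then show ?thesis using I by simp
  qed
  define rp where "rp = embed_pmf r"
  have rp: "pmf rp a = r a" for a
    unfolding rp_def using r0 r1 by (simp add: pmf_embed_pmf)
  define c where "c = bind_pmf (bernoulli_pmf \<eta>)
     (\<lambda>b. if b then pair_pmf p rp else map_pmf (\<lambda>a. (a, a)) p)"
  have "map_pmf fst c = p"
  proof -
    have "map_pmf fst c = bind_pmf (bernoulli_pmf \<eta>) (\<lambda>b. p)"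
      unfolding c_def map_bind_pmf
      by (intro bind_pmf_cong) (auto simp: map_fst_pair_pmf pmf.map_comp o_def pmf.map_ident)
    then show ?thesis by simp
  qed
  moreover have "map_pmf snd c = p'"
  proof (rule pmf_eqI)
    fix a
    have "map_pmf snd c = bind_pmf (bernoulli_pmf \<eta>) (\<lambda>b. if b then rp else p)"
      unfolding c_def map_bind_pmf
      by (intro bind_pmf_cong) (auto simp: map_snd_pair_pmf pmf.map_comp o_def pmf.map_ident)
    then have "pmf (map_pmf snd c) a = \<eta> * r a + (1 - \<eta>) * pmf p a"
      using assms by (simp add: pmf_bind rp)
    then show "pmf (map_pmf snd c) a = pmf p' a" using \<eta> by (simp add: r_def)
  qed
  moreover have "measure c {s. fst s \<noteq> snd s} \<le> \<eta>"
  proof -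
    have "measure c {s. fst s \<noteq> snd s} = pmf (map_pmf (\<lambda>s. fst s \<noteq> snd s) c) True"
      by (simp add: pmf_map vimage_def)
    also have "map_pmf (\<lambda>s. fst s \<noteq> snd s) c = bind_pmf (bernoulli_pmf \<eta>)
        (\<lambda>b. if b then map_pmf (\<lambda>s. fst s \<noteq> snd s) (pair_pmf p rp) else return_pmf False)"
      unfolding c_def map_bind_pmf
      by (intro bind_pmf_cong) (auto simp: pmf.map_comp o_def)
    also have "pmf \<dots> True = \<eta> * pmf (map_pmf (\<lambda>s. fst s \<noteq> snd s) (pair_pmf p rp)) True"
      using assms by (simp add: pmf_bind)
    also have "\<dots> \<le> \<eta> * 1"
      using \<eta> by (intro mult_left_mono pmf_le_1) auto
    finally show ?thesis by simp
  qed
  ultimately show ?thesis by blast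
qed

text \<open>Only the two neighbours of \<open>x\<close> carry mass under \<open>jump_Z\<close>, so the bounds for the moves up and down suffice; what the
two-step chain does besides is covered by the defect \<open>\<eta>\<close>.\<close>

lemma jump_kernel_domination:
  assumes q: "2 \<le> q" and h: "0 < h" and y: "int y = x + int h" and x: "\<bar>x\<bar> < int h" "\<bar>x\<bar> \<le> l"
    and \<eta>: "\<eta> = (real q + 2) * real q powi (l - int h)" "\<eta> \<le> 1"
  shows "(1 - \<eta>) * pmf (jump_Z q x) b
    \<le> pmf (map_pmf (\<lambda>y'. int y' - int h) (cond_pmf (two_steps q (2 * h) y) (- {y}))) b"
proof -
  let ?R = "two_steps q (2 * h) y"
  define p where "p = 1 - pmf ?R y"
  define c where "c = cond_pmf ?R (- {y})"
  have p: "0 < p" using pmf_nondegenerate[OF two_steps_support[OF q h, of y]] by (simp add: p_def)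
  have ps: "p \<le> rate_Z q x / time_scale q h" using two_steps_leave_le[OF q y] x by (simp add: p_def)
  have r: "0 < rate_Z q x" "0 < time_scale q h" using q by (simp_all add: rate_Z_pos time_scale_pos)
  have ne: "set_pmf ?R \<inter> - {y} \<noteq> {}" using two_steps_support[OF q h, of y] by blast
  have "measure ?R (- {y}) = p"
    using measure_pmf.prob_compl[of "{y}" ?R] by (simp add: p_def measure_pmf_single Compl_eq_Diff_UNIV)
  then have c: "pmf c y' = pmf ?R y' / p" if "y' \<noteq> y" for y' using that ne by (simp add: c_def pmf_cond)
  have map: "pmf (map_pmf (\<lambda>y'. int y' - int h) c) (int y' - int h) = pmf c y'" for y'
    by (rule pmf_map_inj') (simp add: inj_def)
  have key: "(1 - \<eta>) * (A / rate_Z q x) \<le> B / p" if "A / time_scale q h * (1 - \<eta>) \<le> B" "0 \<le> A" for A B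
  proof -
    have "(1 - \<eta>) * (A / rate_Z q x) = (A / time_scale q h * (1 - \<eta>)) / (rate_Z q x / time_scale q h)"
      using r by (simp add: field_simps)
    also have "\<dots> \<le> (A / time_scale q h * (1 - \<eta>)) / p"
      using ps p r \<eta> that by (intro divide_left_mono mult_nonneg_nonneg) auto
    also have "\<dots> \<le> B / p" using that p by (intro divide_right_mono) auto
    finally show ?thesis .
  qed
  note nb = two_steps_neighbours[OF q y x, folded \<eta>(1)]
  have y0: "0 < y" using y x by auto
  have up: "(1 - \<eta>) * (real q powi (- x) / rate_Z q x) \<le> pmf c (y + 1)"
    using key[OF nb(1)] by (simp add: c)
  have down: "(1 - \<eta>) * (real q powi x / rate_Z q x) \<le> pmf c (y - 1)"
    using key[OF nb(2)] y0 by (simp add: c)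
  have "int (y + 1) - int h = x + 1" "int (y - 1) - int h = x - 1" using y y0 by auto
  note map = map[of "y + 1", unfolded this(1)] map[of "y - 1", unfolded this(2)]
  show ?thesis
    unfolding c_def[symmetric] pmf_jump_Z[OF q] using up down by (auto simp: map)
qed

text \<open>If the claimed bound is at least one, or if the states are not matched, any coupling will do. Otherwise
\<open>l < h\<close>, so \<open>y\<close> has both neighbours in \<open>{..2 * h}\<close> and the kernels are close.\<close>

lemma exists_jump_coupling:
  assumes q: "2 \<le> q" and h: "0 < h"
  shows "\<exists>c :: (int \<times> nat) pmf. map_pmf fst c = jump_Z q x \<and>
     map_pmf snd c = cond_pmf (two_steps q (2 * h) y) (- {y}) \<and>
     (int y = x + int h \<and> \<bar>x\<bar> \<le> l \<longrightarrow>
       measure c {s. int (snd s) \<noteq> fst s + int h} \<le> (real q + 2) * real q powi (l - int h))"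
proof (cases "int y = x + int h \<and> \<bar>x\<bar> \<le> l \<and> (real q + 2) * real q powi (l - int h) < 1")
  case False
  have "map_pmf fst (pair_pmf (jump_Z q x) r) = jump_Z q x" "map_pmf snd (pair_pmf (jump_Z q x) r) = r" for r :: "nat pmf"
    by (simp_all add: map_fst_pair_pmf map_snd_pair_pmf)
  moreover have "measure c {s. int (snd s) \<noteq> fst s + int h} \<le> (real q + 2) * real q powi (l - int h)"
    if "int y = x + int h \<and> \<bar>x\<bar> \<le> l" for c :: "(int \<times> nat) pmf"
    using False that by (intro order_trans[OF measure_pmf.prob_le_1]) (simp add: not_less)
  ultimately show ?thesis by blast
next
  case True
  define \<eta> where "\<eta> = (real q + 2) * real q powi (l - int h)"
  have "l < int h"
  proof (rule ccontr)
    assume "\<not> l < int h"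
    then have "real q powi 0 \<le> real q powi (l - int h)" using q by (intro power_int_increasing) auto
    then have "1 * 1 \<le> \<eta>" unfolding \<eta>_def by (intro mult_mono) auto
    then show False using True by (simp add: \<eta>_def)
  qed
  then have x: "\<bar>x\<bar> < int h" "\<bar>x\<bar> \<le> l" and y: "int y = x + int h" using True by auto
  have \<eta>: "0 \<le> \<eta>" "\<eta> \<le> 1" using True by (auto simp: \<eta>_def)
  let ?\<iota> = "\<lambda>y'. int y' - int h" and ?r = "cond_pmf (two_steps q (2 * h) y) (- {y})"
  obtain c where c: "map_pmf fst c = jump_Z q x" "map_pmf snd c = map_pmf ?\<iota> ?r" "measure c {s. fst s \<noteq> snd s} \<le> \<eta>"
    using mixture_coupling[OF \<eta> jump_kernel_domination[OF q h y x \<eta>_def \<eta>(2)]] by blast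
  let ?f = "\<lambda>s. (fst s, nat (snd s + int h))"
  have "map_pmf fst (map_pmf ?f c) = jump_Z q x" using c(1) by (simp add: pmf.map_comp o_def)
  moreover have "map_pmf snd (map_pmf ?f c) = ?r"
  proof -
    have "map_pmf snd (map_pmf ?f c) = map_pmf (\<lambda>z. nat (z + int h)) (map_pmf snd c)"
      by (simp add: pmf.map_comp o_def)
    also have "\<dots> = ?r" unfolding c(2) by (simp add: pmf.map_comp o_def pmf.map_ident)
    finally show ?thesis .
  qed
  moreover have "measure (map_pmf ?f c) {s. int (snd s) \<noteq> fst s + int h} \<le> \<eta>"
  proof -
    have supp: "- int h \<le> snd s" if "s \<in> set_pmf c" for s
    proof -
      have "snd s \<in> set_pmf (map_pmf snd c)" using that by simp
      then show ?thesis unfolding c(2) by auto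
    qed
    have "measure (map_pmf ?f c) {s. int (snd s) \<noteq> fst s + int h} = measure c (?f -` {s. int (snd s) \<noteq> fst s + int h})"
      by simp
    also have "\<dots> = measure c ((?f -` {s. int (snd s) \<noteq> fst s + int h}) \<inter> set_pmf c)"
      by (simp add: measure_Int_set_pmf)
    also have "\<dots> \<le> measure c {s. fst s \<noteq> snd s}"
      by (intro measure_pmf.finite_measure_mono) (auto dest: supp)
    finally show ?thesis using c(3) by simp
  qed
  ultimately show ?thesis unfolding \<eta>_def by blast
qed

section \<open>Closeness of the coupled chains\<close>

locale coupled_chains =
  fixes q h :: nat and l :: int and \<kappa> :: "int \<times> nat \<Rightarrow> (int \<times> nat) pmf"
  assumes q: "2 \<le> q" and h: "0 < h"
    and \<kappa>1: "map_pmf fst (\<kappa> s) = jump_Z q (fst s)"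
    and \<kappa>2: "map_pmf snd (\<kappa> s) = cond_pmf (two_steps q (2 * h) (snd s)) (- {snd s})"
    and \<kappa>3: "int (snd s) = fst s + int h \<Longrightarrow> \<bar>fst s\<bar> \<le> l \<Longrightarrow>
       measure (\<kappa> s) {s'. int (snd s') \<noteq> fst s' + int h} \<le> (real q + 2) * real q powi (l - int h)"

sublocale coupled_chains \<subseteq> jump_coupling \<kappa> "jump_Z q" "rate_Z q" "two_steps q (2 * h)"
  using two_steps_support[OF q h] rate_Z_pos[OF q] \<kappa>1 \<kappa>2 by unfold_locales auto

context coupled_chains begin

text \<open>The states for which the two chains agree and are close enough to the origin for the estimates.\<close>

definition matched :: "(int \<times> nat) set" where
  "matched = {s. int (snd s) = fst s + int h \<and> \<bar>fst s\<bar> \<le> l}"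

definition mismatch_bound :: real where
  "mismatch_bound = (real q + 2) * real q powi (l - int h) + real q powi (- 2 * l)"

lemma mismatch_bound_nonneg: "0 \<le> mismatch_bound"
  by (simp add: mismatch_bound_def)

lemma matched_exit:
  assumes s: "s \<in> matched" shows "emeasure (measure_pmf (\<kappa> s)) (- matched) \<le> ennreal mismatch_bound"
proof -
  have x: "\<bar>fst s\<bar> \<le> l" "int (snd s) = fst s + int h" using s by (auto simp: matched_def)
  have out: "measure (\<kappa> s) {s'. l < \<bar>fst s'\<bar>} \<le> real q powi (- 2 * l)"
  proof -
    have "measure (\<kappa> s) {s'. l < \<bar>fst s'\<bar>} = measure (jump_Z q (fst s)) {x'. l < \<bar>x'\<bar>}"
      unfolding \<kappa>1[symmetric] by (simp add: vimage_def)
    also have "\<dots> = measure (jump_Z q (fst s)) ({x'. l < \<bar>x'\<bar>} \<inter> set_pmf (jump_Z q (fst s)))"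
      by (simp add: measure_Int_set_pmf)
    also have "\<dots> \<le> real q powi (- 2 * l)"
    proof (cases "\<bar>fst s\<bar> = l \<and> l \<noteq> 0")
      case True
      define b where "b = (if fst s = l then l + 1 else - l - 1)"
      have "measure (jump_Z q (fst s)) ({x'. l < \<bar>x'\<bar>} \<inter> set_pmf (jump_Z q (fst s))) \<le> measure (jump_Z q (fst s)) {b}"
        using set_jump_Z[of q "fst s"] True by (intro measure_pmf.finite_measure_mono) (auto simp: b_def)
      also have "\<dots> = real q powi (- l) / rate_Z q l"
        using True by (auto simp: b_def measure_pmf_single pmf_jump_Z[OF q] rate_Z_def add.commute)
      also have "\<dots> \<le> real q powi (- 2 * l)" by (rule up_prob_le[OF q])
      finally show ?thesis .
    next
      case False
      then consider "l = 0" | "\<bar>fst s\<bar> < l" using x by linarith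
      then show ?thesis
      proof cases
        case 2
        then have "{x'. l < \<bar>x'\<bar>} \<inter> set_pmf (jump_Z q (fst s)) = {}" using set_jump_Z[of q "fst s"] by auto
        then show ?thesis by simp
      qed simp
    qed
    finally show ?thesis .
  qed
  have "- matched = {s'. int (snd s') \<noteq> fst s' + int h} \<union> {s'. l < \<bar>fst s'\<bar>}" by (auto simp: matched_def)
  then have "measure (\<kappa> s) (- matched) \<le> measure (\<kappa> s) {s'. int (snd s') \<noteq> fst s' + int h} + measure (\<kappa> s) {s'. l < \<bar>fst s'\<bar>}"
    by (simp add: measure_Un_le)
  also have "\<dots> \<le> mismatch_bound"
    unfolding mismatch_bound_def using \<kappa>3[OF x(2,1)] out by (intro add_mono)
  finally show ?thesis by (simp add: measure_pmf.emeasure_eq_measure ennreal_leI)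
qed

text \<open>A bound for the difference of corresponding holding times when the exponential variable is at most \<open>thr\<close>.\<close>

definition lag :: "real \<Rightarrow> real" where
  "lag thr = (1 + 2 * ((real q + 2) * (real q - 1)) * thr) / time_scale q h"

lemma holding_times_close:
  assumes s: "s \<in> matched" and small: "(real q + 2) * real q powi (l - int h) \<le> 1 / 2" and e: "0 < e" "e \<le> thr"
  shows "\<bar>real (disc_hold (snd s) e) / time_scale q h - e / rate_Z q (fst s)\<bar> \<le> lag thr"
proof -
  define x y where "x = fst s" and "y = snd s"
  have xl: "\<bar>x\<bar> \<le> l" and y: "int y = x + int h" using s by (auto simp: matched_def x_def y_def)
  define \<eta> where "\<eta> = (real q + 2) * real q powi (\<bar>x\<bar> - int h)"
  define c where "c = (real q + 2) * (real q - 1)"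
  define r where "r = rate_Z q x / time_scale q h"
  define p where "p = 1 - pmf (two_steps q (2 * h) y) y"
  have ts: "0 < time_scale q h" using q by (rule time_scale_pos)
  have "\<eta> \<le> (real q + 2) * real q powi (l - int h)"
    unfolding \<eta>_def using xl q by (intro mult_left_mono power_int_increasing) auto
  then have \<eta>2: "\<eta> \<le> 1 / 2" using small by simp
  have xh: "\<bar>x\<bar> < int h"
  proof (rule ccontr)
    assume "\<not> \<bar>x\<bar> < int h"
    then have "real q powi 0 \<le> real q powi (\<bar>x\<bar> - int h)" using q by (intro power_int_increasing) auto
    then have "1 * 1 \<le> \<eta>" unfolding \<eta>_def by (intro mult_mono) auto
    then show False using \<eta>2 by simp
  qed
  have p: "0 < p" "p < 1" using stay_prob[of y] by (auto simp: p_def)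
  have c1: "1 * 1 \<le> c" unfolding c_def using q by (intro mult_mono) auto
  have \<eta>c: "\<eta> \<le> c * r"
  proof -
    have "real q powi \<bar>x\<bar> \<le> rate_Z q x" by (auto simp: rate_Z_def abs_if)
    then have "real q powi \<bar>x\<bar> / time_scale q h \<le> r" unfolding r_def using ts by (intro divide_right_mono) auto
    then have "c * (real q powi \<bar>x\<bar> / time_scale q h) \<le> c * r" using c1 by (intro mult_left_mono) auto
    moreover have "c * (real q powi \<bar>x\<bar> / time_scale q h) = \<eta>"
      unfolding powi_centered[OF q, symmetric] c_def \<eta>_def using q by simp
    ultimately show ?thesis by simp
  qed
  have l0: "0 < - ln (1 - p)" using p by simp
  define N where "N = disc_hold y e"
  have N: "e / (- ln (1 - p)) \<le> real N" "real N \<le> e / (- ln (1 - p)) + 1"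
  proof -
    have pos: "0 < e / (- ln (1 - p))" using e l0 by (intro divide_pos_pos) auto
    have "N = max 1 (nat \<lceil>e / (- ln (1 - p))\<rceil>)" by (simp add: N_def disc_hold_def p_def)
    also have "\<dots> = nat \<lceil>e / (- ln (1 - p))\<rceil>" using pos by (simp add: max_def) linarith
    finally have "real N = of_int \<lceil>e / (- ln (1 - p))\<rceil>" using pos by simp
    then show "e / (- ln (1 - p)) \<le> real N" "real N \<le> e / (- ln (1 - p)) + 1" by linarith+
  qed
  have "\<bar>real N - e / r\<bar> \<le> 1 + 2 * c * e"
  proof (rule geometric_holding_error[of e p r \<eta> c "real N"])
    show "p \<le> r" unfolding p_def r_def using two_steps_leave_le[OF q y] xh by simp
    show "r * (1 - \<eta>) \<le> p" unfolding p_def r_def \<eta>_def using two_steps_leave_ge[OF q y xh, of "\<bar>x\<bar>"] by simp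
    show "0 \<le> \<eta>" by (simp add: \<eta>_def)
  qed (use e p \<eta>2 \<eta>c c1 N in auto)
  also have "\<dots> \<le> 1 + 2 * c * thr" using e c1 by simp
  finally have "\<bar>real N - e / r\<bar> / time_scale q h \<le> lag thr"
    unfolding lag_def c_def using ts by (intro divide_right_mono) auto
  moreover have "\<bar>real N - e / r\<bar> / time_scale q h = \<bar>(real N - e / r) / time_scale q h\<bar>"
    by (simp only: abs_divide abs_of_pos[OF ts])
  moreover have "(real N - e / r) / time_scale q h = real N / time_scale q h - e / rate_Z q x"
    using ts rate_Z_pos[OF q, of x] by (simp add: r_def field_simps)
  ultimately show ?thesis by (simp only: N_def x_def y_def)
qed

lemma matched_path:
  assumes s: "s \<in> matched" and small: "(real q + 2) * real q powi (l - int h) \<le> 1 / 2"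
    and pos: "\<And>i. 0 < fst (\<omega> i)"
    and good: "\<And>i. i < N \<Longrightarrow> state s \<omega> (Suc i) \<in> matched \<and> fst (\<omega> i) \<le> thr"
    and i: "i \<le> N"
  shows "state s \<omega> i \<in> matched" and "\<bar>real (disc_time s \<omega> i) / time_scale q h - cont_time s \<omega> i\<bar> \<le> real i * lag thr"
  using i
proof (induction i)
  case 0
  { case 1 then show ?case using s by simp }
  { case 2 then show ?case by (simp add: disc_time_def cont_time_def) }
next
  case (Suc i)
  { case 1 then show ?case using good[of i] by simp }
  { case 2
    have "\<bar>real (disc_hold (snd (state s \<omega> i)) (fst (\<omega> i))) / time_scale q h - cont_hold s \<omega> i\<bar> \<le> lag thr"
      unfolding cont_hold_def using 2 Suc.IH(1) pos good[of i] small by (intro holding_times_close) auto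
    moreover have "\<bar>real (disc_time s \<omega> i) / time_scale q h - cont_time s \<omega> i\<bar> \<le> real i * lag thr" using 2 Suc.IH(2) by simp
    moreover have "real (disc_time s \<omega> (Suc i)) / time_scale q h - cont_time s \<omega> (Suc i)
      = (real (disc_time s \<omega> i) / time_scale q h - cont_time s \<omega> i) +
        (real (disc_hold (snd (state s \<omega> i)) (fst (\<omega> i))) / time_scale q h - cont_hold s \<omega> i)"
      by (simp add: disc_time_def cont_time_def add_divide_distrib)
    ultimately show ?case unfolding of_nat_Suc distrib_right by linarith }
qed

lemma no_explosion_Z: "AE \<omega> in drivers. filterlim (cont_time s \<omega>) at_top sequentially"
  by (rule no_explosion[of lyapunov "9/10"]) (use lyapunov_ge_1 lyapunov_drift[OF q] in auto)

text \<open>Markov's inequality for \<open>exp (- T_N)\<close>.\<close>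

lemma cont_time_small_bound:
  "emeasure drivers {\<omega>. cont_time s \<omega> N < \<beta>} \<le> ennreal (exp \<beta> * (9 / 10) ^ N * lyapunov (fst s))"
proof -
  have L: "0 \<le> lyapunov (fst s)" using lyapunov_ge_1[of "fst s"] by simp
  have m: "{\<omega>. cont_time s \<omega> N < \<beta>} \<in> sets drivers"
    using measurable_cont_time[of s N] by (intro sets_drivers_Collect) simp
  have "emeasure drivers {\<omega>. cont_time s \<omega> N < \<beta>} = (\<integral>\<^sup>+\<omega>. indicator {\<omega>. cont_time s \<omega> N < \<beta>} \<omega> \<partial>drivers)"
    using m by simp
  also have "\<dots> \<le> (\<integral>\<^sup>+\<omega>. ennreal (exp \<beta>) * ennreal (exp (- cont_time s \<omega> N)) \<partial>drivers)"
  proof (intro nn_integral_mono)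
    fix \<omega>
    have "1 \<le> exp (\<beta> - cont_time s \<omega> N)" if "cont_time s \<omega> N < \<beta>" using that by simp
    then show "indicator {\<omega>. cont_time s \<omega> N < \<beta>} \<omega> \<le> ennreal (exp \<beta>) * ennreal (exp (- cont_time s \<omega> N))"
      by (auto simp: ennreal_mult[symmetric] exp_add[symmetric] split: split_indicator)
  qed
  also have "\<dots> = ennreal (exp \<beta>) * (\<integral>\<^sup>+\<omega>. ennreal (exp (- cont_time s \<omega> N)) \<partial>drivers)"
    by (rule nn_integral_cmult) measurable
  also have "\<dots> \<le> ennreal (exp \<beta>) * ennreal ((9 / 10) ^ N * lyapunov (fst s))"
    by (intro mult_left_mono discounted_time_bound[of lyapunov "9/10"]) (use lyapunov_ge_1 lyapunov_drift[OF q] in auto)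
  also have "\<dots> = ennreal (exp \<beta> * (9 / 10) ^ N * lyapunov (fst s))"
    using L by (simp add: ennreal_mult[symmetric] mult.assoc)
  finally show ?thesis .
qed

text \<open>The event of the theorem, expressed by the drivers: for regular drivers, jump times and jump chains
are the explicit sequences that occur here.\<close>

definition close :: "int \<times> nat \<Rightarrow> nat \<Rightarrow> real \<Rightarrow> real \<Rightarrow> (int \<times> nat) drive \<Rightarrow> bool" where
  "close s N D \<beta> \<omega> \<longleftrightarrow> (\<forall>i\<le>N. int (snd (state s \<omega> i)) - int h = fst (state s \<omega> i) \<and>
      \<bar>real (disc_time s \<omega> i) / time_scale q h - cont_time s \<omega> i\<bar> \<le> D) \<and> \<beta> \<le> cont_time s \<omega> N"

lemma measurable_close: "Measurable.pred drivers (close s N D \<beta>)"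
proof -
  have 1: "Measurable.pred drivers (\<lambda>\<omega>. int (snd (state s \<omega> i)) - int h = fst (state s \<omega> i))" for i
    by (rule measurable_compose[OF measurable_state]) simp
  have 2: "(\<lambda>\<omega>. real (disc_time s \<omega> i)) \<in> borel_measurable drivers" for i
    by (rule measurable_compose[OF measurable_disc_time]) simp
  have 3: "Measurable.pred drivers (\<lambda>\<omega>. \<bar>real (disc_time s \<omega> i) / time_scale q h - cont_time s \<omega> i\<bar> \<le> D)" for i
    using 2[of i] measurable_cont_time[of s i] by measurable
  show ?thesis
    unfolding close_def
    by (intro pred_intros_countable pred_intros_imp' pred_intros_logic 1 3) (use measurable_cont_time[of s N] in simp)
qed

lemma close_prob:
  assumes s: "s \<in> matched" and small: "(real q + 2) * real q powi (l - int h) \<le> 1 / 2"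
    and thr: "0 \<le> thr" and D: "real N * lag thr \<le> D"
  shows "1 - real N * (mismatch_bound + exp (- thr)) - exp \<beta> * (9 / 10) ^ N * lyapunov (fst s)
    \<le> measure drivers {\<omega>. close s N D \<beta> \<omega>}"
proof -
  let ?E = "{\<omega>. \<exists>i<N. state s \<omega> (Suc i) \<notin> matched \<or> thr < fst (\<omega> i)}" and ?T = "{\<omega>. cont_time s \<omega> N < \<beta>}"
    and ?C = "{\<omega>. close s N D \<beta> \<omega>}"
  have mE: "?E \<in> sets drivers" by (rule sets_drivers_Collect[OF measurable_exit_event])
  have mC: "?C \<in> sets drivers" by (rule sets_drivers_Collect[OF measurable_close])
  have mT: "?T \<in> sets drivers"
    using measurable_cont_time[of s N] by (intro sets_drivers_Collect) simp
  have lag0: "0 \<le> lag thr" unfolding lag_def using q thr time_scale_pos[OF q, of h] by simp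
  have "AE \<omega> in drivers. \<omega> \<in> ?C \<union> ?E \<union> ?T"
    using AE_drivers
  proof eventually_elim
    case (elim \<omega>)
    show ?case
    proof (rule ccontr)
      assume n: "\<omega> \<notin> ?C \<union> ?E \<union> ?T"
      then have "\<not> (\<exists>i<N. state s \<omega> (Suc i) \<notin> matched \<or> thr < fst (\<omega> i))" by blast
      then have good: "state s \<omega> (Suc i) \<in> matched \<and> fst (\<omega> i) \<le> thr" if "i < N" for i
        using that by (meson not_less)
      have "state s \<omega> i \<in> matched" "\<bar>real (disc_time s \<omega> i) / time_scale q h - cont_time s \<omega> i\<bar> \<le> D" if "i \<le> N" for i
      proof -
        note P = matched_path[OF s small _ good that]
        show "state s \<omega> i \<in> matched" using P(1) elim by blast
        have "\<bar>real (disc_time s \<omega> i) / time_scale q h - cont_time s \<omega> i\<bar> \<le> real i * lag thr" using P(2) elim by blast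
        also have "\<dots> \<le> real N * lag thr" using that lag0 by (intro mult_right_mono) auto
        finally show "\<bar>real (disc_time s \<omega> i) / time_scale q h - cont_time s \<omega> i\<bar> \<le> D" using D by simp
      qed
      then have "close s N D \<beta> \<omega>" using n by (auto simp: close_def matched_def not_less)
      with n show False by simp
    qed
  qed
  then have "1 = measure drivers (?C \<union> ?E \<union> ?T)"
    using mE mC mT by (subst (asm) drivers.prob_eq_1[symmetric]) auto
  also have "\<dots> \<le> measure drivers ?C + measure drivers ?E + measure drivers ?T"
    using measure_Un_le[OF sets.Un[OF mC mE] mT] measure_Un_le[OF mC mE] by simp
  also have "measure drivers ?E \<le> real N * (mismatch_bound + exp (- thr))"
  proof -
    have "emeasure drivers ?E \<le> ennreal (real N * (mismatch_bound + exp (- thr)))"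
      using matched_exit mismatch_bound_nonneg thr s by (rule exit_bound)
    then show ?thesis
      using mismatch_bound_nonneg unfolding drivers.emeasure_eq_measure by (subst (asm) ennreal_le_iff) auto
  qed
  also have "measure drivers ?T \<le> exp \<beta> * (9 / 10) ^ N * lyapunov (fst s)"
    using cont_time_small_bound[of s N \<beta>] lyapunov_ge_1[of "fst s"]
    unfolding drivers.emeasure_eq_measure by (subst (asm) ennreal_le_iff) auto
  finally show ?thesis by simp
qed

end

section \<open>Copies of probability spaces\<close>

lemma distr_fst_pair:
  assumes "prob_space N" shows "distr (M \<Otimes>\<^sub>M N) M fst = M"
proof (rule measure_eqI)
  interpret N: prob_space N by fact
  fix A assume "A \<in> sets (distr (M \<Otimes>\<^sub>M N) M fst)"
  then have A: "A \<in> sets M" by simp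
  then have "fst -` A \<inter> space (M \<Otimes>\<^sub>M N) = A \<times> space N"
    using sets.sets_into_space by (auto simp: space_pair_measure)
  then show "emeasure (distr (M \<Otimes>\<^sub>M N) M fst) A = emeasure M A"
    using A by (simp add: emeasure_distr N.emeasure_pair_measure_Times N.emeasure_space_1)
qed simp

lemma distr_snd_pair:
  assumes "prob_space M" "prob_space N" shows "distr (M \<Otimes>\<^sub>M N) N snd = N"
proof (rule measure_eqI)
  interpret M: prob_space M by fact
  interpret N: prob_space N by fact
  fix A assume "A \<in> sets (distr (M \<Otimes>\<^sub>M N) N snd)"
  then have A: "A \<in> sets N" by simp
  then have "snd -` A \<inter> space (M \<Otimes>\<^sub>M N) = space M \<times> A"
    using sets.sets_into_space by (auto simp: space_pair_measure)
  then show "emeasure (distr (M \<Otimes>\<^sub>M N) N snd) A = emeasure N A"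
    using A by (simp add: emeasure_distr N.emeasure_pair_measure_Times M.emeasure_space_1)
qed simp

lemma measure_distr_Collect:
  assumes "g \<in> measurable M N" "distr M N g = N" "{x \<in> space N. Q x} \<in> sets N"
  shows "measure M {\<omega> \<in> space M. Q (g \<omega>)} = measure N {x \<in> space N. Q x}"
proof -
  have "measure N {x \<in> space N. Q x} = measure (distr M N g) {x \<in> space N. Q x}" using assms by simp
  also have "\<dots> = measure M (g -` {x \<in> space N. Q x} \<inter> space M)" using assms by (intro measure_distr) auto
  also have "g -` {x \<in> space N. Q x} \<inter> space M = {\<omega> \<in> space M. Q (g \<omega>)}"
    using measurable_space[OF assms(1)] by auto
  finally show ?thesis ..
qed

text \<open>Exceptional null sets are removed from the sample space, and the
remaining points are renamed along an injection. The first makes pathwise properties hold surely, the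
second moves everything to a prescribed type of sample points.\<close>

lemma exists_restricted_copy:
  fixes M0 :: "'b measure" and f :: "'b \<Rightarrow> 'c"
  assumes "prob_space M0" and "inj f" and "\<Omega> \<in> sets M0" and "AE \<omega> in M0. \<omega> \<in> \<Omega>"
  shows "\<exists>(M :: 'c measure) g. prob_space M \<and> g \<in> measurable M M0 \<and> distr M M0 g = M0 \<and>
     (\<forall>\<omega>\<in>space M. g \<omega> \<in> \<Omega>)"
proof -
  interpret prob_space M0 by fact
  define R where "R = restrict_space M0 \<Omega>"
  define M where "M = distr R (vimage_algebra (f ` \<Omega>) (inv f) M0) f"
  have sp: "\<Omega> \<subseteq> space M0" using assms(3) sets.sets_into_space by auto
  have spR: "space R = \<Omega>" using sp by (auto simp: R_def space_restrict_space)
  have idR: "(\<lambda>x. x) \<in> measurable R M0"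
    unfolding R_def by (rule measurable_restrict_space1) simp
  have invf: "inv f (f x) = x" for x using assms(2) by simp
  have fM: "f \<in> measurable R (vimage_algebra (f ` \<Omega>) (inv f) M0)"
    by (rule measurable_vimage_algebra2) (auto simp: spR invf idR)
  have gM: "inv f \<in> measurable M M0"
    unfolding M_def measurable_distr_eq1 using sp invf
    by (intro measurable_vimage_algebra1) auto
  have emR: "emeasure R (space R) = 1"
    unfolding spR unfolding R_def using assms(3,4)
    by (subst emeasure_restrict_space) (auto simp: emeasure_eq_1_AE)
  have "prob_space M"
    unfolding M_def by (intro prob_space.prob_space_distr fM prob_spaceI emR)
  moreover have "distr M M0 (inv f) = M0"
  proof (rule measure_eqI)
    fix A assume "A \<in> sets (distr M M0 (inv f))"
    then have A: "A \<in> sets M0" by simp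
    have "distr M M0 (inv f) = distr R M0 (inv f \<circ> f)"
      unfolding M_def using fM gM by (intro distr_distr) (auto simp: M_def)
    also have "\<dots> = distr R M0 (\<lambda>x. x)" by (intro distr_cong) (auto simp: invf)
    finally have "emeasure (distr M M0 (inv f)) A = emeasure R (A \<inter> \<Omega>)"
      using A idR by (simp add: emeasure_distr spR)
    also have "\<dots> = emeasure M0 (A \<inter> \<Omega>)"
      unfolding R_def using A assms(3) by (subst emeasure_restrict_space) auto
    also have "\<dots> = emeasure M0 A"
      using assms(3,4) A by (intro emeasure_eq_AE) auto
    finally show "emeasure (distr M M0 (inv f)) A = emeasure M0 A" .
  qed simp
  moreover have "\<forall>\<omega>\<in>space M. inv f \<omega> \<in> \<Omega>"
    by (auto simp: M_def invf)
  ultimately show ?thesis using gM by blast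
qed

lemma exists_copy_satisfying:
  fixes M0 :: "'b measure" and f :: "'b \<Rightarrow> 'c"
  assumes "prob_space M0" and "inj f" and "AE \<omega> in M0. Q \<omega>"
  shows "\<exists>(M :: 'c measure) g. prob_space M \<and> g \<in> measurable M M0 \<and> distr M M0 g = M0 \<and>
     (\<forall>\<omega>\<in>space M. Q (g \<omega>))"
proof -
  obtain N where N: "{\<omega> \<in> space M0. \<not> Q \<omega>} \<subseteq> N" "N \<in> null_sets M0"
    using assms(3) by (auto simp: eventually_ae_filter)
  have "AE \<omega> in M0. \<omega> \<in> space M0 - N" using AE_not_in[OF N(2)] by (auto simp: AE_space)
  then obtain M :: "'c measure" and g where M: "prob_space M" "g \<in> measurable M M0" "distr M M0 g = M0" "\<forall>\<omega>\<in>space M. g \<omega> \<in> space M0 - N"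
    using exists_restricted_copy[OF assms(1,2) sets.Diff[OF sets.top null_setsD2[OF N(2)]]] by blast
  then have "\<forall>\<omega>\<in>space M. Q (g \<omega>)" using N(1) by blast
  with M show ?thesis by blast
qed

text \<open>All the randomness consists of countably many real or natural numbers, hence fits into one real sequence.\<close>

definition flatten :: "'s::countable drive \<times> ('k::countable \<Rightarrow> nat) \<Rightarrow> nat \<Rightarrow> real" where
  "flatten z m = (case (from_nat m :: nat + (nat \<times> 's) + 'k) of
      Inl i \<Rightarrow> fst (fst z i)
    | Inr (Inl (i, s)) \<Rightarrow> real (to_nat (snd (fst z i) s))
    | Inr (Inr k) \<Rightarrow> real (snd z k))"

lemma inj_flatten:
  "inj (flatten :: 's::countable drive \<times> ('k::countable \<Rightarrow> nat) \<Rightarrow> nat \<Rightarrow> real)"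
proof (rule injI)
  fix z z' :: "'s drive \<times> ('k \<Rightarrow> nat)"
  assume eq: "flatten z = flatten z'"
  have *: "flatten z (to_nat c) = flatten z' (to_nat c)" for c :: "nat + (nat \<times> 's) + 'k"
    using eq by simp
  have "fst (fst z i) = fst (fst z' i)" for i using *[of "Inl i"] by (simp add: flatten_def)
  moreover have "snd (fst z i) s = snd (fst z' i) s" for i s
    using *[of "Inr (Inl (i, s))"] by (simp add: flatten_def)
  moreover have "snd z k = snd z' k" for k using *[of "Inr (Inr k)"] by (simp add: flatten_def)
  ultimately show "z = z'" by (intro prod_eqI ext) auto
qed

section \<open>Realisation of the coupling\<close>

context coupled_chains begin

definition regular :: "int \<times> nat \<Rightarrow> (int \<times> nat) drive \<Rightarrow> bool" where
  "regular s \<omega> \<longleftrightarrow> (\<forall>i. 0 < fst (\<omega> i) \<and> (\<forall>s. snd (\<omega> i) s \<in> set_pmf (\<kappa> s))) \<and>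
     filterlim (cont_time s \<omega>) at_top sequentially"

lemma AE_regular: "AE \<omega> in drivers. regular s \<omega>"
  using AE_drivers no_explosion_Z[of s] by eventually_elim (simp add: regular_def)

definition cont_path :: "int \<times> nat \<Rightarrow> (int \<times> nat) drive \<Rightarrow> real \<Rightarrow> int" where
  "cont_path s \<omega> = step_path (cont_time s \<omega>) (\<lambda>i. fst (state s \<omega> i))"

lemma measurable_cont_path: "(\<lambda>\<omega>. cont_path s \<omega> t) \<in> measurable drivers (count_space UNIV)"
  unfolding cont_path_def
proof (rule measurable_step_path)
  show "Measurable.pred drivers (\<lambda>\<omega>. t < cont_time s \<omega> i)" for i
    using measurable_cont_time[of s i] by simp
  show "(\<lambda>\<omega>. fst (state s \<omega> i)) \<in> measurable drivers (count_space UNIV)" for i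
    by (rule measurable_compose[OF measurable_state]) simp
qed

lemma cont_time_0: "cont_time s \<omega> 0 = 0"
  by (simp add: cont_time_def)

lemma cont_time_strict: "regular s \<omega> \<Longrightarrow> cont_time s \<omega> i < cont_time s \<omega> (Suc i)"
  using rate_Z_pos[OF q] by (simp add: cont_time_def cont_hold_def regular_def)

lemma ex_cont_time_interval:
  assumes "regular s \<omega>" "0 \<le> t"
  shows "\<exists>i. cont_time s \<omega> i \<le> t \<and> t < cont_time s \<omega> (Suc i)"
proof -
  have "eventually (\<lambda>j. t < cont_time s \<omega> j) sequentially"
    using assms(1) by (auto simp: regular_def filterlim_at_top_dense)
  then obtain j where "t < cont_time s \<omega> j" by (auto simp: eventually_sequentially)
  then show ?thesis using assms(2) by (intro ex_step_interval[of "cont_time s \<omega>"]) (simp add: cont_time_0)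
qed

lemma cont_path_eq:
  "regular s \<omega> \<Longrightarrow> cont_time s \<omega> i \<le> t \<Longrightarrow> t < cont_time s \<omega> (Suc i) \<Longrightarrow> cont_path s \<omega> t = fst (state s \<omega> i)"
  unfolding cont_path_def by (rule step_path_eq) (auto intro: less_imp_le cont_time_strict)

lemma cont_path_right_continuous:
  assumes "regular s \<omega>" "0 \<le> t"
  shows "eventually (\<lambda>u. cont_path s \<omega> u = cont_path s \<omega> t) (at_right t)"
proof -
  obtain i where "cont_time s \<omega> i \<le> t" "t < cont_time s \<omega> (Suc i)" using ex_cont_time_interval[OF assms] by blast
  then show ?thesis
    unfolding cont_path_def by (intro step_path_right_continuous[of _ i]) (auto intro: less_imp_le cont_time_strict assms)
qed

lemma state_moves:
  assumes "regular s \<omega>"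
  shows "fst (state s \<omega> (Suc i)) \<noteq> fst (state s \<omega> i)" "snd (state s \<omega> (Suc i)) \<noteq> snd (state s \<omega> i)"
    "snd (state s \<omega> (Suc i)) \<in> set_pmf (two_steps q (2 * h) (snd (state s \<omega> i)))"
proof -
  let ?s = "state s \<omega> i"
  have "snd (\<omega> i) ?s \<in> set_pmf (\<kappa> ?s)" using assms unfolding regular_def by blast
  then have "fst (snd (\<omega> i) ?s) \<in> set_pmf (map_pmf fst (\<kappa> ?s))" "snd (snd (\<omega> i) ?s) \<in> set_pmf (map_pmf snd (\<kappa> ?s))"
    by auto
  moreover have "set_pmf (two_steps q (2 * h) (snd ?s)) \<inter> - {snd ?s} \<noteq> {}"
    using two_steps_support[OF q h, of "snd ?s"] by blast
  ultimately show "fst (state s \<omega> (Suc i)) \<noteq> fst ?s" "snd (state s \<omega> (Suc i)) \<noteq> snd ?s"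
    "snd (state s \<omega> (Suc i)) \<in> set_pmf (two_steps q (2 * h) (snd ?s))"
    using set_jump_Z[of q "fst ?s"] by (auto simp: \<kappa>1 \<kappa>2)
qed

lemma state_le: "regular s \<omega> \<Longrightarrow> snd s \<le> 2 * h \<Longrightarrow> snd (state s \<omega> i) \<le> 2 * h"
proof (induction i)
  case (Suc i)
  then show ?case using two_steps_le[OF q _ state_moves(3)[of s \<omega> i]] by blast
qed simp

lemma disc_path_le: "regular s \<omega> \<Longrightarrow> snd s \<le> 2 * h \<Longrightarrow> disc_path s \<omega> k \<le> 2 * h"
  using ex_disc_time_interval[of s \<omega> k] disc_path_eq[of s \<omega> _ k] state_le[of s \<omega>] by metis

lemma cont_path_jumps:
  assumes "regular s \<omega>"
  shows "jump_time (cont_path s \<omega>) i = ereal (cont_time s \<omega> i)" "jump_chain (cont_path s \<omega>) i = fst (state s \<omega> i)"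
proof -
  note J = jump_times_of_step_function[of "cont_time s \<omega>" "cont_path s \<omega>" "\<lambda>i. fst (state s \<omega> i)",
      OF cont_time_0 cont_time_strict[OF assms] cont_path_eq[OF assms] state_moves(1)[OF assms]]
  show "jump_time (cont_path s \<omega>) i = ereal (cont_time s \<omega> i)" "jump_chain (cont_path s \<omega>) i = fst (state s \<omega> i)"
    by (rule J; assumption)+
qed

lemma disc_path_jumps:
  assumes "regular s \<omega>"
  defines "f \<equiv> \<lambda>t. int (disc_path s \<omega> (nat \<lfloor>time_scale q h * t\<rfloor>)) - int h"
  shows "jump_time f i = ereal (real (disc_time s \<omega> i) / time_scale q h)"
    and "jump_chain f i = int (snd (state s \<omega> i)) - int h"
proof -
  have ts: "0 < time_scale q h" using q by (rule time_scale_pos)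
  let ?\<tau> = "\<lambda>i. real (disc_time s \<omega> i) / time_scale q h" and ?v = "\<lambda>i. int (snd (state s \<omega> i)) - int h"
  have 0: "?\<tau> 0 = 0" by (simp add: disc_time_def)
  have mono: "?\<tau> i < ?\<tau> (Suc i)" for i using disc_time_strict[of s \<omega> i] ts by (simp add: divide_strict_right_mono)
  have f: "f t = ?v i" if "?\<tau> i \<le> t" "t < ?\<tau> (Suc i)" for i t
  proof -
    have "real (disc_time s \<omega> i) \<le> time_scale q h * t" "time_scale q h * t < real (disc_time s \<omega> (Suc i))"
      using that ts by (simp_all add: pos_divide_le_eq pos_less_divide_eq mult.commute)
    then have "int (disc_time s \<omega> i) \<le> \<lfloor>time_scale q h * t\<rfloor>" "\<lfloor>time_scale q h * t\<rfloor> < int (disc_time s \<omega> (Suc i))"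
      by (simp_all add: le_floor_iff floor_less_iff)
    then have "disc_time s \<omega> i \<le> nat \<lfloor>time_scale q h * t\<rfloor>" "nat \<lfloor>time_scale q h * t\<rfloor> < disc_time s \<omega> (Suc i)" by linarith+
    then show ?thesis by (simp add: f_def disc_path_eq)
  qed
  have v: "?v (Suc i) \<noteq> ?v i" for i using state_moves(2)[OF assms(1), of i] by simp
  note J = jump_times_of_step_function[of ?\<tau> f ?v, OF 0 mono f v]
  show "jump_time f i = ereal (?\<tau> i)" "jump_chain f i = ?v i" by (rule J; assumption)+
qed

lemma cont_chain_law:
  "measure drivers {\<omega>. \<forall>i\<le>k. fst (state s \<omega> i) = x i}
    = (if fst s = x 0 then \<Prod>i<k. pmf (jump_Z q (x i)) (x (Suc i)) else 0)"
proof -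
  have m: "{\<omega>. \<forall>i\<le>k. fst (state s \<omega> i) = x i \<and> 0 < fst (\<omega> i)} \<in> sets drivers"
    by (intro sets_drivers_Collect measurable_cont_path_event[where t = "\<lambda>_. 0"])
  have m': "{\<omega>. \<forall>i\<le>k. fst (state s \<omega> i) = x i} \<in> sets drivers"
    using sets_path_event[of "\<lambda>i \<omega>. fst (state s \<omega> i)" drivers k x, OF measurable_compose[OF measurable_state]] by simp
  have "measure drivers {\<omega>. \<forall>i\<le>k. fst (state s \<omega> i) = x i}
      = measure drivers {\<omega>. \<forall>i\<le>k. fst (state s \<omega> i) = x i \<and> 0 < fst (\<omega> i)}"
    by (intro drivers.finite_measure_eq_AE m m') (use AE_drivers in \<open>eventually_elim, auto\<close>)
  also have "\<dots> = (if fst s = x 0 then \<Prod>i<k. pmf (jump_Z q (x i)) (x (Suc i)) else 0)"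
    using cont_path_joint_law[of "\<lambda>_. 0" k s x] unfolding measure_def by (simp add: prod_nonneg)
  finally show ?thesis .
qed

text \<open>The sample space is a copy of the product of the drivers and the bridges on which all drivers are regular and all
bridges take possible values. Every probability is then transferred to that of an event about the drivers.\<close>

lemma realisation:
  fixes a :: int
  assumes a: "\<bar>a\<bar> \<le> int h"
  defines "s \<equiv> (a, nat (a + int h))" and "n \<equiv> 2 * h"
  shows "\<exists>(M :: (nat \<Rightarrow> real) measure) (X :: nat \<Rightarrow> (nat \<Rightarrow> real) \<Rightarrow> nat) (Z :: real \<Rightarrow> (nat \<Rightarrow> real) \<Rightarrow> int).
       discrete_markov_chain M {0..n} (P_mat q n) X \<and>
       continuous_markov_chain M (Q_Z q) Z \<and>
       (\<forall>\<omega>\<in>space M. Y_proc q n X 0 \<omega> = a \<and> Z 0 \<omega> = a) \<and>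
       (\<forall>N D \<beta>. \<P>(\<omega> in M.
           (\<forall>i\<le>N. jump_chain (\<lambda>t. Y_proc q n X t \<omega>) i = jump_chain (\<lambda>t. Z t \<omega>) i) \<and>
           (\<forall>i\<le>N. \<bar>jump_time (\<lambda>t. Y_proc q n X t \<omega>) i - jump_time (\<lambda>t. Z t \<omega>) i\<bar> \<le> ereal D) \<and>
           jump_time (\<lambda>t. Z t \<omega>) N \<ge> ereal \<beta>) = measure drivers {\<omega>. close s N D \<beta> \<omega>})"
proof -
  define K where "K = one_step q n"
  define M0 where "M0 = drivers \<Otimes>\<^sub>M bridges K"
  interpret B: prob_space "bridges K" by (rule prob_space_bridges)
  interpret P: pair_prob_space drivers "bridges K" ..
  have M0: "prob_space M0" unfolding M0_def by unfold_locales
  have sp0: "space M0 = UNIV" by (simp add: M0_def space_pair_measure)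
  have s: "fst s = a" "snd s \<le> n" "int (snd s) = a + int h" using a by (auto simp: s_def n_def)
  have f1: "fst \<in> measurable M0 drivers" "distr M0 drivers fst = drivers"
    unfolding M0_def by (auto intro: distr_fst_pair B.prob_space_axioms)
  have f2: "snd \<in> measurable M0 (bridges K)" "distr M0 (bridges K) snd = bridges K"
    unfolding M0_def by (auto intro: distr_snd_pair B.prob_space_axioms drivers.prob_space_axioms)
  define Q where "Q z \<longleftrightarrow> regular s (fst z) \<and> (\<forall>(k :: nat) w w'. snd z (k, w, w') \<in> set_pmf (bridge K w w'))" for z
  have "AE z in M0. regular s (fst z)"
    by (rule AE_distrD[OF f1(1), unfolded f1(2), OF AE_regular])
  moreover have "AE z in M0. \<forall>k w w'. snd z (k, w, w') \<in> set_pmf (bridge K w w')"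
    by (rule AE_distrD[OF f2(1), unfolded f2(2), OF AE_bridges])
  ultimately have "AE z in M0. Q z" by eventually_elim (simp add: Q_def)
  from exists_copy_satisfying[OF M0 inj_flatten this] obtain M :: "(nat \<Rightarrow> real) measure" and g
    where M: "prob_space M" and g: "g \<in> measurable M M0" "distr M M0 g = M0" and gQ: "\<And>\<omega>. \<omega> \<in> space M \<Longrightarrow> Q (g \<omega>)"
    by blast
  interpret M: prob_space M by fact
  define \<phi> where "\<phi> \<omega> = fst (g \<omega>)" for \<omega>
  have \<phi>: "\<phi> \<in> measurable M drivers" unfolding \<phi>_def by (rule measurable_compose[OF g(1) f1(1)])
  have \<phi>d: "distr M drivers \<phi> = drivers"
  proof -
    have "distr M drivers (fst \<circ> g) = distr (distr M M0 g) drivers fst" by (rule distr_distr[symmetric, OF f1(1) g(1)])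
    also have "\<dots> = drivers" unfolding g(2) f1(2) ..
    also have "fst \<circ> g = \<phi>" by (auto simp: \<phi>_def)
    finally show ?thesis .
  qed
  have reg: "regular s (\<phi> \<omega>)" if "\<omega> \<in> space M" for \<omega> using gQ[OF that] by (simp add: Q_def \<phi>_def)
  have transfer: "\<P>(\<omega> in M. E (\<phi> \<omega>)) = measure drivers {\<omega>. E \<omega>}" if "{\<omega>. E \<omega>} \<in> sets drivers" for E
    using measure_distr_Collect[OF \<phi> \<phi>d, of E] that by simp
  define X where "X i \<omega> = refine (disc_path s (fst (g \<omega>))) (snd (g \<omega>)) i" for i \<omega>
  define Z where "Z t \<omega> = cont_path s (\<phi> \<omega>) t" for t \<omega>

  have measX: "(\<lambda>z. refine (disc_path s (fst z)) (snd z) i) \<in> measurable M0 (count_space UNIV)" for i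
    unfolding M0_def using measurable_refine[of "\<lambda>k \<omega>. disc_path s \<omega> k", OF measurable_disc_path] by simp
  have Xle: "X i \<omega> \<le> n" if "\<omega> \<in> space M" for i \<omega>
  proof (cases "even i")
    case True
    then show ?thesis using disc_path_le[OF reg[OF that], of "i div 2"] s by (simp add: X_def refine_def \<phi>_def n_def)
  next
    case False
    let ?w = "disc_path s (\<phi> \<omega>)"
    have w: "?w (i div 2) \<le> n" using disc_path_le[OF reg[OF that], of "i div 2"] s by (simp add: n_def)
    have "X i \<omega> \<in> set_pmf (bridge K (?w (i div 2)) (?w (Suc (i div 2))))"
      using gQ[OF that] False by (simp add: X_def refine_def Q_def \<phi>_def)
    then have "X i \<omega> \<in> insert (?w (i div 2)) (set_pmf (K (?w (i div 2))))" using set_pmf_bridge[of K] by blast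
    then show ?thesis using w set_one_step[OF q w] by (auto simp: K_def)
  qed
  have dmc: "discrete_markov_chain M {0..n} (P_mat q n) X"
  proof (rule discrete_markov_chainI[where init = "snd s"])
    show "prob_space M" by fact
    show "X i \<in> measurable M (count_space {0..n})" for i
    proof -
      have "X i \<in> measurable M (count_space UNIV)"
        unfolding X_def by (rule measurable_compose[OF g(1) measX])
      then show ?thesis
        using Xle by (intro measurable_count_space_eq2_countable[THEN iffD2]) (auto intro: measurable_sets)
    qed
    fix k and x :: "nat \<Rightarrow> nat" assume x: "\<And>i. i \<le> k \<Longrightarrow> x i \<in> {0..n}"
    let ?E = "\<lambda>z. \<forall>i\<le>k. refine (disc_path s (fst z)) (snd z) i = x i"
    have law: "emeasure M0 {z \<in> space M0. ?E z} = (if snd s = x 0 then ennreal (\<Prod>i<k. pmf (K (x i)) (x (Suc i))) else 0)"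
      unfolding M0_def
    proof (rule refine_law[of drivers "\<lambda>k \<omega>. disc_path s \<omega> k", OF drivers.prob_space_axioms measurable_disc_path])
      show "emeasure drivers {\<omega> \<in> space drivers. \<forall>j\<le>m. disc_path s \<omega> j = w j} =
          (if snd s = w 0 then ennreal (\<Prod>j<m. pmf (bind_pmf (K (w j)) K) (w (Suc j))) else 0)" for m w
        using disc_path_law[of m s w] by (simp add: K_def two_steps_def n_def)
    qed
    have "{z \<in> space M0. ?E z} \<in> sets M0" by (rule sets_path_event[OF measX])
    then have "\<P>(\<omega> in M. \<forall>i\<le>k. X i \<omega> = x i) = measure M0 {z \<in> space M0. ?E z}"
      unfolding X_def by (rule measure_distr_Collect[OF g])
    also have "\<dots> = (if snd s = x 0 then \<Prod>i<k. pmf (K (x i)) (x (Suc i)) else 0)"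
      unfolding measure_def law by (simp add: prod_nonneg)
    also have "(\<Prod>i<k. pmf (K (x i)) (x (Suc i))) = (\<Prod>i<k. P_mat q n (x i) (x (Suc i)))"
      using x by (intro prod.cong) (auto simp: K_def pmf_one_step[OF q])
    finally show "\<P>(\<omega> in M. \<forall>i\<le>k. X i \<omega> = x i) = (if x 0 = snd s then \<Prod>i<k. P_mat q n (x i) (x (Suc i)) else 0)"
      by auto
  qed

  have Zfun: "(\<lambda>t. Z t \<omega>) = cont_path s (\<phi> \<omega>)" for \<omega> by (auto simp: Z_def)
  have Zjt: "jump_time (\<lambda>t. Z t \<omega>) i = ereal (cont_time s (\<phi> \<omega>) i)" "jump_chain (\<lambda>t. Z t \<omega>) i = fst (state s (\<phi> \<omega>) i)"
    if "\<omega> \<in> space M" for \<omega> i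
    unfolding Zfun using cont_path_jumps[OF reg[OF that]] by auto
  have Zpath: "\<P>(\<omega> in M. \<forall>i\<le>k. jump_chain (\<lambda>t. Z t \<omega>) i = x i) = (if x 0 = a then \<Prod>i<k. pmf (jump_Z q (x i)) (x (Suc i)) else 0)" for k x
  proof -
    have m': "{\<omega>. \<forall>i\<le>k. fst (state s \<omega> i) = x i} \<in> sets drivers"
      using sets_path_event[of "\<lambda>i \<omega>. fst (state s \<omega> i)" drivers k x, OF measurable_compose[OF measurable_state]] by simp
    have "{\<omega> \<in> space M. \<forall>i\<le>k. jump_chain (\<lambda>t. Z t \<omega>) i = x i} = {\<omega> \<in> space M. \<forall>i\<le>k. fst (state s (\<phi> \<omega>) i) = x i}"
      by (rule Collect_cong) (simp add: Zjt cong: conj_cong)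
    then show ?thesis using transfer[OF m'] cont_chain_law[of k s x] s(1) by auto
  qed
  have cmc: "continuous_markov_chain M (Q_Z q) Z"
    unfolding continuous_markov_chain_def
  proof (intro conjI)
    show "prob_space M" by fact
    show "\<forall>t\<ge>0. Z t \<in> measurable M (count_space UNIV)"
      unfolding Z_def by (intro allI impI measurable_compose[OF \<phi> measurable_cont_path])
    show "\<forall>\<omega>\<in>space M. \<forall>t\<ge>0. eventually (\<lambda>u. Z u \<omega> = Z t \<omega>) (at_right t)"
      unfolding Z_def using cont_path_right_continuous reg by blast
    show "discrete_markov_chain M UNIV (jump_matrix (Q_Z q)) (\<lambda>i \<omega>. jump_chain (\<lambda>t. Z t \<omega>) i)"
    proof (rule discrete_markov_chainI[where init = a])
      show "prob_space M" by fact
      show "(\<lambda>\<omega>. jump_chain (\<lambda>t. Z t \<omega>) i) \<in> measurable M (count_space UNIV)" for i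
      proof -
        have "(\<lambda>\<omega>. fst (state s \<omega> i)) \<in> measurable drivers (count_space UNIV)"
          by (rule measurable_compose[OF measurable_state]) simp
        then have "(\<lambda>\<omega>. fst (state s (\<phi> \<omega>) i)) \<in> measurable M (count_space UNIV)"
          by (rule measurable_compose[OF \<phi>])
        then show ?thesis by (subst measurable_cong[where g = "\<lambda>\<omega>. fst (state s (\<phi> \<omega>) i)"]) (auto simp: Zjt)
      qed
    qed (simp add: Zpath jump_matrix_Q_Z[OF q])
    show "\<forall>k. \<forall>x. \<forall>t. (\<forall>i\<le>k. 0 \<le> t i) \<longrightarrow>
        0 < \<P>(\<omega> in M. \<forall>i\<le>k. jump_chain (\<lambda>t. Z t \<omega>) i = x i) \<longrightarrow>
        \<P>(\<omega> in M. (\<forall>i\<le>k. ereal (t i) < jump_time (\<lambda>t. Z t \<omega>) (Suc i) - jump_time (\<lambda>t. Z t \<omega>) i)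
            \<bar> \<forall>i\<le>k. jump_chain (\<lambda>t. Z t \<omega>) i = x i)
          = (\<Prod>i\<le>k. exp (Q_Z q (x i) (x i) * t i))"
    proof (intro allI impI)
      fix k and x :: "nat \<Rightarrow> int" and t :: "nat \<Rightarrow> real"
      assume t: "\<forall>i\<le>k. 0 \<le> t i" and pos: "0 < \<P>(\<omega> in M. \<forall>i\<le>k. jump_chain (\<lambda>t. Z t \<omega>) i = x i)"
      define u where "u i = (if i \<le> k then rate_Z q (x i) * t i else 0)" for i
      have u0: "0 \<le> u i" for i using t rate_Z_pos[OF q, of "x i"] by (auto simp: u_def)
      have "{\<omega> \<in> space M. (\<forall>i\<le>k. ereal (t i) < jump_time (\<lambda>t. Z t \<omega>) (Suc i) - jump_time (\<lambda>t. Z t \<omega>) i)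
            \<and> (\<forall>i\<le>k. jump_chain (\<lambda>t. Z t \<omega>) i = x i)}
          = {\<omega> \<in> space M. \<forall>i\<le>k. fst (state s (\<phi> \<omega>) i) = x i \<and> u i < fst (\<phi> \<omega> i)}"
      proof (intro Collect_cong conj_cong refl)
        fix \<omega> assume \<omega>: "\<omega> \<in> space M"
        have "ereal (t i) < jump_time (\<lambda>t. Z t \<omega>) (Suc i) - jump_time (\<lambda>t. Z t \<omega>) i \<longleftrightarrow> u i < fst (\<phi> \<omega> i)"
          if "i \<le> k" "fst (state s (\<phi> \<omega>) i) = x i" for i
        proof -
          have "cont_time s (\<phi> \<omega>) (Suc i) - cont_time s (\<phi> \<omega>) i = fst (\<phi> \<omega> i) / rate_Z q (x i)"
            using that by (simp add: cont_time_def cont_hold_def)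
          then have "ereal (t i) < jump_time (\<lambda>t. Z t \<omega>) (Suc i) - jump_time (\<lambda>t. Z t \<omega>) i \<longleftrightarrow> t i < fst (\<phi> \<omega> i) / rate_Z q (x i)"
            by (simp only: Zjt[OF \<omega>] ereal_minus(1) less_ereal.simps(1))
          then show ?thesis using that rate_Z_pos[OF q, of "x i"] by (simp add: u_def pos_less_divide_eq mult.commute)
        qed
        then show "((\<forall>i\<le>k. ereal (t i) < jump_time (\<lambda>t. Z t \<omega>) (Suc i) - jump_time (\<lambda>t. Z t \<omega>) i)
            \<and> (\<forall>i\<le>k. jump_chain (\<lambda>t. Z t \<omega>) i = x i)) \<longleftrightarrow>
            (\<forall>i\<le>k. fst (state s (\<phi> \<omega>) i) = x i \<and> u i < fst (\<phi> \<omega> i))"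
          using Zjt(2)[OF \<omega>] by auto
      qed
      then have "\<P>(\<omega> in M. (\<forall>i\<le>k. ereal (t i) < jump_time (\<lambda>t. Z t \<omega>) (Suc i) - jump_time (\<lambda>t. Z t \<omega>) i)
            \<and> (\<forall>i\<le>k. jump_chain (\<lambda>t. Z t \<omega>) i = x i))
          = measure drivers {\<omega>. \<forall>i\<le>k. fst (state s \<omega> i) = x i \<and> u i < fst (\<omega> i)}"
        using transfer[OF sets_drivers_Collect[OF measurable_cont_path_event]] by simp
      also have "\<dots> = (if a = x 0 then (\<Prod>i<k. pmf (jump_Z q (x i)) (x (Suc i))) * (\<Prod>i\<le>k. exp (- u i)) else 0)"
        using cont_path_joint_law[OF u0, of k s x] s(1) unfolding measure_def
        by (auto simp: prod_nonneg intro!: enn2real_ennreal mult_nonneg_nonneg)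
      also have "(\<Prod>i\<le>k. exp (- u i)) = (\<Prod>i\<le>k. exp (Q_Z q (x i) (x i) * t i))"
        by (intro prod.cong) (auto simp: u_def Q_Z_diag)
      finally have joint: "\<P>(\<omega> in M. (\<forall>i\<le>k. ereal (t i) < jump_time (\<lambda>t. Z t \<omega>) (Suc i) - jump_time (\<lambda>t. Z t \<omega>) i)
            \<and> (\<forall>i\<le>k. jump_chain (\<lambda>t. Z t \<omega>) i = x i))
          = (if a = x 0 then (\<Prod>i<k. pmf (jump_Z q (x i)) (x (Suc i))) * (\<Prod>i\<le>k. exp (Q_Z q (x i) (x i) * t i)) else 0)" .
      define c where "c = (\<Prod>i<k. pmf (jump_Z q (x i)) (x (Suc i)))"
      have "x 0 = a" "c \<noteq> 0" using pos unfolding Zpath c_def[symmetric] by (auto split: if_splits)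
      then show "\<P>(\<omega> in M. (\<forall>i\<le>k. ereal (t i) < jump_time (\<lambda>t. Z t \<omega>) (Suc i) - jump_time (\<lambda>t. Z t \<omega>) i)
            \<bar> \<forall>i\<le>k. jump_chain (\<lambda>t. Z t \<omega>) i = x i)
          = (\<Prod>i\<le>k. exp (Q_Z q (x i) (x i) * t i))"
        unfolding cond_prob_def joint Zpath c_def[symmetric] by simp
    qed
    show "AE \<omega> in M. (\<lambda>i. jump_time (\<lambda>t. Z t \<omega>) i) \<longlonglongrightarrow> \<infinity>"
    proof (rule AE_I2)
      fix \<omega> assume "\<omega> \<in> space M"
      then show "(\<lambda>i. jump_time (\<lambda>t. Z t \<omega>) i) \<longlonglongrightarrow> \<infinity>"
        using reg[of \<omega>] by (simp add: Zjt regular_def tendsto_PInfty_eq_at_top)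
    qed
  qed

  have powr: "real q powr (real n / 2) * (real q - 1) = time_scale q h"
    using q by (simp add: n_def time_scale_def powr_realpow)
  have Y: "Y_proc q n X t \<omega> = int (disc_path s (\<phi> \<omega>) (nat \<lfloor>time_scale q h * t\<rfloor>)) - int h" for t \<omega>
    unfolding Y_proc_def powr by (simp add: X_def refine_def \<phi>_def n_def)
  have start: "Y_proc q n X 0 \<omega> = a" "Z 0 \<omega> = a" if "\<omega> \<in> space M" for \<omega>
    using s(3) cont_path_eq[OF reg[OF that], of 0 0] cont_time_strict[OF reg[OF that], of 0]
    by (simp_all add: Y disc_path_0 Z_def cont_time_0 s(1))
  have "\<P>(\<omega> in M.
           (\<forall>i\<le>N. jump_chain (\<lambda>t. Y_proc q n X t \<omega>) i = jump_chain (\<lambda>t. Z t \<omega>) i) \<and>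
           (\<forall>i\<le>N. \<bar>jump_time (\<lambda>t. Y_proc q n X t \<omega>) i - jump_time (\<lambda>t. Z t \<omega>) i\<bar> \<le> ereal D) \<and>
           jump_time (\<lambda>t. Z t \<omega>) N \<ge> ereal \<beta>) = measure drivers {\<omega>. close s N D \<beta> \<omega>}" for N D \<beta>
  proof -
    have "{\<omega> \<in> space M. (\<forall>i\<le>N. jump_chain (\<lambda>t. Y_proc q n X t \<omega>) i = jump_chain (\<lambda>t. Z t \<omega>) i) \<and>
           (\<forall>i\<le>N. \<bar>jump_time (\<lambda>t. Y_proc q n X t \<omega>) i - jump_time (\<lambda>t. Z t \<omega>) i\<bar> \<le> ereal D) \<and>
           jump_time (\<lambda>t. Z t \<omega>) N \<ge> ereal \<beta>} = {\<omega> \<in> space M. close s N D \<beta> (\<phi> \<omega>)}"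
    proof (intro Collect_cong conj_cong refl)
      fix \<omega> assume \<omega>: "\<omega> \<in> space M"
      show "((\<forall>i\<le>N. jump_chain (\<lambda>t. Y_proc q n X t \<omega>) i = jump_chain (\<lambda>t. Z t \<omega>) i) \<and>
           (\<forall>i\<le>N. \<bar>jump_time (\<lambda>t. Y_proc q n X t \<omega>) i - jump_time (\<lambda>t. Z t \<omega>) i\<bar> \<le> ereal D) \<and>
           jump_time (\<lambda>t. Z t \<omega>) N \<ge> ereal \<beta>) \<longleftrightarrow> close s N D \<beta> (\<phi> \<omega>)"
        unfolding Y Zjt[OF \<omega>] disc_path_jumps[OF reg[OF \<omega>]] close_def by auto
    qed
    then show ?thesis using transfer[OF sets_drivers_Collect[OF measurable_close]] by simp
  qed
  then show ?thesis using dmc cmc start by blast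
qed

end

section \<open>The coupling theorem\<close>

lemma eventually_error_terms_small:
  fixes K A :: real assumes "0 < K"
  shows "eventually (\<lambda>z. 1 \<le> z \<and> A / z ^ 4 \<le> 1 / 2 \<and> exp (- ((z ^ 3 - 1) / K)) \<le> 1 / z ^ 4 \<and>
    exp z * (9 / 10) powr (z\<^sup>2 - 1) * z\<^sup>2 \<le> 1 / z\<^sup>2) at_top"
proof (intro eventually_conj)
  show "eventually (\<lambda>z::real. 1 \<le> z) at_top" by (rule eventually_ge_at_top)
  have "((\<lambda>z::real. A / z ^ 4) \<longlongrightarrow> 0) at_top" by real_asymp
  then have "eventually (\<lambda>z::real. A / z ^ 4 < 1 / 2) at_top" by (rule order_tendstoD) simp
  then show "eventually (\<lambda>z::real. A / z ^ 4 \<le> 1 / 2) at_top" by eventually_elim simp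
  show "eventually (\<lambda>z::real. exp (- ((z ^ 3 - 1) / K)) \<le> 1 / z ^ 4) at_top"
    using assms by real_asymp
  show "eventually (\<lambda>z::real. exp z * (9 / 10) powr (z\<^sup>2 - 1) * z\<^sup>2 \<le> 1 / z\<^sup>2) at_top"
    by real_asymp
qed

text \<open>With \<open>z = q^(\<alpha> n)\<close> the number of jumps is \<open>N = \<lfloor>z^2\<rfloor>\<close> and every error term is at most a constant times
\<open>z^-2\<close> for \<open>z \<ge> z0\<close>. For smaller \<open>z\<close> the bound on the probability is not positive by the
choice of \<open>C\<close>; the processes are still constructed in the same way.\<close>

theorem theorem2:
  fixes q :: nat
  assumes "primepow q"
  shows "\<exists>C :: real. \<forall>(n :: nat) (a :: int).
    n > 0 \<longrightarrow> even n \<longrightarrow> real_of_int \<bar>a\<bar> \<le> 2 * \<alpha> * real n \<longrightarrow>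
    (\<exists>(M :: (nat \<Rightarrow> real) measure) (X :: nat \<Rightarrow> (nat \<Rightarrow> real) \<Rightarrow> nat) (Z :: real \<Rightarrow> (nat \<Rightarrow> real) \<Rightarrow> int).
       discrete_markov_chain M {0..n} (P_mat q n) X \<and>
       continuous_markov_chain M (Q_Z q) Z \<and>
       (\<forall>\<omega>\<in>space M. Y_proc q n X 0 \<omega> = a \<and> Z 0 \<omega> = a) \<and>
       \<P>(\<omega> in M.
           (\<forall>i :: nat. real i \<le> real q powr (2 * \<alpha> * real n) \<longrightarrow>
              jump_chain (\<lambda>t. Y_proc q n X t \<omega>) i = jump_chain (\<lambda>t. Z t \<omega>) i) \<and>
           (\<forall>i :: nat. real i \<le> real q powr (2 * \<alpha> * real n) \<longrightarrow>
              \<bar>jump_time (\<lambda>t. Y_proc q n X t \<omega>) i - jump_time (\<lambda>t. Z t \<omega>) i\<bar>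
                \<le> ereal (real q powr (- \<alpha> * real n))) \<and>
           jump_time (\<lambda>t. Z t \<omega>) (nat \<lfloor>real q powr (2 * \<alpha> * real n)\<rfloor>)
             \<ge> ereal (real q powr (\<alpha> * real n)))
         \<ge> 1 - C * real q powr (- 2 * \<alpha> * real n))"
proof -
  have q: "2 \<le> q" using primepow_gt_Suc_0[OF assms] by simp
  define A where "A = (real q + 2) * real q"
  define K where "K = 2 * ((real q + 2) * (real q - 1))"
  have A0: "0 \<le> A" by (simp add: A_def)
  have K0: "0 < K" using q by (simp add: K_def)
  obtain z0 where z0: "\<And>z. z0 \<le> z \<Longrightarrow> 1 \<le> z \<and> A / z ^ 4 \<le> 1 / 2 \<and> exp (- ((z ^ 3 - 1) / K)) \<le> 1 / z ^ 4 \<and>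
      exp z * (9 / 10) powr (z\<^sup>2 - 1) * z\<^sup>2 \<le> 1 / z\<^sup>2"
    using eventually_error_terms_small[OF K0, of A] unfolding eventually_at_top_linorder by blast
  define C where "C = z0\<^sup>2 + (A + 3)"
  show ?thesis
  proof (intro exI[of _ C] allI impI)
    fix n :: nat and a :: int
    assume n: "0 < n" "even n" and a: "real_of_int \<bar>a\<bar> \<le> 2 * \<alpha> * real n"
    obtain h where nh: "n = 2 * h" using n(2) by (rule evenE)
    have h: "0 < h" using n(1) nh by simp
    define z where "z = real q powr (\<alpha> * real n)"
    have z1: "1 \<le> z" unfolding z_def using q by (intro ge_one_powr_ge_zero) (auto simp: \<alpha>_def)
    have z2: "real q powr (2 * \<alpha> * real n) = z\<^sup>2"
      using q by (simp add: z_def power2_eq_square powr_add[symmetric] mult.assoc)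
    have zm1: "real q powr (- \<alpha> * real n) = 1 / z" by (simp add: z_def powr_minus_divide)
    have zm2: "real q powr (- 2 * \<alpha> * real n) = 1 / z\<^sup>2"
      using z2 powr_minus_divide[of "real q" "2 * \<alpha> * real n"] by simp
    define N where "N = nat \<lfloor>z\<^sup>2\<rfloor>"
    have N: "real i \<le> z\<^sup>2 \<longleftrightarrow> i \<le> N" for i
      unfolding N_def by (simp add: le_nat_floor le_nat_iff le_floor_iff)
    have NZ: "real N \<le> z\<^sup>2" "z\<^sup>2 - 1 \<le> real N" using N[of N] by (auto simp: N_def)
    \<comment> \<open>The initial state has \<open>\<bar>a\<bar> \<le> l\<close>, and \<open>q^(-2l)\<close> is still at most \<open>z^-4\<close>.\<close>
    define l where "l = \<lfloor>2 * \<alpha> * real n\<rfloor> + 1"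
    have l: "2 * \<alpha> * real n \<le> real_of_int l" "real_of_int l \<le> 2 * \<alpha> * real n + 1"
      unfolding l_def by linarith+
    have al: "\<bar>a\<bar> \<le> l" using a l(1) by linarith
    have ah: "\<bar>a\<bar> \<le> int h"
    proof -
      have "real_of_int \<bar>a\<bar> \<le> real h" using a by (simp add: nh \<alpha>_def)
      then show ?thesis by linarith
    qed
    have "\<forall>s. \<exists>c :: (int \<times> nat) pmf. map_pmf fst c = jump_Z q (fst s) \<and>
       map_pmf snd c = cond_pmf (two_steps q (2 * h) (snd s)) (- {snd s}) \<and>
       (int (snd s) = fst s + int h \<and> \<bar>fst s\<bar> \<le> l \<longrightarrow>
         measure c {s. int (snd s) \<noteq> fst s + int h} \<le> (real q + 2) * real q powi (l - int h))"
      using exists_jump_coupling[OF q h] by blast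
    then obtain \<kappa> where "\<forall>s. map_pmf fst (\<kappa> s) = jump_Z q (fst s) \<and>
       map_pmf snd (\<kappa> s) = cond_pmf (two_steps q (2 * h) (snd s)) (- {snd s}) \<and>
       (int (snd s) = fst s + int h \<and> \<bar>fst s\<bar> \<le> l \<longrightarrow>
         measure (\<kappa> s) {s. int (snd s) \<noteq> fst s + int h} \<le> (real q + 2) * real q powi (l - int h))"
      by (rule choice[THEN exE])
    then interpret coupled_chains q h l \<kappa> using q h by unfold_locales blast+
    define s where "s = (a, nat (a + int h))"
    have s: "s \<in> matched" using al ah by (auto simp: s_def matched_def)
    have prob: "1 - C * (1 / z\<^sup>2) \<le> measure drivers {\<omega>. close s N (1 / z) z \<omega>}"
    proof (cases "z0 \<le> z")
      case False
      then have "z\<^sup>2 \<le> z0\<^sup>2" using z1 by (intro power_mono) auto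
      then have "z\<^sup>2 \<le> C" using A0 by (simp add: C_def)
      then have "1 - C * (1 / z\<^sup>2) \<le> 0" using z1 by (simp add: pos_le_divide_eq)
      then show ?thesis by (rule order_trans) simp
    next
      case True
      note E = z0[OF True]
      \<comment> \<open>Chosen so that \<open>lag thr = z^3 / time_scale q h\<close>.\<close>
      define thr where "thr = (z ^ 3 - 1) / K"
      have thr: "0 \<le> thr" unfolding thr_def using z1 K0 by (simp add: one_le_power)
      have qh: "z ^ 6 \<le> real q ^ h"
      proof -
        have "z ^ 6 = real q powr (6 * (\<alpha> * real n))" using q by (simp add: z_def powr_power mult.commute)
        \<comment> \<open>The value of \<open>\<alpha>\<close> enters here: \<open>6 * 0.08 * n \<le> n / 2\<close>.\<close>
        also have "\<dots> \<le> real q powr real h" using q by (intro powr_mono) (auto simp: \<alpha>_def nh)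
        finally show ?thesis using q by (simp add: powr_realpow)
      qed
      have ts: "z ^ 6 \<le> time_scale q h"
      proof -
        have "z ^ 6 * 1 \<le> real q ^ h * (real q - 1)" using qh q z1 by (intro mult_mono) auto
        then show ?thesis by (simp add: time_scale_def)
      qed
      have powi: "real q powi i = real q powr real_of_int i" for i using q by (simp add: powr_real_of_int')
      have ql: "real q powi (l - int h) \<le> real q / z ^ 4"
      proof -
        have "real q powi (l - int h) \<le> real q powr (2 * \<alpha> * real n + 1 - real h)"
          unfolding powi using q l by (intro powr_mono) auto
        also have "\<dots> = z\<^sup>2 * real q / real q ^ h"
          using q by (simp add: powr_diff powr_add z2 powr_realpow)
        also have "\<dots> \<le> z\<^sup>2 * real q / z ^ 6"
          using qh z1 q by (intro divide_left_mono mult_pos_pos mult_nonneg_nonneg) auto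
        also have "\<dots> = real q / z ^ 4"
          using z1 by (simp add: field_simps eval_nat_numeral)
        finally show ?thesis .
      qed
      have mism: "(real q + 2) * real q powi (l - int h) \<le> A / z ^ 4"
        using mult_left_mono[OF ql, of "real q + 2"] by (simp add: A_def)
      have q2l: "real q powi (- 2 * l) \<le> 1 / z ^ 4"
      proof -
        have "real q powi (- 2 * l) \<le> real q powr (- 2 * \<alpha> * real n + - 2 * \<alpha> * real n)"
          unfolding powi using q l by (intro powr_mono) auto
        also have "\<dots> = 1 / z ^ 4" unfolding powr_add zm2 by (simp add: eval_nat_numeral)
        finally show ?thesis .
      qed
      have D: "real N * lag thr \<le> 1 / z"
      proof -
        have "1 + 2 * ((real q + 2) * (real q - 1)) * thr = z ^ 3"
          unfolding thr_def K_def[symmetric] using K0 by simp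
        then have lag: "lag thr = z ^ 3 / time_scale q h" by (simp add: lag_def)
        have lag0: "0 \<le> lag thr" unfolding lag using z1 time_scale_pos[OF q, of h] by simp
        have "lag thr \<le> z ^ 3 / z ^ 6"
          unfolding lag using ts z1 time_scale_pos[OF q, of h] by (intro divide_left_mono mult_pos_pos) auto
        then have "real N * lag thr \<le> z\<^sup>2 * (z ^ 3 / z ^ 6)" using NZ lag0 by (intro mult_mono') auto
        also have "\<dots> = 1 / z" using z1 by (simp add: field_simps eval_nat_numeral)
        finally show ?thesis .
      qed
      have exit: "real N * (mismatch_bound + exp (- thr)) \<le> (A + 2) / z\<^sup>2"
      proof -
        have "mismatch_bound + exp (- thr) \<le> A / z ^ 4 + 1 / z ^ 4 + 1 / z ^ 4"
          using mism q2l E unfolding mismatch_bound_def thr_def by (intro add_mono) auto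
        then have "real N * (mismatch_bound + exp (- thr)) \<le> z\<^sup>2 * (A / z ^ 4 + 1 / z ^ 4 + 1 / z ^ 4)"
          using NZ mismatch_bound_nonneg by (intro mult_mono') auto
        also have "\<dots> = (A + 2) / z\<^sup>2" using z1 by (simp add: field_simps eval_nat_numeral)
        finally show ?thesis .
      qed
      have late_bound: "exp z * (9 / 10) ^ N * lyapunov (fst s) \<le> 1 / z\<^sup>2"
      proof -
        have "(9 / 10 :: real) ^ N = (9 / 10) powr real N" by (simp add: powr_realpow)
        also have "\<dots> \<le> (9 / 10) powr (z\<^sup>2 - 1)" using NZ by (intro powr_mono') auto
        finally have 1: "(9 / 10 :: real) ^ N \<le> (9 / 10) powr (z\<^sup>2 - 1)" .
        have "lyapunov a \<le> real q ^ nat \<bar>a\<bar>" unfolding lyapunov_def using q by (intro power_mono) auto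
        also have "\<dots> = real q powr real_of_int \<bar>a\<bar>" using q by (simp add: powr_realpow[symmetric])
        also have "\<dots> \<le> real q powr (2 * \<alpha> * real n)" using q a by (intro powr_mono) auto
        finally have "lyapunov a \<le> z\<^sup>2" by (simp add: z2)
        with 1 have "exp z * (9 / 10) ^ N * lyapunov (fst s) \<le> exp z * (9 / 10) powr (z\<^sup>2 - 1) * z\<^sup>2"
          using lyapunov_ge_1[of a] unfolding s_def by (intro mult_mono) auto
        with E show ?thesis by linarith
      qed
      have "1 - C * (1 / z\<^sup>2) \<le> 1 - (A + 2) / z\<^sup>2 - 1 / z\<^sup>2"
      proof -
        have "(A + 2) / z\<^sup>2 + 1 / z\<^sup>2 = (A + 3) / z\<^sup>2" by (simp add: add_divide_distrib[symmetric])
        also have "\<dots> \<le> C * (1 / z\<^sup>2)" by (simp add: C_def divide_right_mono)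
        finally show ?thesis by linarith
      qed
      also have "\<dots> \<le> 1 - real N * (mismatch_bound + exp (- thr)) - exp z * (9 / 10) ^ N * lyapunov (fst s)"
        using exit late_bound by linarith
      also have "\<dots> \<le> measure drivers {\<omega>. close s N (1 / z) z \<omega>}"
        using s _ thr D by (rule close_prob) (use mism E in linarith)
      finally show ?thesis .
    qed
    obtain M :: "(nat \<Rightarrow> real) measure" and X Z where
      "discrete_markov_chain M {0..n} (P_mat q n) X" "continuous_markov_chain M (Q_Z q) Z"
      "\<forall>\<omega>\<in>space M. Y_proc q n X 0 \<omega> = a \<and> Z 0 \<omega> = a" and
      law: "\<And>N D \<beta>. \<P>(\<omega> in M.
           (\<forall>i\<le>N. jump_chain (\<lambda>t. Y_proc q n X t \<omega>) i = jump_chain (\<lambda>t. Z t \<omega>) i) \<and>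
           (\<forall>i\<le>N. \<bar>jump_time (\<lambda>t. Y_proc q n X t \<omega>) i - jump_time (\<lambda>t. Z t \<omega>) i\<bar> \<le> ereal D) \<and>
           jump_time (\<lambda>t. Z t \<omega>) N \<ge> ereal \<beta>) = measure drivers {\<omega>. close s N D \<beta> \<omega>}"
      using realisation[OF ah] unfolding nh s_def by blast
    then show "\<exists>(M :: (nat \<Rightarrow> real) measure) (X :: nat \<Rightarrow> (nat \<Rightarrow> real) \<Rightarrow> nat) (Z :: real \<Rightarrow> (nat \<Rightarrow> real) \<Rightarrow> int).
       discrete_markov_chain M {0..n} (P_mat q n) X \<and>
       continuous_markov_chain M (Q_Z q) Z \<and>
       (\<forall>\<omega>\<in>space M. Y_proc q n X 0 \<omega> = a \<and> Z 0 \<omega> = a) \<and>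
       \<P>(\<omega> in M.
           (\<forall>i :: nat. real i \<le> real q powr (2 * \<alpha> * real n) \<longrightarrow>
              jump_chain (\<lambda>t. Y_proc q n X t \<omega>) i = jump_chain (\<lambda>t. Z t \<omega>) i) \<and>
           (\<forall>i :: nat. real i \<le> real q powr (2 * \<alpha> * real n) \<longrightarrow>
              \<bar>jump_time (\<lambda>t. Y_proc q n X t \<omega>) i - jump_time (\<lambda>t. Z t \<omega>) i\<bar>
                \<le> ereal (real q powr (- \<alpha> * real n))) \<and>
           jump_time (\<lambda>t. Z t \<omega>) (nat \<lfloor>real q powr (2 * \<alpha> * real n)\<rfloor>)
             \<ge> ereal (real q powr (\<alpha> * real n)))
         \<ge> 1 - C * real q powr (- 2 * \<alpha> * real n)"
      using prob unfolding z2 zm1 zm2 N N_def[symmetric] z_def[symmetric] law[symmetric] by blast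
  qed
qed

end
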